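(* Let $T>0$ and let $(u^{\varepsilon},v^{\varepsilon})$, $\varepsilon\in(0,1)$, be the solution of $\partial_t u^{\varepsilon}=\frac{v^{\varepsilon}-F(u^{\varepsilon})}{\varepsilon}$, $\partial_t v^{\varepsilon}=\Delta v^{\varepsilon}+\frac{F(u^{\varepsilon})-v^{\varepsilon}}{\varepsilon}$ in $\Omega$ with Neumann boundary conditions and initial data $(u_0,v_0)$, where $F$, $u_0$, $v_0$ satisfy the assumptions listed in the context. Let $p,q:(0,T)\times\Omega\times\mathbb{R}\to\mathbb{R}$ be the $L^\infty$-weak$^*$ limits (up to extraction of subsequences), as $\varepsilon\to0$, of $$(t,x,\xi)\mapsto\mathbf{1}_{0\le\xi\le u^{\varepsilon}(t,x)}\quad\text{and}\quad(t,x,\xi)\mapsto\mathbf{1}_{0\le\xi\le v^{\varepsilon}(t,x)}$$ respectively. Then there is a bounded nonnegative measure $n$ on $(0,T)\times\Omega\times\mathbb{R}$ such that $$\partial_t\left[\int_{\mathbb{R}}p(t,x,\lambda)\,\delta_{\xi=F(\lambda)}(\xi)\,d\lambda+q(t,x,\xi)\right]-\Delta_x q(t,x,\xi)=\partial_\xi n(t,x,\xi)$$ holds in the sense of distributions.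
   Context: $\Omega\subset\mathbb{R}^d$ is a smooth bounded domain. Assumptions on $F$: (1) $F\in C^1(\mathbb{R};\mathbb{R})$, $F(0)=0$, $F\ge0$ on $[0,\infty)$. (2) There are $0<\alpha_-<\alpha_+<\beta_-<\beta_+$ with $F(\beta_-)=F(\alpha_-)=:f_-$ and $F(\alpha_+)=F(\beta_+)=:f_+$; $F$ is strictly increasing on $(-\infty,\alpha_+)$ and on $(\beta_-,\infty)$ and strictly decreasing on $(\alpha_+,\beta_-)$; $\lim_{u\to\infty}F(u)=\infty$ and $\lim_{u\to-\infty}F(u)=-\infty$. The inverses of $F$ on its monotone branches are $S_1:(-\infty,f_+)\to(-\infty,\alpha_+)$, $S_2:(f_-,f_+)\to(\alpha_+,\beta_-)$, $S_3:(f_-,\infty)\to(\beta_-,\infty)$. (3) Nondegeneracy: for every (nonempty open) subinterval of $(f_-,f_+)$ and real $a_1,a_2,a_3$, if $\sum_{i=1}^3a_i\,(S_i'(r)+1)=0$ on that subinterval, then $a_1+a_2+a_3=0$. Assumptions on initial data: $u_0,v_0\ge0$, $u_0,v_0\in C^{2+\alpha}(\overline{\Omega})$ for some $\alpha\in(0,1)$, and $u_0,v_0$ satisfy the Neumann boundary condition. For each $\varepsilon$ the system, with $u^{\varepsilon}(0,x)=u_0(x)$, $v^{\varepsilon}(0,x)=v_0(x)$ and Neumann boundary conditions, has a unique global classical solution $(u^{\varepsilon},v^{\varepsilon})$ on $[0,\infty)\times\Omega$; it is nonnegative and bounded in $L^\infty$ uniformly in $\varepsilon$. The expression $\int_{\mathbb{R}}p(t,x,\lambda)\,\delta_{\xi=F(\lambda)}(\xi)\,d\lambda$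 is the distribution in $\xi$ (the push-forward of $p(t,x,\lambda)\,d\lambda$ under $F$) acting on a test function $\psi$ by $\psi\mapsto\int_{\mathbb{R}}p(t,x,\lambda)\,\psi(F(\lambda))\,d\lambda$. *)

theory Defs
  imports "HOL-Analysis.Analysis"
begin

definition partial :: "'a::euclidean_space \<Rightarrow> ('a \<Rightarrow> real) \<Rightarrow> 'a \<Rightarrow> real" where
  "partial b f x = frechet_derivative f (at x) b"

definition gradient :: "('a::euclidean_space \<Rightarrow> real) \<Rightarrow> 'a \<Rightarrow> 'a" where
  "gradient f x = (\<Sum>b\<in>Basis. partial b f x *\<^sub>R b)"

definition laplacian :: "('a::euclidean_space \<Rightarrow> real) \<Rightarrow> 'a \<Rightarrow> real" where
  "laplacian f x = (\<Sum>b\<in>Basis. partial b (partial b f) x)"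

text \<open>\<open>Ck_on k f U\<close> is only meaningful for open \<open>U\<close>: the partial derivatives are taken in the
  full space.\<close>

primrec Ck_on :: "nat \<Rightarrow> ('a::euclidean_space \<Rightarrow> real) \<Rightarrow> 'a set \<Rightarrow> bool" where
  "Ck_on 0 f U \<longleftrightarrow> continuous_on U f"
| "Ck_on (Suc k) f U \<longleftrightarrow> f differentiable_on U \<and> (\<forall>b\<in>Basis. Ck_on k (partial b f) U)"

definition smooth_on :: "('a::euclidean_space \<Rightarrow> real) \<Rightarrow> 'a set \<Rightarrow> bool" where
  "smooth_on f U \<longleftrightarrow> (\<forall>k. Ck_on k f U)"

text \<open>Near the point \<open>x0\<close> the set \<open>\<Omega>\<close> is the sublevel set of a smooth function without critical
  points; in particular its boundary near \<open>x0\<close> is a smooth hypersurface and \<open>\<Omega>\<close> lies on one side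
  of it.\<close>

definition local_defining_function ::
    "'a::euclidean_space set \<Rightarrow> 'a \<Rightarrow> 'a set \<Rightarrow> ('a \<Rightarrow> real) \<Rightarrow> bool" where
  "local_defining_function \<Omega> x0 U \<rho> \<longleftrightarrow>
     open U \<and> x0 \<in> U \<and> smooth_on \<rho> U \<and> (\<forall>x\<in>U. gradient \<rho> x \<noteq> 0) \<and>
     \<Omega> \<inter> U = {x \<in> U. \<rho> x < 0}"

definition smooth_bounded_domain :: "'a::euclidean_space set \<Rightarrow> bool" where
  "smooth_bounded_domain \<Omega> \<longleftrightarrow>
     open \<Omega> \<and> connected \<Omega> \<and> \<Omega> \<noteq> {} \<and> bounded \<Omega> \<and>
     (\<forall>x0\<in>frontier \<Omega>. \<exists>U \<rho>. local_defining_function \<Omega> x0 U \<rho>)"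

text \<open>The vector below does not depend on the chosen local defining function.\<close>

definition outer_unit_normal :: "'a::euclidean_space set \<Rightarrow> 'a \<Rightarrow> 'a \<Rightarrow> bool" where
  "outer_unit_normal \<Omega> x \<nu> \<longleftrightarrow>
     x \<in> frontier \<Omega> \<and>
     (\<exists>U \<rho>. local_defining_function \<Omega> x U \<rho> \<and> \<nu> = gradient \<rho> x /\<^sub>R norm (gradient \<rho> x))"

text \<open>Homogeneous Neumann condition. The derivative at a boundary point is the one-sided one,
  taken within the closure of the domain.\<close>

definition neumann_bc :: "'a::euclidean_space set \<Rightarrow> ('a \<Rightarrow> real) \<Rightarrow> bool" where
  "neumann_bc \<Omega> f \<longleftrightarrow>
     (\<forall>x \<nu>. outer_unit_normal \<Omega> x \<nu> \<longrightarrow>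
        (\<exists>D. (f has_derivative D) (at x within closure \<Omega>) \<and> D \<nu> = 0))"

text \<open>The space $C^{2+\alpha}(\overline\Omega)$: \<open>G\<close> is the gradient and \<open>H\<close> the Hessian (as a linear
  map), both up to the boundary. On the compact closure of a smooth bounded domain the Hoelder
  bound on \<open>H\<close> makes all the norms finite.\<close>

definition C2_Hoelder :: "real \<Rightarrow> 'a::euclidean_space set \<Rightarrow> ('a \<Rightarrow> real) \<Rightarrow> bool" where
  "C2_Hoelder \<alpha> \<Omega> f \<longleftrightarrow>
     (\<exists>G H C. \<forall>x\<in>closure \<Omega>.
        (f has_derivative (\<lambda>h. G x \<bullet> h)) (at x within closure \<Omega>) \<and>
        (G has_derivative H x) (at x within closure \<Omega>) \<and>
        (\<forall>y\<in>closure \<Omega>. \<forall>h. norm (H x h - H y h) \<le> C * dist x y powr \<alpha> * norm h))"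

text \<open>In the last condition the inverse branches are required to be differentiable at each point
  of the subinterval, so that the linear relation is meaningful there. Since \<open>F\<close> is only assumed
  to be of class $C^1$, they may fail to be differentiable at images of critical points of \<open>F\<close>.\<close>

definition nondegenerate_branches ::
    "real \<Rightarrow> real \<Rightarrow> (real \<Rightarrow> real) \<Rightarrow> (real \<Rightarrow> real) \<Rightarrow> (real \<Rightarrow> real) \<Rightarrow> bool" where
  "nondegenerate_branches f_minus f_plus S1 S2 S3 \<longleftrightarrow>
     (\<forall>a b a1 a2 a3. f_minus \<le> a \<and> a < b \<and> b \<le> f_plus \<and>
        (\<forall>r\<in>{a<..<b}.
           S1 differentiable (at r) \<and> S2 differentiable (at r) \<and> S3 differentiable (at r) \<and>
           a1 * (deriv S1 r + 1) + a2 * (deriv S2 r + 1) + a3 * (deriv S3 r + 1) = 0)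
        \<longrightarrow> a1 + a2 + a3 = 0)"

definition reaction_function ::
    "(real \<Rightarrow> real) \<Rightarrow> real \<Rightarrow> real \<Rightarrow> real \<Rightarrow> real \<Rightarrow> bool" where
  "reaction_function F \<alpha>_minus \<alpha>_plus \<beta>_minus \<beta>_plus \<longleftrightarrow>
     (\<forall>x. F differentiable (at x)) \<and> continuous_on UNIV (deriv F) \<and>
     F 0 = 0 \<and> (\<forall>x\<ge>0. F x \<ge> 0) \<and>
     0 < \<alpha>_minus \<and> \<alpha>_minus < \<alpha>_plus \<and> \<alpha>_plus < \<beta>_minus \<and> \<beta>_minus < \<beta>_plus \<and>
     F \<beta>_minus = F \<alpha>_minus \<and> F \<alpha>_plus = F \<beta>_plus \<and>
     strict_mono_on {..<\<alpha>_plus} F \<and> strict_mono_on {\<beta>_minus<..} F \<and>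
     strict_antimono_on {\<alpha>_plus<..<\<beta>_minus} F \<and>
     filterlim F at_top at_top \<and> filterlim F at_bot at_bot \<and>
     nondegenerate_branches (F \<alpha>_minus) (F \<alpha>_plus)
       (inv_into {..<\<alpha>_plus} F) (inv_into {\<alpha>_plus<..<\<beta>_minus} F) (inv_into {\<beta>_minus<..} F)"

definition initial_data :: "'a::euclidean_space set \<Rightarrow> ('a \<Rightarrow> real) \<Rightarrow> ('a \<Rightarrow> real) \<Rightarrow> bool" where
  "initial_data \<Omega> u0 v0 \<longleftrightarrow>
     (\<forall>x\<in>closure \<Omega>. u0 x \<ge> 0 \<and> v0 x \<ge> 0) \<and>
     (\<exists>\<alpha>\<in>{0<..<1}. C2_Hoelder \<alpha> \<Omega> u0 \<and> C2_Hoelder \<alpha> \<Omega> v0) \<and>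
     neumann_bc \<Omega> u0 \<and> neumann_bc \<Omega> v0"

text \<open>\<open>u\<close> and \<open>v\<close> are functions of time and space. The boundary condition is imposed on the diffusing
  component \<open>v\<close> only; \<open>u\<close> solves an ordinary differential equation at each point of the domain.\<close>

definition classical_solution ::
    "'a::euclidean_space set \<Rightarrow> (real \<Rightarrow> real) \<Rightarrow> ('a \<Rightarrow> real) \<Rightarrow> ('a \<Rightarrow> real) \<Rightarrow> real \<Rightarrow>
     (real \<Rightarrow> 'a \<Rightarrow> real) \<Rightarrow> (real \<Rightarrow> 'a \<Rightarrow> real) \<Rightarrow> bool" where
  "classical_solution \<Omega> F u0 v0 \<epsilon> u v \<longleftrightarrow>
     \<comment> \<open>regularity\<close>
     continuous_on ({0..} \<times> closure \<Omega>) (\<lambda>(t, x). u t x) \<and>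
     continuous_on ({0..} \<times> closure \<Omega>) (\<lambda>(t, x). v t x) \<and>
     (\<forall>t>0. \<forall>x\<in>\<Omega>. (\<lambda>s. u s x) differentiable (at t) \<and> (\<lambda>s. v s x) differentiable (at t)) \<and>
     continuous_on ({0<..} \<times> \<Omega>) (\<lambda>(t, x). deriv (\<lambda>s. u s x) t) \<and>
     continuous_on ({0<..} \<times> \<Omega>) (\<lambda>(t, x). deriv (\<lambda>s. v s x) t) \<and>
     (\<forall>t>0. Ck_on 2 (v t) \<Omega>) \<and>
     (\<forall>b\<in>Basis. \<forall>c\<in>Basis.
        continuous_on ({0<..} \<times> \<Omega>) (\<lambda>(t, x). partial c (partial b (v t)) x)) \<and>
     (\<exists>G. continuous_on ({0<..} \<times> closure \<Omega>) (\<lambda>(t, x). G t x) \<and>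
        (\<forall>t>0. \<forall>x\<in>closure \<Omega>. (v t has_derivative (\<lambda>h. G t x \<bullet> h)) (at x within closure \<Omega>))) \<and>
     \<comment> \<open>equations\<close>
     (\<forall>t>0. \<forall>x\<in>\<Omega>.
        deriv (\<lambda>s. u s x) t = (v t x - F (u t x)) / \<epsilon> \<and>
        deriv (\<lambda>s. v s x) t = laplacian (v t) x + (F (u t x) - v t x) / \<epsilon>) \<and>
     \<comment> \<open>boundary and initial conditions\<close>
     (\<forall>t>0. neumann_bc \<Omega> (v t)) \<and>
     (\<forall>x\<in>closure \<Omega>. u 0 x = u0 x \<and> v 0 x = v0 x)"

text \<open>Elements of $L^\infty(Q)$ are given by Borel representatives.\<close>

definition Linf_on :: "'a::euclidean_space set \<Rightarrow> ('a \<Rightarrow> real) \<Rightarrow> bool" where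
  "Linf_on Q f \<longleftrightarrow>
     set_borel_measurable lborel Q f \<and> (\<exists>C. AE z in lborel. z \<in> Q \<longrightarrow> \<bar>f z\<bar> \<le> C)"

definition Linf_weak_star_limit ::
    "'a::euclidean_space set \<Rightarrow> (nat \<Rightarrow> 'a \<Rightarrow> real) \<Rightarrow> ('a \<Rightarrow> real) \<Rightarrow> bool" where
  "Linf_weak_star_limit Q f g \<longleftrightarrow>
     Linf_on Q g \<and>
     (\<forall>h. set_integrable lborel Q h \<longrightarrow>
        (\<lambda>k. LINT z:Q|lborel. f k z * h z) \<longlonglongrightarrow> (LINT z:Q|lborel. g z * h z))"

definition phase_space :: "real \<Rightarrow> 'a::euclidean_space set \<Rightarrow> (real \<times> 'a \<times> real) set" where
  "phase_space T \<Omega> = {0<..<T} \<times> \<Omega> \<times> UNIV"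

definition test_functions :: "'a::euclidean_space set \<Rightarrow> ('a \<Rightarrow> real) set" where
  "test_functions Q =
     {\<Phi>. smooth_on \<Phi> UNIV \<and> compact (closure {z. \<Phi> z \<noteq> 0}) \<and> closure {z. \<Phi> z \<noteq> 0} \<subseteq> Q}"

text \<open>Distributions are represented by their action on test functions; the derivatives of a
  distribution are defined by duality.\<close>

type_synonym 'a distr = "(real \<times> 'a \<times> real \<Rightarrow> real) \<Rightarrow> real"

definition distr_dt :: "'a::euclidean_space distr \<Rightarrow> 'a distr" where
  "distr_dt \<Lambda> \<Phi> = - \<Lambda> (\<lambda>(t, x, \<xi>). deriv (\<lambda>s. \<Phi> (s, x, \<xi>)) t)"

definition distr_dxi :: "'a::euclidean_space distr \<Rightarrow> 'a distr" where
  "distr_dxi \<Lambda> \<Phi> = - \<Lambda> (\<lambda>(t, x, \<xi>). deriv (\<lambda>\<eta>. \<Phi> (t, x, \<eta>)) \<xi>)"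

definition distr_laplacian_x :: "'a::euclidean_space distr \<Rightarrow> 'a distr" where
  "distr_laplacian_x \<Lambda> \<Phi> = \<Lambda> (\<lambda>(t, x, \<xi>). laplacian (\<lambda>y. \<Phi> (t, y, \<xi>)) x)"

definition distr_of_fun ::
    "real \<Rightarrow> 'a::euclidean_space set \<Rightarrow> (real \<times> 'a \<times> real \<Rightarrow> real) \<Rightarrow> 'a distr" where
  "distr_of_fun T \<Omega> f \<Phi> = (LINT z:phase_space T \<Omega>|lborel. f z * \<Phi> z)"

definition distr_of_measure :: "(real \<times> 'a::euclidean_space \<times> real) measure \<Rightarrow> 'a distr" where
  "distr_of_measure n \<Phi> = (LINT z|n. \<Phi> z)"

text \<open>The action on \<open>\<psi>\<close> of $\int w(\lambda)\,\delta_{\xi = F(\lambda)}\,d\lambda$, a distribution in \<open>\<xi>\<close>.\<close>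

definition pushforward_distr :: "(real \<Rightarrow> real) \<Rightarrow> (real \<Rightarrow> real) \<Rightarrow> (real \<Rightarrow> real) \<Rightarrow> real" where
  "pushforward_distr F w \<psi> = (LINT l|lborel. w l * \<psi> (F l))"

definition kinetic_pushforward ::
    "real \<Rightarrow> 'a::euclidean_space set \<Rightarrow> (real \<Rightarrow> real) \<Rightarrow> (real \<times> 'a \<times> real \<Rightarrow> real) \<Rightarrow> 'a distr" where
  "kinetic_pushforward T \<Omega> F p \<Phi> =
     (LINT z:{0<..<T} \<times> \<Omega>|lborel.
        pushforward_distr F (\<lambda>l. p (fst z, snd z, l)) (\<lambda>\<xi>. \<Phi> (fst z, snd z, \<xi>)))"

end

(* For a nondecreasing C^1 function phi, the sum of the primitives of phi o F at u and of phi at v is an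
   entropy: up to the divergence of phi(v) grad v its time derivative is minus
     phi'(v) |grad v|^2 + (phi(F(u)) - phi(v)) (F(u) - v) / eps >= 0.
   Letting phi depend on (t,x) as well, this says that the kinetic equation holds for every eps with
     n_eps = |grad v|^2 delta(xi = v) + (F(u) - v)/eps (1(v <= xi <= F(u)) - 1(F(u) <= xi <= v)).
   A phi vanishing exactly on [0,N] yields 0 <= v, F(u) <= N, hence u >= 0, and phi(xi) = xi yields a bound
   of the total mass of n_eps that does not depend on eps.  The measures n_eps therefore have a weak limit
   point n, and the left-hand side passes to the limit because it is linear in the indicator functions.
   No trace or divergence theorem is needed: all integrations by parts involve compactly supported functions,
   and cutoffs built from the local defining functions of the domain show that the boundary does not
   contribute, since grad v is tangential there. *)
theory Submission
  imports Defs "HOL-Probability.Helly_Selection" "HOL-Probability.Giry_Monad"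
begin

text \<open>The regularity of a classical solution shapes the argument: second derivatives of
  \<open>v\<close> are continuous only inside the domain and for positive times, the gradient of
  \<open>v\<close> is continuous up to the lateral boundary, and the solution itself down to
  \<open>t = 0\<close>. Estimates over the whole domain are therefore made with cutoffs in time and
  space; removing them may use only the gradient at the boundary and only the values of
  \<open>u\<close> and \<open>v\<close> near \<open>t = 0\<close>. No limit of a nonlinear
  expression has to be identified. The term with \<open>u\<close> is the integral over
  \<open>l\<close> of \<open>1(0 \<le> l \<le> u)\<close> against the time derivative of the test
  function at \<open>(t, x, F l)\<close>. This is a fixed continuous function of
  \<open>(t, x, l)\<close>, of compact support because \<open>F\<close> is unbounded at both ends;
  it is the origin of the push-forward under \<open>F\<close>. The weak limit is taken over the
  whole space, where one ball carries all the measures, so that no mass escapes. Mass that reaches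
  the boundary of the phase space is removed by restriction, which test functions with compact
  support in the open set do not notice.\<close>

section \<open>Integration by parts with compact support\<close>

lemma set_integrable_continuous_compact_support:
  fixes g :: "'a::euclidean_space \<Rightarrow> real"
  assumes "open U" "compact K" "K \<subseteq> U" "continuous_on U g" "\<And>x. x \<in> U - K \<Longrightarrow> g x = 0"
  shows "set_integrable lborel U g"
proof -
  have "set_integrable lborel K g"
    unfolding set_integrable_def
    by (rule borel_integrable_compact) (use assms continuous_on_subset in auto)
  moreover have "indicator U x *\<^sub>R g x = indicator K x *\<^sub>R g x" for x
    using assms(3,5) by (auto simp: indicator_def)
  ultimately show ?thesis unfolding set_integrable_def by (simp only:)
qed

lemma continuous_on_zero_extension:
  fixes g :: "'a::euclidean_space \<Rightarrow> 'b::real_normed_vector"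
  assumes "open U" "compact K" "K \<subseteq> U" "continuous_on U g" "\<And>x. x \<in> U - K \<Longrightarrow> g x = 0"
  shows "continuous_on UNIV (\<lambda>x. indicator U x *\<^sub>R g x)"
proof -
  have 1: "continuous_on U (\<lambda>x. indicator U x *\<^sub>R g x)"
    by (rule continuous_on_eq[OF assms(4)]) auto
  have 2: "continuous_on (-K) (\<lambda>x. indicator U x *\<^sub>R g x)"
    by (rule continuous_on_eq[OF continuous_on_const[of _ 0]]) (use assms(5) in \<open>auto simp: indicator_def\<close>)
  have "continuous_on (U \<union> -K) (\<lambda>x. indicator U x *\<^sub>R g x)"
    by (rule continuous_on_open_Un[OF assms(1) _ 1 2]) (use assms compact_imp_closed in auto)
  moreover have "U \<union> -K = UNIV" using assms(3) by auto
  ultimately show ?thesis by simp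
qed

text \<open>Difference quotients of the zero extension have integral 0 by translation invariance,
  and the mean value theorem bounds them by the supremum of \<open>|g|\<close>, so dominated
  convergence applies. A derivative along the single direction \<open>b\<close> is enough; this
  matters for functions of time and space that are differentiated in one variable only.\<close>

lemma integral_directional_derivative_eq_0:
  fixes f g :: "'a::euclidean_space \<Rightarrow> real"
  assumes U: "open U" "compact K" "K \<subseteq> U"
    and f: "continuous_on U f" "\<And>x. x \<in> U - K \<Longrightarrow> f x = 0"
    and g: "continuous_on U g"
    and deriv: "\<And>x. x \<in> U \<Longrightarrow> ((\<lambda>s. f (x + s *\<^sub>R b)) has_real_derivative g x) (at 0)"
  shows "set_integrable lborel U g \<and> (LINT x:U|lborel. g x) = 0"
proof -
  define f0 where "f0 x = indicator U x * f x" for x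
  define g0 where "g0 x = indicator U x * g x" for x
  have cl: "closed K" using U compact_imp_closed by auto
  have loc0: "\<forall>\<^sub>F s in nhds 0. x + s *\<^sub>R b \<in> W" if "open W" "x \<in> W" for x W
  proof -
    have "((\<lambda>s. x + s *\<^sub>R b) \<longlongrightarrow> x + 0 *\<^sub>R b) (nhds 0)"
      by (intro tendsto_intros filterlim_ident)
    then show ?thesis using that by (simp add: tendsto_def)
  qed
  have g_zero: "g x = 0" if "x \<in> U - K" for x
  proof -
    have "open (U - K)" using U(1) cl by auto
    then have "\<forall>\<^sub>F s in nhds 0. f (x + s *\<^sub>R b) = 0"
      by (rule eventually_mono[OF loc0]) (use that f(2) in auto)
    then have "((\<lambda>s. f (x + s *\<^sub>R b)) has_real_derivative 0) (at 0)"
      by (subst DERIV_cong_ev) auto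
    with deriv that DERIV_unique show ?thesis by blast
  qed
  have int: "set_integrable lborel U g"
    by (rule set_integrable_continuous_compact_support[OF U g g_zero])
  have cf0: "continuous_on UNIV f0"
    using continuous_on_zero_extension[OF U f] by (simp add: f0_def)
  have cg0: "continuous_on UNIV g0"
    using continuous_on_zero_extension[OF U g g_zero] by (simp add: g0_def)
  have d0: "((\<lambda>s. f0 (x + s *\<^sub>R b)) has_real_derivative g0 x) (at 0)" for x
  proof (cases "x \<in> U")
    case True
    have "\<forall>\<^sub>F s in nhds 0. f (x + s *\<^sub>R b) = f0 (x + s *\<^sub>R b)"
      by (rule eventually_mono[OF loc0[OF U(1) True]]) (auto simp: f0_def)
    then have "((\<lambda>s. f0 (x + s *\<^sub>R b)) has_real_derivative g x) (at 0)"
      using deriv[OF True] by (subst (asm) DERIV_cong_ev) auto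
    then show ?thesis using True by (simp add: g0_def)
  next
    case False
    then have x: "x \<in> - K" using U by auto
    have "\<forall>\<^sub>F s in nhds 0. f0 (x + s *\<^sub>R b) = 0"
      by (rule eventually_mono[OF loc0[of "-K" x]]) (use cl x f(2) in \<open>auto simp: f0_def indicator_def\<close>)
    then have "((\<lambda>s. f0 (x + s *\<^sub>R b)) has_real_derivative 0) (at 0)"
      by (subst DERIV_cong_ev) auto
    then show ?thesis using False by (simp add: g0_def)
  qed
  have dall: "((\<lambda>s. f0 (x + s *\<^sub>R b)) has_real_derivative g0 (x + r *\<^sub>R b)) (at r)" for x r
  proof -
    have "((\<lambda>s. f0 ((x + r *\<^sub>R b) + (s - r) *\<^sub>R b)) has_real_derivative g0 (x + r *\<^sub>R b)) (at r)"
      using d0[of "x + r *\<^sub>R b"]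
        DERIV_shift[of "\<lambda>s. f0 ((x + r *\<^sub>R b) + (s - r) *\<^sub>R b)" "g0 (x + r *\<^sub>R b)" 0 r]
      by simp
    then show ?thesis by (simp add: algebra_simps)
  qed
  obtain C where C: "\<And>x. \<bar>g0 x\<bar> \<le> C" "C \<ge> 0"
  proof -
    have "bounded (g0 ` K)"
      by (intro compact_imp_bounded compact_continuous_image) (use cg0 U continuous_on_subset in blast)+
    then obtain C where "\<And>x. x \<in> K \<Longrightarrow> \<bar>g0 x\<bar> \<le> C" by (auto simp: bounded_iff)
    then have "\<bar>g0 x\<bar> \<le> max C 0" for x
    proof (cases "x \<in> K")
      case False
      then show ?thesis using g_zero[of x] by (simp add: g0_def indicator_def)
    qed (use \<open>\<And>x. x \<in> K \<Longrightarrow> \<bar>g0 x\<bar> \<le> C\<close> in \<open>fastforce simp: le_max_iff_disj\<close>)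
    then show ?thesis using that[of "max C 0"] by auto
  qed
  obtain R where R: "\<And>x. x \<in> K \<Longrightarrow> norm x \<le> R"
    using compact_imp_bounded[OF U(2)] by (auto simp: bounded_iff)
  \<comment> \<open>Step lengths of at most 1 keep the supports of all difference quotients in the
    ball of radius \<open>R + norm b\<close>.\<close>
  define h where "h n = 1 / real (Suc n)" for n
  have h: "h n > 0" "h n \<le> 1" for n by (auto simp: h_def)
  have h0: "h \<longlonglongrightarrow> 0" unfolding h_def using LIMSEQ_Suc[OF lim_1_over_n[where ?'a=real]] by simp
  define q where "q n x = (f0 (x + h n *\<^sub>R b) - f0 x) / h n" for n x
  have f0_out: "f0 x = 0" if "norm x > R" for x
    using R[of x] that f(2)[of x] by (auto simp: f0_def indicator_def)
  have q_bd: "\<bar>q n x\<bar> \<le> C * indicator (cball 0 (R + norm b)) x" for n x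
  proof (cases "norm x \<le> R + norm b")
    case True
    obtain z where "f0 (x + h n *\<^sub>R b) - f0 (x + 0 *\<^sub>R b) = (h n - 0) * g0 (x + z *\<^sub>R b)"
      using MVT2[OF h(1)[of n] dall] by blast
    then have "q n x = g0 (x + z *\<^sub>R b)" using h(1)[of n] by (simp add: q_def)
    then show ?thesis using True C by (simp add: indicator_def)
  next
    case False
    have "norm (h n *\<^sub>R b) \<le> norm b" using h[of n] by (simp add: mult_left_le_one_le)
    moreover have "norm x \<le> norm (x + h n *\<^sub>R b) + norm (h n *\<^sub>R b)"
      using norm_triangle_ineq4[of "x + h n *\<^sub>R b" "h n *\<^sub>R b"] by simp
    ultimately have "norm (x + h n *\<^sub>R b) > R" "norm x > R"
      using False norm_ge_zero[of b] by linarith+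
    then show ?thesis using f0_out C by (simp add: q_def)
  qed
  have int_f0: "integrable lborel f0"
    using set_integrable_continuous_compact_support[OF U f] by (simp add: f0_def[abs_def] set_integrable_def)
  have mf0: "f0 \<in> borel_measurable borel" and mg0: "g0 \<in> borel_measurable borel"
    using cf0 cg0 by (auto intro: borel_measurable_continuous_onI)
  have distr: "distr lborel borel ((+) c) = (lborel :: 'a measure)" for c
    by (rule lborel_distr_plus)
  have trans: "integrable lborel (\<lambda>x. f0 (x + c))" "(LINT x|lborel. f0 (x + c)) = (LINT x|lborel. f0 x)" for c
  proof -
    show "integrable lborel (\<lambda>x. f0 (x + c))"
      using int_f0 integrable_distr_eq[of "(+) c" lborel borel f0] mf0 distr[of c] by (simp add: add.commute)
    show "(LINT x|lborel. f0 (x + c)) = (LINT x|lborel. f0 x)"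
      using integral_distr[of "(+) c" lborel borel f0] mf0 distr[of c] by (simp add: add.commute)
  qed
  have int_q: "(LINT x|lborel. q n x) = 0" for n
    unfolding q_def using trans int_f0 by simp
  have "(\<lambda>n. LINT x|lborel. q n x) \<longlonglongrightarrow> (LINT x|lborel. g0 x)"
  proof (rule integral_dominated_convergence)
    show "integrable lborel (\<lambda>x. C * indicator (cball (0::'a) (R + norm b)) x)"
      by (intro integrable_mult_right integrable_real_indicator) (use emeasure_lborel_cball_finite[of "0::'a" "R + norm b"] in auto)
    show "AE x in lborel. (\<lambda>n. q n x) \<longlonglongrightarrow> g0 x"
    proof (rule AE_I2)
      fix x
      have "(\<lambda>s. (f0 (x + s *\<^sub>R b) - f0 x) / s) \<midarrow>0\<rightarrow> g0 x"
        using d0[of x] by (simp add: DERIV_def)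
      moreover have "filterlim h (at 0) sequentially"
        using h(1) h0 by (auto simp: filterlim_at less_imp_neq[symmetric])
      ultimately show "(\<lambda>n. q n x) \<longlonglongrightarrow> g0 x"
        unfolding q_def by (rule filterlim_compose)
    qed
    show "AE x in lborel. norm (q n x) \<le> C * indicator (cball 0 (R + norm b)) x" for n
      using q_bd by simp
    show "q n \<in> borel_measurable lborel" for n
      unfolding q_def using mf0 by measurable
  qed (use mg0 in auto)
  then have "(LINT x|lborel. g0 x) = 0" using LIMSEQ_unique[OF _ tendsto_const[of 0]] by (simp add: int_q)
  then show ?thesis using int by (simp add: g0_def set_lebesgue_integral_def)
qed

section \<open>Cutoffs at the boundary\<close>

lemma has_real_derivative_max_0_square:
  "((\<lambda>t. (max 0 t)\<^sup>2) has_real_derivative 2 * max 0 t) (at (t::real))"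
proof -
  consider "t < 0" | "t > 0" | "t = 0" by linarith
  then show ?thesis
  proof cases
    case 1
    have "((\<lambda>t. 0) has_real_derivative 2 * max 0 t) (at t)" using 1 by simp
    then show ?thesis
      by (rule has_field_derivative_transform_within_open[of _ _ _ "{..<0}"]) (use 1 in auto)
  next
    case 2
    have "((\<lambda>t. t\<^sup>2) has_real_derivative 2 * max 0 t) (at t)"
      using 2 by (auto intro!: derivative_eq_intros)
    then show ?thesis
      by (rule has_field_derivative_transform_within_open[of _ _ _ "{0<..}"]) (use 2 in auto)
  next
    case 3
    have "((\<lambda>h. (max 0 h)\<^sup>2 / h) \<longlongrightarrow> 0) (at (0::real))"
    proof (rule Lim_null_comparison)
      show "\<forall>\<^sub>F h in at 0. norm ((max 0 h)\<^sup>2 / h) \<le> \<bar>h\<bar>"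
        by (rule always_eventually) (auto simp: max_def power2_eq_square)
      show "((\<lambda>h. \<bar>h\<bar>) \<longlongrightarrow> 0) (at (0::real))" by (auto intro!: tendsto_eq_intros)
    qed
    then show ?thesis using 3 by (simp add: DERIV_def)
  qed
qed

lemmas DERIV_max_0_square [derivative_intros] = DERIV_chain2[OF has_real_derivative_max_0_square]

text \<open>The primitive of the tent function on \<open>[0, 1]\<close> with peak value 2 at 1/2,
  hence of area 1. It is piecewise quadratic and only of class \<open>C^1\<close>, which suffices
  because cutoffs are differentiated once.\<close>

definition smooth_step :: "real \<Rightarrow> real" where
  "smooth_step t = 2 * (max 0 t)\<^sup>2 - 4 * (max 0 (t - 1 / 2))\<^sup>2 + 2 * (max 0 (t - 1))\<^sup>2"

definition smooth_step' :: "real \<Rightarrow> real" where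
  "smooth_step' t = 4 * max 0 t - 8 * max 0 (t - 1 / 2) + 4 * max 0 (t - 1)"

lemma has_real_derivative_smooth_step: "(smooth_step has_real_derivative smooth_step' t) (at t)"
  unfolding smooth_step_def[abs_def] smooth_step'_def by (auto intro!: derivative_eq_intros)

lemma continuous_on_smooth_step [continuous_intros]:
  "continuous_on S f \<Longrightarrow> continuous_on S (\<lambda>x. smooth_step (f x))"
  unfolding smooth_step_def by (intro continuous_intros)

lemma continuous_on_smooth_step' [continuous_intros]:
  "continuous_on S f \<Longrightarrow> continuous_on S (\<lambda>x. smooth_step' (f x))"
  unfolding smooth_step'_def by (intro continuous_intros)

lemma smooth_step_measurable [measurable]:
  "smooth_step \<in> borel_measurable borel" "smooth_step' \<in> borel_measurable borel"
  unfolding smooth_step_def[abs_def] smooth_step'_def[abs_def] by measurable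

lemma smooth_step_simps:
  "t \<le> 0 \<Longrightarrow> smooth_step t = 0" "1 \<le> t \<Longrightarrow> smooth_step t = 1"
  "t \<le> 0 \<Longrightarrow> smooth_step' t = 0" "1 \<le> t \<Longrightarrow> smooth_step' t = 0"
  by (auto simp: smooth_step_def smooth_step'_def max_def power2_eq_square algebra_simps)

lemma smooth_step'_bounds: "0 \<le> smooth_step' t" "smooth_step' t \<le> 2"
  by (auto simp: smooth_step'_def max_def)

lemma smooth_step'_pos: "0 < t \<Longrightarrow> t < 1 \<Longrightarrow> 0 < smooth_step' t"
  by (auto simp: smooth_step'_def max_def)

lemma smooth_step_mono: "s \<le> t \<Longrightarrow> smooth_step s \<le> smooth_step t"
  by (rule DERIV_nonneg_imp_nondecreasing)
    (use has_real_derivative_smooth_step smooth_step'_bounds in blast)+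

lemma smooth_step_bounds: "0 \<le> smooth_step t" "smooth_step t \<le> 1"
  using smooth_step_mono[of "min t 0" t] smooth_step_mono[of t "max t 1"] smooth_step_simps(1)[of "min t 0"]
    smooth_step_simps(2)[of "max t 1"] by auto

section \<open>Local defining functions and the Neumann condition at a boundary point\<close>

lemma has_derivative_gradient:
  fixes f :: "'a::euclidean_space \<Rightarrow> real"
  assumes "f differentiable (at x)"
  shows "(f has_derivative (\<lambda>h. gradient f x \<bullet> h)) (at x)"
proof -
  obtain D where D: "(f has_derivative D) (at x)" using assms by (auto simp: differentiable_def)
  have eq: "frechet_derivative f (at x) = D" using frechet_derivative_at[OF D] by simp
  have lin: "linear D" by (rule has_derivative_linear[OF D])
  have "D h = gradient f x \<bullet> h" for h
  proof -
    have "D h = D (\<Sum>b\<in>Basis. (h \<bullet> b) *\<^sub>R b)" by (simp add: euclidean_representation)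
    also have "\<dots> = (\<Sum>b\<in>Basis. (h \<bullet> b) * D b)" by (simp add: linear_sum[OF lin] linear_cmul[OF lin])
    also have "\<dots> = gradient f x \<bullet> h"
      by (simp add: gradient_def partial_def eq inner_sum_right inner_commute[of _ h] mult.commute)
    finally show ?thesis .
  qed
  then have "D = (\<lambda>h. gradient f x \<bullet> h)" by (rule ext)
  with D show ?thesis by simp
qed

lemma smooth_on_gradient:
  fixes f :: "'a::euclidean_space \<Rightarrow> real"
  assumes "smooth_on f U" "open U"
  shows "\<And>x. x \<in> U \<Longrightarrow> (f has_derivative (\<lambda>h. gradient f x \<bullet> h)) (at x)"
    and "continuous_on U (gradient f)"
proof -
  have "Ck_on (Suc 0) f U" using assms(1) unfolding smooth_on_def by blast
  then have *: "f differentiable_on U" "\<And>b. b \<in> Basis \<Longrightarrow> continuous_on U (partial b f)" by auto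
  show "(f has_derivative (\<lambda>h. gradient f x \<bullet> h)) (at x)" if "x \<in> U" for x
    using *(1) that assms(2) by (intro has_derivative_gradient) (metis differentiable_on_eq_differentiable_at)
  show "continuous_on U (gradient f)"
    unfolding gradient_def[abs_def] using *(2) by (intro continuous_intros)
qed

lemma smooth_on_imp_continuous_on:
  fixes f :: "'a::euclidean_space \<Rightarrow> real"
  shows "smooth_on f U \<Longrightarrow> continuous_on U f"
  unfolding smooth_on_def by (metis Ck_on.simps(1))

lemma local_defining_function_mem:
  assumes "local_defining_function \<Omega> x0 U \<rho>" "x \<in> U"
  shows "x \<in> \<Omega> \<longleftrightarrow> \<rho> x < 0"
proof -
  have "x \<in> \<Omega> \<inter> U \<longleftrightarrow> x \<in> {x \<in> U. \<rho> x < 0}"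
    using assms(1) unfolding local_defining_function_def by metis
  then show ?thesis using assms(2) by simp
qed

lemma local_defining_function_closure:
  fixes \<rho> :: "'a::euclidean_space \<Rightarrow> real"
  assumes "local_defining_function \<Omega> x0 U \<rho>" "x \<in> U" "x \<in> closure \<Omega>"
  shows "\<rho> x \<le> 0"
proof (rule ccontr)
  assume "\<not> \<rho> x \<le> 0"
  have U: "open U" and sm: "smooth_on \<rho> U"
    using assms by (auto simp: local_defining_function_def)
  have "open (U \<inter> \<rho> -` {0<..})"
    using U smooth_on_imp_continuous_on[OF sm] by (simp add: continuous_open_preimage)
  moreover have "(U \<inter> \<rho> -` {0<..}) \<inter> \<Omega> = {}" using local_defining_function_mem[OF assms(1)] by force
  ultimately have "(U \<inter> \<rho> -` {0<..}) \<inter> closure \<Omega> = {}"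
    by (simp only: open_Int_closure_eq_empty)
  then show False using assms \<open>\<not> \<rho> x \<le> 0\<close> by auto
qed

lemma local_defining_function_frontier:
  fixes \<rho> :: "'a::euclidean_space \<Rightarrow> real"
  assumes "local_defining_function \<Omega> x0 U \<rho>" "open \<Omega>" "x \<in> U"
  shows "x \<in> frontier \<Omega> \<longleftrightarrow> x \<in> closure \<Omega> \<and> \<rho> x = 0"
proof -
  have "x \<in> frontier \<Omega> \<longleftrightarrow> x \<in> closure \<Omega> \<and> x \<notin> \<Omega>"
    using assms(2) by (simp add: frontier_def interior_open)
  moreover have "x \<notin> \<Omega> \<longleftrightarrow> \<rho> x \<ge> 0"
    using local_defining_function_mem[OF assms(1,3)] by auto
  ultimately show ?thesis using local_defining_function_closure[OF assms(1,3)] by auto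
qed

text \<open>Differentiability within the closure determines the derivative only in directions pointing
  into the domain; the inner normal is one of them.\<close>

lemma neumann_bc_gradient:
  fixes f \<rho> :: "'a::euclidean_space \<Rightarrow> real"
  assumes ldf: "local_defining_function \<Omega> x U \<rho>" and x: "x \<in> frontier \<Omega>" and bc: "neumann_bc \<Omega> f"
    and g: "(f has_derivative (\<lambda>h. g \<bullet> h)) (at x within closure \<Omega>)"
  shows "g \<bullet> gradient \<rho> x = 0"
proof -
  let ?n = "gradient \<rho> x"
  have U: "open U" "x \<in> U" and \<Omega>: "\<Omega> \<inter> U = {x \<in> U. \<rho> x < 0}" and sm: "smooth_on \<rho> U" and n: "?n \<noteq> 0"
    using ldf by (auto simp: local_defining_function_def)
  have "outer_unit_normal \<Omega> x (?n /\<^sub>R norm ?n)"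
    using x ldf unfolding outer_unit_normal_def by blast
  then obtain D where D: "(f has_derivative D) (at x within closure \<Omega>)" "D (?n /\<^sub>R norm ?n) = 0"
    using bc unfolding neumann_bc_def by blast
  interpret D: linear D using has_derivative_linear[OF D(1)] .
  have Dn: "D ?n = 0" using D(2) n by (simp add: D.scale)
  have curve: "((\<lambda>s. x - s *\<^sub>R ?n) has_derivative (\<lambda>s. - (s *\<^sub>R ?n))) F" for F
    by (auto intro!: derivative_eq_intros)
  have "((\<lambda>s. \<rho> (x - s *\<^sub>R ?n)) has_derivative (\<lambda>s. ?n \<bullet> (- (s *\<^sub>R ?n)))) (at 0)"
    by (rule has_derivative_compose[OF curve]) (use smooth_on_gradient(1)[OF sm U(1), of x] U in simp)
  then have "((\<lambda>s. \<rho> (x - s *\<^sub>R ?n)) has_real_derivative - (?n \<bullet> ?n)) (at 0)"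
    unfolding has_field_derivative_def by (rule back_subst[where P = "\<lambda>D. (_ has_derivative D) _"]) (auto simp: fun_eq_iff)
  moreover have "- (?n \<bullet> ?n) < 0" using n by simp
  ultimately obtain d1 where d1: "d1 > 0" "\<And>h. 0 < h \<Longrightarrow> h < d1 \<Longrightarrow> \<rho> (x - h *\<^sub>R ?n) < \<rho> x"
    using DERIV_neg_dec_right[of "\<lambda>s. \<rho> (x - s *\<^sub>R ?n)" "- (?n \<bullet> ?n)" 0] by auto
  have "((\<lambda>s. x - s *\<^sub>R ?n) \<longlongrightarrow> x - 0 *\<^sub>R ?n) (at 0)" by (intro tendsto_intros)
  then have "\<forall>\<^sub>F s in at 0. x - s *\<^sub>R ?n \<in> U" using U by (simp add: tendsto_def)
  then obtain d2 where d2: "d2 > 0" "\<And>h. h \<noteq> 0 \<Longrightarrow> \<bar>h\<bar> < d2 \<Longrightarrow> x - h *\<^sub>R ?n \<in> U"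
    unfolding eventually_at by (auto simp: dist_real_def)
  define d where "d = min d1 d2 / 2"
  have d: "d > 0" "d < d1" "d < d2" using d1 d2 by (auto simp: d_def)
  have "\<rho> x \<le> 0" using local_defining_function_closure[OF ldf U(2)] x by (simp add: frontier_def)
  then have inside: "x - s *\<^sub>R ?n \<in> closure \<Omega>" if "s \<in> {0..d}" for s
  proof (cases "s = 0")
    case False
    then have "x - s *\<^sub>R ?n \<in> {x \<in> U. \<rho> x < 0}"
      using that d d1(2)[of s] d2(2)[of s] \<open>\<rho> x \<le> 0\<close> by auto
    then show ?thesis using \<Omega> closure_subset by blast
  qed (use x in \<open>auto simp: frontier_def\<close>)
  \<comment> \<open>\<open>D\<close> and \<open>g\<close> both differentiate \<open>f\<close> within
    the closure, so their difference is a derivative of the zero function. On the segment from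
    \<open>x\<close> along the inner normal, which lies in the closure, this forces agreement in the
    direction of \<open>gradient \<rho> x\<close>, where \<open>D\<close> vanishes.\<close>
  have "((\<lambda>y. f y - f y) has_derivative (\<lambda>h. D h - g \<bullet> h)) (at x within closure \<Omega>)"
    by (rule has_derivative_diff[OF D(1) g])
  then have "((\<lambda>y. 0) has_derivative (\<lambda>h. D h - g \<bullet> h)) (at (x - 0 *\<^sub>R ?n) within (\<lambda>s. x - s *\<^sub>R ?n) ` {0..d})"
    by (auto intro: has_derivative_subset simp: inside image_subset_iff)
  then have "((\<lambda>s. 0) has_derivative (\<lambda>s. D (- (s *\<^sub>R ?n)) - g \<bullet> (- (s *\<^sub>R ?n)))) (at 0 within {0..d})"
    by (rule has_derivative_in_compose[OF curve])
  then have "((\<lambda>s. 0::real) has_vector_derivative (g \<bullet> ?n)) (at 0 within {0..d})"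
    by (simp add: has_vector_derivative_def D.neg D.scale Dn)
  moreover have "at 0 within {0..d} \<noteq> bot"
    using d(1) by (simp add: at_within_Icc_at_right)
  ultimately show ?thesis using has_vector_derivative_const vector_derivative_unique_within by blast
qed

section \<open>Cutting off a boundary layer at vanishing cost\<close>

text \<open>On the compact set where \<open>|h| \<ge> e\<close> the function \<open>f\<close> has no
  zero, so \<open>|f|\<close> has a positive minimum there; half of it serves as \<open>d\<close>,
  since the bound in the conclusion is not strict. It yields the smallness of the normal component
  of a gradient near the boundary, and that of an entropy at small times.\<close>

lemma compact_small_near_zero_set:
  fixes f h :: "'a::metric_space \<Rightarrow> real"
  assumes C: "compact C" and f: "continuous_on C f" and h: "continuous_on C h"
    and zero: "\<And>z. z \<in> C \<Longrightarrow> f z = 0 \<Longrightarrow> h z = 0" and e: "e > 0"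
  obtains d where "d > 0" "\<And>z. z \<in> C \<Longrightarrow> \<bar>f z\<bar> \<le> d \<Longrightarrow> \<bar>h z\<bar> < e"
proof -
  let ?C = "C \<inter> (\<lambda>z. \<bar>h z\<bar>) -` {e..}"
  have K: "compact ?C"
    by (rule closedin_compact[OF C]) (rule continuous_closedin_preimage, intro continuous_intros h, simp)
  show ?thesis
  proof (cases "?C = {}")
    case True
    then show ?thesis using that[of 1] by force
  next
    case False
    have "continuous_on ?C (\<lambda>z. \<bar>f z\<bar>)" using f by (intro continuous_intros) (auto intro: continuous_on_subset)
    then obtain z0 where z0: "z0 \<in> ?C" "\<And>z. z \<in> ?C \<Longrightarrow> \<bar>f z0\<bar> \<le> \<bar>f z\<bar>"
      using continuous_attains_inf[OF K False] by metis
    have "\<bar>f z0\<bar> > 0" using zero[of z0] z0(1) e by auto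
    then show ?thesis using that[of "\<bar>f z0\<bar> / 2"] z0(2) by force
  qed
qed

lemma fst_snd_borel_measurable [measurable]:
  "(fst :: 'a::{second_countable_topology} \<times> 'b::{second_countable_topology} \<Rightarrow> 'a) \<in> borel_measurable borel"
  "(snd :: 'a::{second_countable_topology} \<times> 'b::{second_countable_topology} \<Rightarrow> 'b) \<in> borel_measurable borel"
  by (intro borel_measurable_continuous_onI continuous_intros)+

lemmas has_derivative_smooth_step = DERIV_compose_FDERIV[OF has_real_derivative_smooth_step]

text \<open>The gradient of the cutoff \<open>1 - \<zeta> (1 - \<sigma>(- (n + 1) \<rho> - 1))\<close>, with \<open>\<sigma>\<close> the smooth step, is of size \<open>n\<close> in
  a layer of width \<open>1/n\<close> along the boundary, but there \<open>G \<bullet> \<nabla>\<rho>\<close> is small. That \<open>(n + 1) \<zeta> \<sigma>'(- (n + 1) \<rho> - 1)\<close>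
  has a bounded integral is seen by integrating by parts in the direction \<open>\<nabla>\<rho>(x0)\<close>.\<close>

lemma boundary_layer_cutoff:
  fixes \<Omega> :: "'a::euclidean_space set" and G :: "real \<Rightarrow> 'a \<Rightarrow> 'a"
  assumes ldf: "local_defining_function \<Omega> x0 U \<rho>" and \<Omega>: "open \<Omega>"
    and G: "continuous_on ({0<..} \<times> closure \<Omega>) (\<lambda>(t, x). G t x)"
    and normal: "\<And>t x. 0 < t \<Longrightarrow> x \<in> frontier \<Omega> \<Longrightarrow> x \<in> U \<Longrightarrow> G t x \<bullet> gradient \<rho> x = 0"
    and a: "0 < a" and \<theta>: "continuous_on UNIV \<theta>" "\<And>t. 0 \<le> \<theta> t" "\<And>t. t \<notin> {a..b} \<Longrightarrow> \<theta> t = 0"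
  shows "\<exists>r>0. \<exists>m Y. (\<forall>n x. 0 \<le> m n x \<and> m n x \<le> 1)
    \<and> (\<forall>n x. (m n has_derivative (\<lambda>h. Y n x \<bullet> h)) (at x)) \<and> (\<forall>n. continuous_on UNIV (Y n))
    \<and> (\<forall>x\<in>\<Omega>. (\<lambda>n::nat. m n x) \<longlonglongrightarrow> (1::real))
    \<and> (\<forall>n. \<forall>y\<in>frontier \<Omega> \<inter> ball x0 r. \<forall>\<^sub>F x in nhds y. m n x = 0)
    \<and> (\<lambda>n. \<integral>\<^sup>+z. ennreal (indicator ({0<..} \<times> \<Omega>) z * (\<theta> (fst z) * \<bar>Y n (snd z) \<bullet> G (fst z) (snd z)\<bar>)) \<partial>lborel)
        \<longlonglongrightarrow> 0"
proof -
  have U: "open U" "x0 \<in> U" and sm: "smooth_on \<rho> U" and N0: "gradient \<rho> x0 \<noteq> 0"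
    using ldf by (auto simp: local_defining_function_def)
  note grad = smooth_on_gradient[OF sm U(1)]
  note c\<rho> = smooth_on_imp_continuous_on[OF sm]
  define d where "d = gradient \<rho> x0"
  \<comment> \<open>Half of \<open>|\<nabla>\<rho>(x0)|\<^sup>2\<close>, so that by continuity
    \<open>\<nabla>\<rho> \<bullet> d > c\<close> persists on a ball around
    \<open>x0\<close>.\<close>
  define c where "c = (d \<bullet> d) / 2"
  have c: "c > 0" using N0 by (simp add: c_def d_def)
  obtain R where R: "R > 0" "cball x0 R \<subseteq> U" "\<And>x. x \<in> cball x0 R \<Longrightarrow> c < gradient \<rho> x \<bullet> d"
  proof -
    have "continuous_on U (\<lambda>x. gradient \<rho> x \<bullet> d)" using grad(2) by (intro continuous_intros)
    then have "open (U \<inter> (\<lambda>x. gradient \<rho> x \<bullet> d) -` {c<..})" using U by (simp add: continuous_open_preimage)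
    moreover have "x0 \<in> U \<inter> (\<lambda>x. gradient \<rho> x \<bullet> d) -` {c<..}" using U c by (simp add: c_def flip: d_def)
    ultimately obtain e where "e > 0" "cball x0 e \<subseteq> U \<inter> (\<lambda>x. gradient \<rho> x \<bullet> d) -` {c<..}"
      using open_contains_cball by blast
    then show ?thesis using that[of e] by fastforce
  qed
  define r where "r = R / 2"
  have r: "r > 0" using R by (simp add: r_def)
  define B where "B = ball x0 R"
  \<comment> \<open>\<open>\<zeta>\<close> is 1 up to radius \<open>r\<close> and 0 from radius
    \<open>sqrt 2 * r\<close> on. The radius \<open>3 / 2 * r\<close> lies between the latter and
    the radius \<open>R = 2 * r\<close> of \<open>B\<close>, so the open sets \<open>B\<close> and
    \<open>- C\<close> overlap and functions may be treated separately on each.\<close>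
  define C where "C = cball x0 (3 / 2 * r)"
  have CB: "C \<subseteq> B" using r by (auto simp: B_def C_def r_def)
  have BU: "B \<subseteq> U" using R by (auto simp: B_def)
  have oB: "open B" and cC: "compact C" "closed C" by (auto simp: B_def C_def)
  define \<zeta> where "\<zeta> x = smooth_step (2 - (x - x0) \<bullet> (x - x0) / r\<^sup>2)" for x
  define Z where "Z x = smooth_step' (2 - (x - x0) \<bullet> (x - x0) / r\<^sup>2) *\<^sub>R (- (2 / r\<^sup>2) *\<^sub>R (x - x0))" for x
  define p where "p x = indicator B x * \<rho> x" for x
  define N where "N x = indicator B x *\<^sub>R gradient \<rho> x" for x
  \<comment> \<open>Because of the shift by -1 the step is 0 in a whole neighbourhood of the
    boundary and not merely on it. It is 1 as soon as
    \<open>- \<rho> \<ge> 2 / (n + 1)\<close>.\<close>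
  define w where "w n x = - real (Suc n) * p x - 1" for n x
  define m where "m n x = 1 - \<zeta> x * (1 - smooth_step (w n x))" for n x
  define Y where "Y n x = - (1 - smooth_step (w n x)) *\<^sub>R Z x - (real (Suc n) * \<zeta> x * smooth_step' (w n x)) *\<^sub>R N x" for n x
  have far: "2 - (x - x0) \<bullet> (x - x0) / r\<^sup>2 \<le> 0" if "x \<notin> C" for x
  proof -
    have "(3 / 2 * r)\<^sup>2 \<le> (norm (x - x0))\<^sup>2"
      using that r by (intro power_mono) (auto simp: C_def dist_norm norm_minus_commute)
    moreover have "(3 / 2 * r)\<^sup>2 = 9 / 4 * r\<^sup>2" by (simp add: power2_eq_square)
    ultimately have "2 * r\<^sup>2 \<le> (norm (x - x0))\<^sup>2" using zero_le_power2[of r] by linarith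
    then show ?thesis using r by (simp add: field_simps power2_norm_eq_inner)
  qed
  have \<zeta>_out: "\<zeta> x = 0" and Z_out: "Z x = 0" if "x \<notin> C" for x
    using far[OF that] by (simp_all add: \<zeta>_def Z_def smooth_step_simps)
  have \<zeta>_in: "\<zeta> x = 1" if "x \<in> ball x0 r" for x
  proof -
    have "(norm (x - x0))\<^sup>2 \<le> r\<^sup>2"
      using that by (intro power_mono) (auto simp: dist_norm norm_minus_commute)
    then show ?thesis using r unfolding \<zeta>_def
      by (intro smooth_step_simps) (simp add: field_simps power2_norm_eq_inner)
  qed
  have \<zeta>_bd: "0 \<le> \<zeta> x" "\<zeta> x \<le> 1" for x by (auto simp: \<zeta>_def smooth_step_bounds)
  have \<zeta>_deriv: "(\<zeta> has_derivative (\<lambda>h. Z x \<bullet> h)) (at x)" for x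
  proof -
    have "((\<lambda>x. (x - x0) \<bullet> (x - x0)) has_derivative (\<lambda>h. 2 * ((x - x0) \<bullet> h))) (at x)"
      by (rule has_derivative_eq_rhs, (rule derivative_intros)+) (auto simp: fun_eq_iff inner_commute)
    from has_derivative_mult_right[OF this, of "1 / r\<^sup>2"]
    have "((\<lambda>x. 2 - (x - x0) \<bullet> (x - x0) / r\<^sup>2) has_derivative (\<lambda>h. 0 - 1 / r\<^sup>2 * (2 * ((x - x0) \<bullet> h)))) (at x)"
      by (intro has_derivative_diff has_derivative_const) simp
    note has_derivative_smooth_step[OF this]
    then show ?thesis unfolding \<zeta>_def[abs_def] Z_def
      by (rule has_derivative_eq_rhs) (simp add: fun_eq_iff)
  qed
  have \<zeta>_cont: "continuous_on S \<zeta>" "continuous_on S Z" for S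
    unfolding \<zeta>_def[abs_def] Z_def[abs_def] by (intro continuous_intros; use r in simp)+
  have p_deriv: "(p has_derivative (\<lambda>h. N x \<bullet> h)) (at x)" if "x \<in> B" for x
  proof -
    have "x \<in> U" using that BU by blast
    then have "(\<rho> has_derivative (\<lambda>h. N x \<bullet> h)) (at x)"
      using grad(1)[of x] that by (simp add: N_def)
    then show ?thesis
      by (rule has_derivative_transform_within_open[OF _ oB that]) (simp add: p_def)
  qed
  have p_cont: "continuous_on B p" "continuous_on B N"
    by (rule continuous_on_eq[OF continuous_on_subset[OF c\<rho> BU]], simp add: p_def,
      rule continuous_on_eq[OF continuous_on_subset[OF grad(2) BU]], simp add: N_def)
  have w_cont: "continuous_on B (w n)" for n unfolding w_def by (intro continuous_intros p_cont)
  have cover: "x \<in> B \<or> x \<in> - C" for x using CB by auto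
  have m_deriv: "(m n has_derivative (\<lambda>h. Y n x \<bullet> h)) (at x)" for n x
  proof (cases "x \<in> B")
    case True
    have "((\<lambda>x. w n x) has_derivative (\<lambda>h. - real (Suc n) * (N x \<bullet> h))) (at x)"
      unfolding w_def by (auto intro!: derivative_eq_intros p_deriv[OF True])
    note S = has_derivative_smooth_step[OF this]
    have "((\<lambda>x. 1 - \<zeta> x * (1 - smooth_step (w n x))) has_derivative
      (\<lambda>h. 0 - (\<zeta> x * (0 - - real (Suc n) * (N x \<bullet> h) * smooth_step' (w n x)) + (Z x \<bullet> h) * (1 - smooth_step (w n x))))) (at x)"
      by (intro has_derivative_diff has_derivative_mult has_derivative_const \<zeta>_deriv S)
    then show ?thesis unfolding m_def[abs_def] Y_def
      by (rule has_derivative_eq_rhs) (simp add: fun_eq_iff inner_diff_left algebra_simps)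
  next
    case False
    then have x: "x \<in> - C" using cover by auto
    have "((\<lambda>x. 1) has_derivative (\<lambda>h. Y n x \<bullet> h)) (at x)"
      using x \<zeta>_out Z_out by (simp add: Y_def)
    then show ?thesis
      by (rule has_derivative_transform_within_open[of _ _ _ _ "- C"]) (use x cC \<zeta>_out in \<open>auto simp: m_def\<close>)
  qed
  have Y_cont: "continuous_on UNIV (Y n)" for n
  proof -
    have "continuous_on B (Y n)"
      unfolding Y_def[abs_def] by (intro continuous_intros w_cont p_cont \<zeta>_cont)
    moreover have "continuous_on (- C) (Y n)"
      by (rule continuous_on_eq[OF continuous_on_const[of _ 0]]) (use \<zeta>_out Z_out in \<open>auto simp: Y_def\<close>)
    ultimately have "continuous_on (B \<union> - C) (Y n)"
      using oB cC by (intro continuous_on_open_Un) auto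
    moreover have "B \<union> - C = UNIV" using cover by auto
    ultimately show ?thesis by simp
  qed
  have m_bd: "0 \<le> m n x \<and> m n x \<le> 1" for n x
    using \<zeta>_bd[of x] smooth_step_bounds[of "w n x"] mult_le_one[of "\<zeta> x" "1 - smooth_step (w n x)"]
    by (auto simp: m_def)
  have step_ev: "(\<forall>\<^sub>F n in sequentially. smooth_step (w n x) = 1)" if "x \<in> \<Omega>" "x \<in> B" for x
  proof -
    have neg: "\<rho> x < 0" using local_defining_function_mem[OF ldf] that BU by blast
    obtain n0 :: nat where n0: "2 / (- \<rho> x) \<le> n0" using real_arch_simple by blast
    have "smooth_step (w n x) = 1" if "n \<ge> n0" for n
    proof (rule smooth_step_simps)
      have "2 / (- \<rho> x) \<le> real (Suc n)" using n0 that by linarith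
      then have "2 \<le> real (Suc n) * (- \<rho> x)" using neg by (simp add: field_simps)
      then show "1 \<le> w n x" using \<open>x \<in> B\<close> by (simp add: w_def p_def del: of_nat_Suc)
    qed
    then show ?thesis by (auto simp: eventually_sequentially)
  qed
  have m_lim: "(\<lambda>n. m n x) \<longlonglongrightarrow> 1" if "x \<in> \<Omega>" for x
  proof (cases "x \<in> B")
    case True
    show ?thesis
      by (rule tendsto_eventually, rule eventually_mono[OF step_ev[OF that True]]) (simp add: m_def)
  next
    case False
    then show ?thesis using cover[of x] \<zeta>_out[of x] by (simp add: m_def)
  qed
  have m_zero: "\<forall>\<^sub>F x in nhds y. m n x = 0" if "y \<in> frontier \<Omega>" "y \<in> ball x0 r" for n y
  proof -
    have yB: "y \<in> B" using that r by (auto simp: B_def r_def)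
    have "p y = 0" using local_defining_function_frontier[OF ldf \<Omega>, of y] that yB BU by (auto simp: p_def)
    then have wy: "w n y < 0" by (simp add: w_def)
    have "isCont (w n) y" using w_cont oB yB continuous_on_eq_continuous_at by blast
    then have "((w n) \<longlongrightarrow> w n y) (nhds y)" by (simp add: tendsto_nhds_iff continuous_at)
    then have "\<forall>\<^sub>F x in nhds y. w n x < 0" using wy by (rule order_tendstoD)
    moreover have "\<forall>\<^sub>F x in nhds y. x \<in> ball x0 r"
      using that(2) by (intro eventually_nhds_in_open) auto
    ultimately show ?thesis
      by eventually_elim (simp add: m_def \<zeta>_in smooth_step_simps)
  qed
  define O' where "O' = {0::real<..} \<times> \<Omega>"
  define K where "K = {a..b} \<times> (closure \<Omega> \<inter> C)"
  have cK: "compact K" unfolding K_def by (intro compact_Times compact_Icc closed_Int_compact closed_closure cC)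
  have [measurable]: "K \<in> sets borel" using cK by (rule borel_compact)
  have KG: "continuous_on K (\<lambda>z. G (fst z) (snd z))"
    using a by (intro continuous_on_subset[OF G[unfolded case_prod_beta]]) (auto simp: K_def)
  have K_sub: "snd ` K \<subseteq> B" "snd ` K \<subseteq> U" using CB BU by (auto simp: K_def)
  have oO: "open O'" unfolding O'_def by (intro open_Times \<Omega> open_greaterThan)
  have mem_K: "z \<in> K" if "z \<in> O'" "\<theta> (fst z) \<noteq> 0" "snd z \<in> C" for z
    using that \<theta>(3)[of "fst z"] closure_subset[of \<Omega>] by (auto simp: O'_def K_def mem_Times_iff)
  have Gm: "(\<lambda>z. indicator O' z *\<^sub>R G (fst z) (snd z)) \<in> borel_measurable borel"
    using oO closure_subset[of \<Omega>]
    by (intro borel_measurable_continuous_on_indicator continuous_on_subset[OF G[unfolded case_prod_beta]])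
      (auto simp: O'_def)
  have [measurable]: "p \<in> borel_measurable borel" "N \<in> borel_measurable borel"
    using borel_measurable_continuous_on_indicator[of B \<rho>] borel_measurable_continuous_on_indicator[of B "gradient \<rho>"]
      oB BU c\<rho> grad(2) by (auto simp: p_def[abs_def] N_def[abs_def] intro: continuous_on_subset)
  have [measurable]: "\<zeta> \<in> borel_measurable borel" "Z \<in> borel_measurable borel" "\<theta> \<in> borel_measurable borel"
    using \<zeta>_cont \<theta>(1) by (auto intro: borel_measurable_continuous_onI)
  have [measurable]: "w n \<in> borel_measurable borel" for n unfolding w_def[abs_def] by measurable
  have absorb: "indicator O' z * (f * \<bar>y \<bullet> G (fst z) (snd z)\<bar>) = f * \<bar>y \<bullet> (indicator O' z *\<^sub>R G (fst z) (snd z))\<bar>"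
    for z f and y :: 'a
    by (simp add: indicator_def)
  \<comment> \<open>\<open>A1\<close> comes from the gradient of \<open>\<zeta>\<close>: it is
    bounded uniformly in \<open>n\<close>, and its support inside the domain shrinks to the
    boundary. \<open>A2\<close> comes from the gradient of the step and carries the factor
    \<open>n + 1\<close>.\<close>
  define A1 where "A1 n z = indicator O' z * ((\<theta> (fst z) * (1 - smooth_step (w n (snd z)))) * \<bar>Z (snd z) \<bullet> G (fst z) (snd z)\<bar>)" for n z
  define A2 where "A2 n z = indicator O' z * ((\<theta> (fst z) * (real (Suc n) * \<zeta> (snd z) * smooth_step' (w n (snd z)))) * \<bar>N (snd z) \<bullet> G (fst z) (snd z)\<bar>)" for n z
  have A1m[measurable]: "A1 n \<in> borel_measurable borel" for n
    unfolding A1_def[abs_def] absorb using Gm by measurable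
  have A2m[measurable]: "A2 n \<in> borel_measurable borel" for n
    unfolding A2_def[abs_def] absorb using Gm by measurable
  have A_nonneg: "0 \<le> A1 n z" "0 \<le> A2 n z" for n z
    using smooth_step_bounds \<theta>(2) \<zeta>_bd smooth_step'_bounds by (auto simp: A1_def A2_def)
  have split: "indicator O' z * (\<theta> (fst z) * \<bar>Y n (snd z) \<bullet> G (fst z) (snd z)\<bar>) \<le> A1 n z + A2 n z" for n z
  proof -
    have "\<bar>Y n (snd z) \<bullet> G (fst z) (snd z)\<bar> \<le> (1 - smooth_step (w n (snd z))) * \<bar>Z (snd z) \<bullet> G (fst z) (snd z)\<bar>
      + (real (Suc n) * \<zeta> (snd z) * smooth_step' (w n (snd z))) * \<bar>N (snd z) \<bullet> G (fst z) (snd z)\<bar>"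
      (is "_ \<le> ?\<alpha> * \<bar>?z\<bar> + ?\<beta> * \<bar>?n\<bar>")
    proof -
      have "Y n (snd z) \<bullet> G (fst z) (snd z) = - (?\<alpha> * ?z) - ?\<beta> * ?n"
        unfolding Y_def inner_diff_left inner_scaleR_left by (simp only: mult_minus_left)
      moreover have "\<bar>?\<alpha> * ?z\<bar> = ?\<alpha> * \<bar>?z\<bar>" "\<bar>?\<beta> * ?n\<bar> = ?\<beta> * \<bar>?n\<bar>"
        using smooth_step_bounds \<zeta>_bd smooth_step'_bounds by (auto simp: abs_mult)
      ultimately show ?thesis by linarith
    qed
    then have "\<theta> (fst z) * \<bar>Y n (snd z) \<bullet> G (fst z) (snd z)\<bar> \<le> \<theta> (fst z) * (?\<alpha> * \<bar>?z\<bar> + ?\<beta> * \<bar>?n\<bar>)"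
      by (intro mult_left_mono \<theta>)
    then show ?thesis by (simp add: A1_def A2_def indicator_def algebra_simps)
  qed
  have A1_lim: "(\<lambda>n. \<integral>\<^sup>+z. ennreal (A1 n z) \<partial>lborel) \<longlonglongrightarrow> 0"
  proof -
    have "bounded ((\<lambda>z. \<theta> (fst z) * \<bar>Z (snd z) \<bullet> G (fst z) (snd z)\<bar>) ` K)"
      by (intro compact_imp_bounded compact_continuous_image cK continuous_intros KG)
        (auto intro!: continuous_on_compose2[OF \<theta>(1)] continuous_on_compose2[OF \<zeta>_cont(2)[of UNIV]] continuous_intros)
    then obtain C1 where C1: "\<And>z. z \<in> K \<Longrightarrow> \<theta> (fst z) * \<bar>Z (snd z) \<bullet> G (fst z) (snd z)\<bar> \<le> C1"
      by (auto simp: bounded_iff abs_le_iff)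
    have mK: "(\<lambda>z. ennreal C1 * indicator K z) \<in> borel_measurable borel" by measurable
    have "(\<lambda>n. \<integral>\<^sup>+z. ennreal (A1 n z) \<partial>lborel) \<longlonglongrightarrow> (\<integral>\<^sup>+z. 0 \<partial>(lborel :: (real \<times> 'a) measure))"
    proof (rule nn_integral_dominated_convergence)
      show "AE z in lborel. ennreal (A1 n z) \<le> ennreal C1 * indicator K z" for n
      proof (rule AE_I2)
        fix z
        show "ennreal (A1 n z) \<le> ennreal C1 * indicator K z"
        proof (cases "z \<in> O' \<and> \<theta> (fst z) \<noteq> 0 \<and> snd z \<in> C")
          case True
          then have z: "z \<in> K" using mem_K by auto
          have "A1 n z \<le> 1 * (\<theta> (fst z) * \<bar>Z (snd z) \<bullet> G (fst z) (snd z)\<bar>)"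
          proof -
            have "A1 n z = (1 - smooth_step (w n (snd z))) * (\<theta> (fst z) * \<bar>Z (snd z) \<bullet> G (fst z) (snd z)\<bar>)"
              using True by (simp add: A1_def)
            also have "\<dots> \<le> 1 * (\<theta> (fst z) * \<bar>Z (snd z) \<bullet> G (fst z) (snd z)\<bar>)"
              using smooth_step_bounds \<theta>(2) by (intro mult_right_mono) auto
            finally show ?thesis .
          qed
          then show ?thesis using C1[OF z] z by (auto intro: ennreal_leI)
        next
          case False
          then have "A1 n z = 0" using Z_out[of "snd z"] by (auto simp: A1_def)
          then show ?thesis by simp
        qed
      qed
      show "(\<integral>\<^sup>+z. ennreal C1 * indicator K z \<partial>lborel) < \<infinity>"
        using cK emeasure_compact_finite[OF cK]
        by (subst nn_integral_cmult_indicator) (auto simp: ennreal_mult_less_top intro: borel_compact)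
      show "AE z in lborel. (\<lambda>n. ennreal (A1 n z)) \<longlonglongrightarrow> 0"
      proof (rule AE_I2)
        fix z
        show "(\<lambda>n. ennreal (A1 n z)) \<longlonglongrightarrow> 0"
        proof (cases "z \<in> O' \<and> snd z \<in> C")
          case True
          then have "\<forall>\<^sub>F n in sequentially. smooth_step (w n (snd z)) = 1"
            using CB by (intro step_ev) (auto simp: O'_def)
          then show ?thesis
            by (rule tendsto_eventually[OF eventually_mono]) (simp add: A1_def)
        next
          case False
          then have "A1 n z = 0" for n using Z_out[of "snd z"] by (auto simp: A1_def)
          then show ?thesis by simp
        qed
      qed
    qed (use mK in auto)
    then show ?thesis by simp
  qed
  \<comment> \<open>The integration by parts takes place over the full ball \<open>B\<close> and all
    times, across the boundary of the domain, and thus has no boundary term.\<close>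
  define W where "W = (UNIV :: real set) \<times> B"
  have oW: "open W" unfolding W_def by (intro open_Times oB open_UNIV)
  have cKW: "compact ({a..b} \<times> C)" "{a..b} \<times> C \<subseteq> W"
    using cC CB by (auto simp: W_def intro: compact_Times)
  have out: "\<theta> (fst z) = 0 \<or> \<zeta> (snd z) = 0 \<and> Z (snd z) = 0" if "z \<notin> {a..b} \<times> C" for z
    using that \<theta>(3)[of "fst z"] \<zeta>_out[of "snd z"] Z_out[of "snd z"] by (auto simp: mem_Times_iff)
  note cont2 = continuous_on_compose2[OF \<theta>(1) continuous_on_fst[OF continuous_on_id]]
    continuous_on_compose2[OF \<zeta>_cont(1)[of UNIV] continuous_on_snd[OF continuous_on_id]]
    continuous_on_compose2[OF \<zeta>_cont(2)[of UNIV] continuous_on_snd[OF continuous_on_id]]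
    continuous_on_compose2[OF w_cont continuous_on_snd[OF continuous_on_id]]
    continuous_on_compose2[OF p_cont(2) continuous_on_snd[OF continuous_on_id]]
  \<comment> \<open>\<open>L - J\<close> is the derivative of
    \<open>\<theta> \<zeta> smooth_step(w)\<close> in the direction \<open>(0, d)\<close>, so
    \<open>J\<close> and \<open>L\<close> have the same integral. The large factor
    \<open>n + 1\<close> sits in \<open>J\<close> alone; \<open>L\<close> has the majorant
    integrated in \<open>C2\<close>, which does not depend on \<open>n\<close>.\<close>
  define J where "J n z = \<theta> (fst z) * (\<zeta> (snd z) * (smooth_step' (w n (snd z)) * (real (Suc n) * (N (snd z) \<bullet> d))))" for n z
  define L where "L n z = \<theta> (fst z) * ((Z (snd z) \<bullet> d) * smooth_step (w n (snd z)))" for n z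
  define C2 where "C2 = (LINT z:W|lborel. \<theta> (fst z) * \<bar>Z (snd z) \<bullet> d\<bar>)"
  have J: "set_integrable lborel W (J n)" "(LINT z:W|lborel. J n z) \<le> C2" for n
  proof -
    have cJ: "continuous_on W (J n)" and cL: "continuous_on W (L n)"
      unfolding J_def L_def by (intro continuous_intros cont2; auto simp: W_def)+
    have out0: "J n z = 0" "L n z = 0" "\<theta> (fst z) * \<bar>Z (snd z) \<bullet> d\<bar> = 0" if "z \<notin> {a..b} \<times> C" for z
      using out[OF that] by (auto simp: J_def L_def)
    show iJ: "set_integrable lborel W (J n)"
      by (rule set_integrable_continuous_compact_support[OF oW cKW cJ]) (use out0 in auto)
    have iL: "set_integrable lborel W (L n)"
      by (rule set_integrable_continuous_compact_support[OF oW cKW cL]) (use out0 in auto)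
    have iC: "set_integrable lborel W (\<lambda>z. \<theta> (fst z) * \<bar>Z (snd z) \<bullet> d\<bar>)"
    proof (rule set_integrable_continuous_compact_support[OF oW cKW])
      show "continuous_on W (\<lambda>z. \<theta> (fst z) * \<bar>Z (snd z) \<bullet> d\<bar>)"
        by (intro continuous_intros cont2) (auto simp: W_def)
    qed (use out0 in auto)
    have "(LINT z:W|lborel. L n z - J n z) = 0"
    proof (rule integral_directional_derivative_eq_0[OF oW cKW, THEN conjunct2])
      show "continuous_on W (\<lambda>z. \<theta> (fst z) * (\<zeta> (snd z) * smooth_step (w n (snd z))))"
        by (intro continuous_intros cont2) (auto simp: W_def)
      show "\<theta> (fst z) * (\<zeta> (snd z) * smooth_step (w n (snd z))) = 0" if "z \<in> W - {a..b} \<times> C" for z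
        using out[of z] that by auto
      show "continuous_on W (\<lambda>z. L n z - J n z)" by (intro continuous_intros cL cJ)
      fix z assume "z \<in> W"
      then have zB: "snd z \<in> B" by (auto simp: W_def)
      have line: "((\<lambda>s. snd z + s *\<^sub>R d) has_derivative (\<lambda>s. s *\<^sub>R d)) (at 0)"
        by (auto intro!: derivative_eq_intros)
      have d1: "((\<lambda>s. \<zeta> (snd z + s *\<^sub>R d)) has_derivative (\<lambda>s. Z (snd z) \<bullet> (s *\<^sub>R d))) (at 0)"
        by (rule has_derivative_compose[OF line]) (use \<zeta>_deriv[of "snd z"] in simp)
      have "((\<lambda>s. p (snd z + s *\<^sub>R d)) has_derivative (\<lambda>s. N (snd z) \<bullet> (s *\<^sub>R d))) (at 0)"
        by (rule has_derivative_compose[OF line]) (use p_deriv[OF zB] in simp)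
      then have d2: "((\<lambda>s. p (snd z + s *\<^sub>R d)) has_real_derivative N (snd z) \<bullet> d) (at 0)"
        by (rule has_derivative_imp_has_field_derivative) simp
      have d1': "((\<lambda>s. \<zeta> (snd z + s *\<^sub>R d)) has_real_derivative Z (snd z) \<bullet> d) (at 0)"
        by (rule has_derivative_imp_has_field_derivative[OF d1]) simp
      have d3: "((\<lambda>s. w n (snd z + s *\<^sub>R d)) has_real_derivative - real (Suc n) * (N (snd z) \<bullet> d)) (at 0)"
        unfolding w_def by (auto intro!: derivative_eq_intros d2)
      have "((\<lambda>s. \<theta> (fst z) * (\<zeta> (snd z + s *\<^sub>R d) * smooth_step (w n (snd z + s *\<^sub>R d)))) has_real_derivative
        L n z - J n z) (at 0)"
        by (rule DERIV_cong[OF DERIV_cmult[OF DERIV_mult[OF d1' DERIV_chain2[OF has_real_derivative_smooth_step d3]]]])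
          (simp add: L_def J_def algebra_simps)
      then show "((\<lambda>s. \<theta> (fst (z + s *\<^sub>R (0::real, d))) * (\<zeta> (snd (z + s *\<^sub>R (0::real, d))) * smooth_step (w n (snd (z + s *\<^sub>R (0::real, d))))))
         has_real_derivative L n z - J n z) (at 0)" by simp
    qed
    then have "(LINT z:W|lborel. J n z) = (LINT z:W|lborel. L n z)"
      using iL iJ by (simp add: set_integral_diff)
    also have "\<dots> \<le> C2" unfolding C2_def
    proof (rule set_integral_mono[OF iL iC])
      fix z :: "real \<times> 'a"
      have "(Z (snd z) \<bullet> d) * smooth_step (w n (snd z)) \<le> \<bar>Z (snd z) \<bullet> d\<bar> * 1"
        using smooth_step_bounds[of "w n (snd z)"] by (intro mult_mono) auto
      then show "L n z \<le> \<theta> (fst z) * \<bar>Z (snd z) \<bullet> d\<bar>" unfolding L_def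
        by (intro mult_left_mono \<theta>) simp
    qed
    finally show "(LINT z:W|lborel. J n z) \<le> C2" .
  qed
  have A2_le: "\<forall>\<^sub>F n in sequentially. (\<integral>\<^sup>+z. ennreal (A2 n z) \<partial>lborel) \<le> ennreal (\<eta> / c * C2)" if \<eta>: "\<eta> > 0" for \<eta>
  proof -
    have k1: "continuous_on K (\<lambda>z. \<rho> (snd z))"
      by (rule continuous_on_compose2[OF c\<rho> continuous_on_snd[OF continuous_on_id]]) (use K_sub in auto)
    have k2: "continuous_on K (\<lambda>z. gradient \<rho> (snd z) \<bullet> G (fst z) (snd z))"
      by (intro continuous_on_inner KG continuous_on_compose2[OF grad(2) continuous_on_snd[OF continuous_on_id]])
        (use K_sub in auto)
    have k3: "gradient \<rho> (snd z) \<bullet> G (fst z) (snd z) = 0" if "z \<in> K" "\<rho> (snd z) = 0" for z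
    proof -
      have "snd z \<in> U" using that K_sub by auto
      moreover have "snd z \<in> frontier \<Omega>"
        using local_defining_function_frontier[OF ldf \<Omega> \<open>snd z \<in> U\<close>] that by (auto simp: K_def)
      ultimately show ?thesis using normal[of "fst z" "snd z"] that a by (auto simp: K_def inner_commute)
    qed
    obtain \<delta> where \<delta>: "\<delta> > 0"
      "\<And>z. z \<in> K \<Longrightarrow> \<bar>\<rho> (snd z)\<bar> \<le> \<delta> \<Longrightarrow> \<bar>gradient \<rho> (snd z) \<bullet> G (fst z) (snd z)\<bar> < \<eta>"
      using compact_small_near_zero_set[OF cK k1 k2 k3 \<eta>] by blast
    obtain n0 :: nat where n0: "2 / \<delta> \<le> n0" using real_arch_simple by blast
    have "(\<integral>\<^sup>+z. ennreal (A2 n z) \<partial>lborel) \<le> ennreal (\<eta> / c * C2)" if n: "n \<ge> n0" for n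
    proof -
      \<comment> \<open>Where the step has nonzero derivative,
        \<open>|\<rho>| \<le> 2 / (n + 1) \<le> \<delta>\<close>, so the normal component is below
        \<open>\<eta>\<close>; and
        \<open>\<eta> \<le> \<eta> / c * (\<nabla>\<rho> \<bullet> d)\<close> turns this bound into
        a multiple of \<open>J\<close>. Elsewhere the left side is 0 and \<open>J\<close> is
        nonnegative.\<close>
      have le: "A2 n z \<le> \<eta> / c * (indicator W z * J n z)" for z
      proof (cases "z \<in> O' \<and> \<theta> (fst z) \<noteq> 0 \<and> snd z \<in> C \<and> smooth_step' (w n (snd z)) \<noteq> 0")
        case True
        then have zK: "z \<in> K" and zB: "snd z \<in> B" using mem_K CB by auto
        have "0 < w n (snd z)" "w n (snd z) < 1"
          using True smooth_step_simps(3,4) not_le by blast+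
        then have "\<bar>real (Suc n) * \<rho> (snd z)\<bar> \<le> 2"
          using zB by (simp add: w_def p_def del: of_nat_Suc)
        then have "real (Suc n) * \<bar>\<rho> (snd z)\<bar> \<le> 2" by (simp only: abs_mult abs_of_nat)
        moreover have "2 \<le> real (Suc n) * \<delta>"
        proof -
          have "2 / \<delta> \<le> real (Suc n)" using n0 n by linarith
          then show ?thesis using \<delta>(1) by (simp add: field_simps)
        qed
        ultimately have "real (Suc n) * \<bar>\<rho> (snd z)\<bar> \<le> real (Suc n) * \<delta>" by linarith
        then have "\<bar>gradient \<rho> (snd z) \<bullet> G (fst z) (snd z)\<bar> < \<eta>" by (intro \<delta> zK) simp
        moreover have "c < gradient \<rho> (snd z) \<bullet> d" using zB by (intro R) (auto simp: B_def)
        ultimately have "\<bar>N (snd z) \<bullet> G (fst z) (snd z)\<bar> \<le> \<eta> / c * (N (snd z) \<bullet> d)"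
        proof -
          have "\<eta> / c * c \<le> \<eta> / c * (gradient \<rho> (snd z) \<bullet> d)"
            using c \<eta> \<open>c < gradient \<rho> (snd z) \<bullet> d\<close> by (intro mult_left_mono) auto
          then show ?thesis
            using c zB \<open>\<bar>gradient \<rho> (snd z) \<bullet> G (fst z) (snd z)\<bar> < \<eta>\<close> by (simp add: N_def)
        qed
        then have "(\<theta> (fst z) * (real (Suc n) * \<zeta> (snd z) * smooth_step' (w n (snd z)))) * \<bar>N (snd z) \<bullet> G (fst z) (snd z)\<bar>
          \<le> (\<theta> (fst z) * (real (Suc n) * \<zeta> (snd z) * smooth_step' (w n (snd z)))) * (\<eta> / c * (N (snd z) \<bullet> d))"
          by (intro mult_left_mono mult_nonneg_nonneg \<theta> \<zeta>_bd smooth_step'_bounds) auto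
        then show ?thesis using True zB by (simp add: A2_def J_def W_def mem_Times_iff mult_ac)
      next
        case False
        then have "A2 n z = 0" using \<zeta>_out[of "snd z"] by (auto simp: A2_def)
        moreover have "0 \<le> indicator W z * J n z"
        proof (cases "z \<in> W")
          case True
          then have "c < gradient \<rho> (snd z) \<bullet> d" by (intro R) (auto simp: B_def W_def)
          then have "0 \<le> N (snd z) \<bullet> d" using c True by (simp add: N_def indicator_def)
          then show ?thesis using \<theta>(2) \<zeta>_bd smooth_step'_bounds by (simp add: J_def)
        qed simp
        ultimately show ?thesis using c \<eta> by simp
      qed
      have "(\<integral>\<^sup>+z. ennreal (A2 n z) \<partial>lborel) \<le> (\<integral>\<^sup>+z. ennreal (\<eta> / c * (indicator W z * J n z)) \<partial>lborel)"
        by (intro nn_integral_mono ennreal_leI le)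
      also have "\<dots> = ennreal (\<integral>z. \<eta> / c * (indicator W z * J n z) \<partial>lborel)"
      proof (rule nn_integral_eq_integral)
        show "integrable lborel (\<lambda>z. \<eta> / c * (indicator W z * J n z))"
          using J(1)[of n] by (intro integrable_mult_right) (simp add: set_integrable_def)
        show "AE z in lborel. 0 \<le> \<eta> / c * (indicator W z * J n z)"
          using le A_nonneg(2) order_trans by (intro AE_I2) blast
      qed
      also have "(\<integral>z. \<eta> / c * (indicator W z * J n z) \<partial>lborel) = \<eta> / c * (LINT z:W|lborel. J n z)"
        by (simp add: set_lebesgue_integral_def)
      also have "ennreal \<dots> \<le> ennreal (\<eta> / c * C2)"
        using J(2)[of n] c \<eta> by (intro ennreal_leI mult_left_mono) auto
      finally show ?thesis .
    qed
    then show ?thesis by (auto simp: eventually_sequentially)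
  qed
  have A2_lim: "(\<lambda>n. \<integral>\<^sup>+z. ennreal (A2 n z) \<partial>lborel) \<longlonglongrightarrow> 0"
  proof (rule order_tendstoI)
    fix e :: ennreal assume "e > 0"
    then obtain e' where e': "0 < e'" "e' < e" using dense by blast
    then obtain x where x: "e' = ennreal x" "x > 0"
      by (cases e') (auto simp: ennreal_less_zero_iff)
    have "C2 \<ge> 0" unfolding C2_def set_lebesgue_integral_def
      by (intro integral_nonneg_AE AE_I2) (auto simp: \<theta>)
    \<comment> \<open>The summand 1 in the denominator covers \<open>C2 = 0\<close>.\<close>
    define \<eta> where "\<eta> = x * c / (C2 + 1)"
    have "\<eta> > 0" using x c \<open>C2 \<ge> 0\<close> by (simp add: \<eta>_def)
    have "\<eta> / c * C2 = x * (C2 / (C2 + 1))" using c by (simp add: \<eta>_def)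
    also have "\<dots> \<le> x" using x \<open>C2 \<ge> 0\<close> by (intro mult_left_le) auto
    finally have "\<eta> / c * C2 \<le> x" .
    show "\<forall>\<^sub>F n in sequentially. (\<integral>\<^sup>+z. ennreal (A2 n z) \<partial>lborel) < e"
      using A2_le[OF \<open>\<eta> > 0\<close>]
    proof eventually_elim
      case (elim n)
      also have "ennreal (\<eta> / c * C2) \<le> e'" using \<open>\<eta> / c * C2 \<le> x\<close> x by (simp add: ennreal_leI)
      finally show ?case using e' by simp
    qed
  qed simp
  have "(\<lambda>n. \<integral>\<^sup>+z. ennreal (indicator O' z * (\<theta> (fst z) * \<bar>Y n (snd z) \<bullet> G (fst z) (snd z)\<bar>)) \<partial>lborel) \<longlonglongrightarrow> 0"
  proof (rule tendsto_sandwich[OF _ _ tendsto_const])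
    show "(\<lambda>n. (\<integral>\<^sup>+z. ennreal (A1 n z) \<partial>lborel) + (\<integral>\<^sup>+z. ennreal (A2 n z) \<partial>lborel)) \<longlonglongrightarrow> 0"
      using tendsto_add[OF A1_lim A2_lim] by simp
    show "\<forall>\<^sub>F n in sequentially. (\<integral>\<^sup>+z. ennreal (indicator O' z * (\<theta> (fst z) * \<bar>Y n (snd z) \<bullet> G (fst z) (snd z)\<bar>)) \<partial>lborel)
      \<le> (\<integral>\<^sup>+z. ennreal (A1 n z) \<partial>lborel) + (\<integral>\<^sup>+z. ennreal (A2 n z) \<partial>lborel)"
    proof (rule always_eventually, rule allI)
      fix n
      have "(\<integral>\<^sup>+z. ennreal (indicator O' z * (\<theta> (fst z) * \<bar>Y n (snd z) \<bullet> G (fst z) (snd z)\<bar>)) \<partial>lborel)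
        \<le> (\<integral>\<^sup>+z. ennreal (A1 n z) + ennreal (A2 n z) \<partial>lborel)"
        using split[of _ n] A_nonneg by (intro nn_integral_mono) (simp add: ennreal_leI flip: ennreal_plus)
      also have "\<dots> = (\<integral>\<^sup>+z. ennreal (A1 n z) \<partial>lborel) + (\<integral>\<^sup>+z. ennreal (A2 n z) \<partial>lborel)"
        by (rule nn_integral_add) auto
      finally show "(\<integral>\<^sup>+z. ennreal (indicator O' z * (\<theta> (fst z) * \<bar>Y n (snd z) \<bullet> G (fst z) (snd z)\<bar>)) \<partial>lborel)
        \<le> (\<integral>\<^sup>+z. ennreal (A1 n z) \<partial>lborel) + (\<integral>\<^sup>+z. ennreal (A2 n z) \<partial>lborel)" .
    qed
  qed simp
  with r m_bd m_deriv Y_cont m_lim m_zero show ?thesis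
    unfolding O'_def by (intro exI[of _ r] exI[of _ m] exI[of _ Y] conjI) auto
qed

text \<open>The frontier is compact, so finitely many local cutoffs suffice. Their product vanishes
  near every boundary point, which makes its restriction to the domain compactly supported and
  continuously differentiable. All factors lie in \<open>[0, 1]\<close>; by the product rule the
  error of the product is at most the sum of the errors of its factors.\<close>

lemma neumann_cutoffs:
  fixes \<Omega> :: "'a::euclidean_space set" and G :: "real \<Rightarrow> 'a \<Rightarrow> 'a"
  assumes dom: "smooth_bounded_domain \<Omega>"
    and G: "continuous_on ({0<..} \<times> closure \<Omega>) (\<lambda>(t, x). G t x)"
    and normal: "\<And>t x U \<rho>. 0 < t \<Longrightarrow> x \<in> frontier \<Omega> \<Longrightarrow> local_defining_function \<Omega> x U \<rho> \<Longrightarrow>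
      G t x \<bullet> gradient \<rho> x = 0"
    and a: "0 < a" and \<theta>: "continuous_on UNIV \<theta>" "\<And>t. 0 \<le> \<theta> t" "\<And>t. t \<notin> {a..b} \<Longrightarrow> \<theta> t = 0"
  obtains \<kappa> :: "nat \<Rightarrow> 'a \<Rightarrow> real" and X K where
    "\<And>n x. 0 \<le> \<kappa> n x" "\<And>n x. \<kappa> n x \<le> 1"
    "\<And>n x. (\<kappa> n has_derivative (\<lambda>h. X n x \<bullet> h)) (at x)" "\<And>n. continuous_on UNIV (X n)"
    "\<And>n. compact (K n)" "\<And>n. K n \<subseteq> \<Omega>" "\<And>n x. x \<notin> K n \<Longrightarrow> \<kappa> n x = 0"
    "\<And>n x. x \<notin> K n \<Longrightarrow> X n x = 0"
    "\<And>x. x \<in> \<Omega> \<Longrightarrow> (\<lambda>n. \<kappa> n x) \<longlonglongrightarrow> 1"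
    "(\<lambda>n. \<integral>\<^sup>+z. ennreal (indicator ({0<..} \<times> \<Omega>) z * (\<theta> (fst z) * \<bar>X n (snd z) \<bullet> G (fst z) (snd z)\<bar>)) \<partial>lborel)
        \<longlonglongrightarrow> 0"
proof -
  have \<Omega>: "open \<Omega>" "bounded \<Omega>" using dom by (auto simp: smooth_bounded_domain_def)
  define S where "S x0 r m Y \<longleftrightarrow> (\<forall>n x. 0 \<le> m n x \<and> m n x \<le> 1)
    \<and> (\<forall>n x. (m n has_derivative (\<lambda>h. Y n x \<bullet> h)) (at x)) \<and> (\<forall>n. continuous_on UNIV (Y n))
    \<and> (\<forall>x\<in>\<Omega>. (\<lambda>n::nat. m n x) \<longlonglongrightarrow> (1::real))
    \<and> (\<forall>n. \<forall>y\<in>frontier \<Omega> \<inter> ball x0 r. \<forall>\<^sub>F x in nhds y. m n x = 0)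
    \<and> (\<lambda>n. \<integral>\<^sup>+z. ennreal (indicator ({0<..} \<times> \<Omega>) z * (\<theta> (fst z) * \<bar>Y n (snd z) \<bullet> G (fst z) (snd z)\<bar>)) \<partial>lborel)
        \<longlonglongrightarrow> 0" for x0 r m Y
  have "\<exists>r>0. \<exists>m Y. S x0 r m Y" if x0: "x0 \<in> frontier \<Omega>" for x0
  proof -
    obtain U \<rho> where ldf: "local_defining_function \<Omega> x0 U \<rho>"
      using dom x0 unfolding smooth_bounded_domain_def by blast
    have "local_defining_function \<Omega> x U \<rho>" if "x \<in> U" for x
      using ldf that unfolding local_defining_function_def by blast
    then have nrm: "\<And>t x. 0 < t \<Longrightarrow> x \<in> frontier \<Omega> \<Longrightarrow> x \<in> U \<Longrightarrow> G t x \<bullet> gradient \<rho> x = 0"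
      using normal by blast
    show ?thesis unfolding S_def
      by (rule boundary_layer_cutoff[OF ldf \<Omega>(1) G _ a \<theta>(1)]) (use nrm \<theta> in auto)
  qed
  then obtain r where "\<forall>x0\<in>frontier \<Omega>. 0 < r x0 \<and> (\<exists>m Y. S x0 (r x0) m Y)" by metis
  then obtain m where "\<forall>x0\<in>frontier \<Omega>. 0 < r x0 \<and> (\<exists>Y. S x0 (r x0) (m x0) Y)" by metis
  then obtain Y where "\<forall>x0\<in>frontier \<Omega>. 0 < r x0 \<and> S x0 (r x0) (m x0) (Y x0)" by metis
  then have r: "\<And>i. i \<in> frontier \<Omega> \<Longrightarrow> 0 < r i"
    and m_bd: "\<And>i n x. i \<in> frontier \<Omega> \<Longrightarrow> 0 \<le> m i n x" "\<And>i n x. i \<in> frontier \<Omega> \<Longrightarrow> m i n x \<le> 1"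
    and m_deriv: "\<And>i n x. i \<in> frontier \<Omega> \<Longrightarrow> (m i n has_derivative (\<lambda>h. Y i n x \<bullet> h)) (at x)"
    and Y_cont: "\<And>i n. i \<in> frontier \<Omega> \<Longrightarrow> continuous_on UNIV (Y i n)"
    and m_lim: "\<And>i x. i \<in> frontier \<Omega> \<Longrightarrow> x \<in> \<Omega> \<Longrightarrow> (\<lambda>n. m i n x) \<longlonglongrightarrow> 1"
    and m_zero: "\<And>i n y. i \<in> frontier \<Omega> \<Longrightarrow> y \<in> frontier \<Omega> \<Longrightarrow> y \<in> ball i (r i) \<Longrightarrow> \<forall>\<^sub>F x in nhds y. m i n x = 0"
    and Y_lim: "\<And>i. i \<in> frontier \<Omega> \<Longrightarrow> (\<lambda>n. \<integral>\<^sup>+z. ennreal (indicator ({0<..} \<times> \<Omega>) z *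
      (\<theta> (fst z) * \<bar>Y i n (snd z) \<bullet> G (fst z) (snd z)\<bar>)) \<partial>lborel) \<longlonglongrightarrow> 0"
    unfolding S_def by blast+
  have "compact (frontier \<Omega>)" using \<Omega>(2) by (simp add: compact_frontier_bounded)
  moreover have "frontier \<Omega> \<subseteq> (\<Union>i\<in>frontier \<Omega>. ball i (r i))" using r by force
  ultimately obtain I where I: "I \<subseteq> frontier \<Omega>" "finite I" "frontier \<Omega> \<subseteq> (\<Union>i\<in>I. ball i (r i))"
    using compactE_image[of "frontier \<Omega>" "frontier \<Omega>" "\<lambda>i. ball i (r i)"] by auto
  have iI: "i \<in> frontier \<Omega>" if "i \<in> I" for i using that I by auto
  define \<pi> where "\<pi> n x = (\<Prod>i\<in>I. m i n x)" for n x
  define P where "P n x = (\<Sum>i\<in>I. (\<Prod>j\<in>I - {i}. m j n x) *\<^sub>R Y i n x)" for n x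
  define \<kappa> where "\<kappa> n x = indicator \<Omega> x * \<pi> n x" for n x
  define X where "X n x = indicator \<Omega> x *\<^sub>R P n x" for n x
  define K where "K n = closure {x\<in>\<Omega>. \<pi> n x \<noteq> 0}" for n
  have \<pi>_deriv: "(\<pi> n has_derivative (\<lambda>h. P n x \<bullet> h)) (at x)" for n x
  proof -
    have "((\<lambda>x. \<Prod>i\<in>I. m i n x) has_derivative (\<lambda>h. \<Sum>i\<in>I. (Y i n x \<bullet> h) * (\<Prod>j\<in>I - {i}. m j n x))) (at x)"
      by (rule has_derivative_prod) (use m_deriv iI in blast)
    then show ?thesis unfolding \<pi>_def[abs_def]
      by (rule has_derivative_eq_rhs) (simp add: P_def inner_sum_left fun_eq_iff mult.commute)
  qed
  have m_cont: "continuous_on UNIV (m i n)" if "i \<in> I" for i n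
    using has_derivative_continuous[OF m_deriv[OF iI[OF that]]] by (intro continuous_at_imp_continuous_on) blast
  have P_cont: "continuous_on UNIV (P n)" for n
    unfolding P_def[abs_def] by (intro continuous_intros m_cont Y_cont iI) auto
  have cK: "compact (K n)" for n
    unfolding K_def using bounded_subset[OF \<Omega>(2)] by (auto intro: compact_closure[THEN iffD2])
  have K\<Omega>: "K n \<subseteq> \<Omega>" for n
  proof
    fix y assume y: "y \<in> K n"
    then have "y \<in> closure \<Omega>" unfolding K_def by (rule subsetD[OF closure_mono, rotated]) auto
    show "y \<in> \<Omega>"
    proof (rule ccontr)
      assume "y \<notin> \<Omega>"
      then have yf: "y \<in> frontier \<Omega>" using \<open>y \<in> closure \<Omega>\<close> \<Omega>(1) by (simp add: frontier_def interior_open)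
      then obtain i where i: "i \<in> I" "y \<in> ball i (r i)" using I(3) by blast
      from m_zero[OF iI[OF i(1)] yf i(2)] obtain V where V: "open V" "y \<in> V" "\<And>x. x \<in> V \<Longrightarrow> m i n x = 0"
        unfolding eventually_nhds by metis
      then have "\<pi> n x = 0" if "x \<in> V" for x
        unfolding \<pi>_def using that i(1) I(2) by (intro prod_zero) auto
      then have "V \<inter> {x\<in>\<Omega>. \<pi> n x \<noteq> 0} = {}" by auto
      then have "V \<inter> K n = {}" unfolding K_def using V(1) by (simp only: open_Int_closure_eq_empty)
      then show False using y V(2) by auto
    qed
  qed
  have \<kappa>_out: "\<kappa> n x = 0" if "x \<notin> K n" for n x
  proof -
    have "x \<notin> {x\<in>\<Omega>. \<pi> n x \<noteq> 0}" using that closure_subset[of "{x\<in>\<Omega>. \<pi> n x \<noteq> 0}"] unfolding K_def by blast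
    then show ?thesis by (auto simp: \<kappa>_def)
  qed
  have \<kappa>_deriv0: "(\<kappa> n has_derivative (\<lambda>h. 0)) (at x)" if "x \<notin> K n" for n x
  proof -
    have "((\<lambda>x. 0) has_derivative (\<lambda>h. 0)) (at x)" by simp
    then show ?thesis
      by (rule has_derivative_transform_within_open[of _ _ _ _ "- K n"])
        (use that compact_imp_closed[OF cK] \<kappa>_out in auto)
  qed
  have \<kappa>_deriv1: "(\<kappa> n has_derivative (\<lambda>h. X n x \<bullet> h)) (at x)" if "x \<in> \<Omega>" for n x
  proof -
    have "(\<pi> n has_derivative (\<lambda>h. X n x \<bullet> h)) (at x)" using \<pi>_deriv[of n x] that by (simp add: X_def)
    then show ?thesis
      by (rule has_derivative_transform_within_open[OF _ \<Omega>(1) that]) (simp add: \<kappa>_def)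
  qed
  have X_out: "X n x = 0" if "x \<notin> K n" for n x
  proof (cases "x \<in> \<Omega>")
    case True
    have "(\<lambda>h. X n x \<bullet> h) = (\<lambda>h. 0)"
      by (rule has_derivative_unique[OF \<kappa>_deriv1[OF True] \<kappa>_deriv0[OF that]])
    then have "X n x \<bullet> X n x = 0" by metis
    then show ?thesis by simp
  qed (simp add: X_def)
  have \<kappa>_deriv: "(\<kappa> n has_derivative (\<lambda>h. X n x \<bullet> h)) (at x)" for n x
  proof (cases "x \<in> \<Omega>")
    case False
    then have "x \<notin> K n" using K\<Omega>[of n] by blast
    then show ?thesis using \<kappa>_deriv0[of x n] X_out[of x n] by simp
  qed (rule \<kappa>_deriv1)
  have X_cont: "continuous_on UNIV (X n)" for n
  proof -
    have 1: "continuous_on \<Omega> (X n)"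
      by (rule continuous_on_eq[OF continuous_on_subset[OF P_cont[of n] subset_UNIV]]) (simp add: X_def)
    have 2: "continuous_on (- K n) (X n)"
      by (rule continuous_on_eq[OF continuous_on_const[of _ 0]]) (simp add: X_out)
    have "continuous_on (\<Omega> \<union> - K n) (X n)"
      by (rule continuous_on_open_Un[OF \<Omega>(1) _ 1 2]) (use compact_imp_closed[OF cK] in auto)
    moreover have "\<Omega> \<union> - K n = UNIV" using K\<Omega>[of n] by auto
    ultimately show ?thesis by simp
  qed
  have \<pi>_bd: "0 \<le> \<pi> n x" "\<pi> n x \<le> 1" for n x
    unfolding \<pi>_def using m_bd iI by (auto intro!: prod_nonneg prod_le_1)
  have \<kappa>_bd: "0 \<le> \<kappa> n x" "\<kappa> n x \<le> 1" for n x
    using \<pi>_bd by (auto simp: \<kappa>_def indicator_def)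
  have \<kappa>_lim: "(\<lambda>n. \<kappa> n x) \<longlonglongrightarrow> 1" if "x \<in> \<Omega>" for x
  proof -
    have "(\<lambda>n. \<Prod>i\<in>I. m i n x) \<longlonglongrightarrow> (\<Prod>i\<in>I. 1)"
      by (intro tendsto_prod m_lim iI that)
    then show ?thesis using that by (simp add: \<kappa>_def \<pi>_def)
  qed
  let ?O = "{0<..} \<times> \<Omega> :: (real \<times> 'a) set"
  let ?D = "\<lambda>Z z. indicator ?O z * (\<theta> (fst z) * \<bar>Z (snd z) \<bullet> G (fst z) (snd z)\<bar>)"
  have Gm: "(\<lambda>z. indicator ?O z *\<^sub>R G (fst z) (snd z)) \<in> borel_measurable borel"
    using \<Omega>(1) closure_subset[of \<Omega>]
    by (intro borel_measurable_continuous_on_indicator continuous_on_subset[OF G[unfolded case_prod_beta]])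
      (auto intro!: borel_open open_Times)
  have \<theta>m[measurable]: "\<theta> \<in> borel_measurable borel" using \<theta>(1) by (rule borel_measurable_continuous_onI)
  have Dm: "(\<lambda>z. ennreal (?D (Y i n) z)) \<in> borel_measurable lborel" if "i \<in> I" for i n
  proof -
    have [measurable]: "Y i n \<in> borel_measurable borel"
      using Y_cont[OF iI[OF that]] by (rule borel_measurable_continuous_onI)
    have "?D (Y i n) = (\<lambda>z. \<theta> (fst z) * \<bar>Y i n (snd z) \<bullet> (indicator ?O z *\<^sub>R G (fst z) (snd z))\<bar>)"
      by (auto simp: indicator_def fun_eq_iff)
    moreover have "(\<lambda>z. \<theta> (fst z) * \<bar>Y i n (snd z) \<bullet> (indicator ?O z *\<^sub>R G (fst z) (snd z))\<bar>) \<in> borel_measurable borel"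
      using Gm by measurable
    ultimately have "?D (Y i n) \<in> borel_measurable borel" by simp
    then show ?thesis by simp
  qed
  have X_le: "\<bar>X n x \<bullet> y\<bar> \<le> (\<Sum>i\<in>I. \<bar>Y i n x \<bullet> y\<bar>)" for n x y
  proof (cases "x \<in> \<Omega>")
    case True
    then have "X n x \<bullet> y = (\<Sum>i\<in>I. (\<Prod>j\<in>I - {i}. m j n x) * (Y i n x \<bullet> y))"
      by (simp add: X_def P_def inner_sum_left)
    also have "\<bar>\<dots>\<bar> \<le> (\<Sum>i\<in>I. \<bar>(\<Prod>j\<in>I - {i}. m j n x) * (Y i n x \<bullet> y)\<bar>)" by (rule sum_abs)
    also have "\<dots> \<le> (\<Sum>i\<in>I. \<bar>Y i n x \<bullet> y\<bar>)"
    proof (rule sum_mono)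
      fix i
      have "0 \<le> (\<Prod>j\<in>I - {i}. m j n x)" "(\<Prod>j\<in>I - {i}. m j n x) \<le> 1"
        using m_bd iI by (auto intro!: prod_nonneg prod_le_1)
      then show "\<bar>(\<Prod>j\<in>I - {i}. m j n x) * (Y i n x \<bullet> y)\<bar> \<le> \<bar>Y i n x \<bullet> y\<bar>"
        by (simp add: abs_mult mult_left_le_one_le)
    qed
    finally show ?thesis .
  qed (simp add: X_def sum_nonneg)
  have X_lim: "(\<lambda>n. \<integral>\<^sup>+z. ennreal (?D (X n) z) \<partial>lborel) \<longlonglongrightarrow> 0"
  proof (rule tendsto_sandwich[OF _ _ tendsto_const])
    show "(\<lambda>n. \<Sum>i\<in>I. \<integral>\<^sup>+z. ennreal (?D (Y i n) z) \<partial>lborel) \<longlonglongrightarrow> 0"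
      using tendsto_sum[of I "\<lambda>i n. \<integral>\<^sup>+z. ennreal (?D (Y i n) z) \<partial>lborel" "\<lambda>_. 0"] Y_lim iI by simp
    show "\<forall>\<^sub>F n in sequentially. (\<integral>\<^sup>+z. ennreal (?D (X n) z) \<partial>lborel) \<le> (\<Sum>i\<in>I. \<integral>\<^sup>+z. ennreal (?D (Y i n) z) \<partial>lborel)"
    proof (rule always_eventually, rule allI)
      fix n
      have "(\<integral>\<^sup>+z. ennreal (?D (X n) z) \<partial>lborel) \<le> (\<integral>\<^sup>+z. (\<Sum>i\<in>I. ennreal (?D (Y i n) z)) \<partial>lborel)"
      proof (rule nn_integral_mono)
        fix z :: "real \<times> 'a"
        have "?D (X n) z \<le> indicator ?O z * (\<theta> (fst z) * (\<Sum>i\<in>I. \<bar>Y i n (snd z) \<bullet> G (fst z) (snd z)\<bar>))"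
          by (intro mult_left_mono X_le \<theta>) auto
        also have "\<dots> = (\<Sum>i\<in>I. ?D (Y i n) z)" by (simp add: sum_distrib_left)
        finally show "ennreal (?D (X n) z) \<le> (\<Sum>i\<in>I. ennreal (?D (Y i n) z))"
          using \<theta>(2) by (subst sum_ennreal) (auto intro: ennreal_leI)
      qed
      also have "\<dots> = (\<Sum>i\<in>I. \<integral>\<^sup>+z. ennreal (?D (Y i n) z) \<partial>lborel)"
        by (rule nn_integral_sum) (rule Dm)
      finally show "(\<integral>\<^sup>+z. ennreal (?D (X n) z) \<partial>lborel) \<le> (\<Sum>i\<in>I. \<integral>\<^sup>+z. ennreal (?D (Y i n) z) \<partial>lborel)" .
    qed
  qed simp
  show ?thesis
    using that[of \<kappa> X K] \<kappa>_bd \<kappa>_deriv X_cont cK K\<Omega> \<kappa>_out X_out \<kappa>_lim X_lim by blast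
qed

section \<open>Entropy identity and energy estimate\<close>

text \<open>The Leibniz rule in the parameter and the fundamental theorem in the upper limit give
  two partial derivatives, of which the second is jointly continuous; this suffices for a total
  derivative and the chain rule. The sign condition on \<open>w\<close> is there because the
  integral over \<open>{0..w s}\<close> is 0, not the signed integral, for negative
  \<open>w s\<close>.\<close>

lemma has_real_derivative_integral_moving_endpoint:
  fixes g gs :: "real \<times> real \<Rightarrow> real" and w :: "real \<Rightarrow> real"
  assumes g: "continuous_on UNIV g" and gs: "continuous_on UNIV gs"
    and deriv: "\<And>s l. ((\<lambda>s. g (s, l)) has_real_derivative gs (s, l)) (at s)"
    and w: "(w has_real_derivative w') (at s0)" and w_nonneg: "\<forall>\<^sub>F s in nhds s0. 0 \<le> w s"
  shows "((\<lambda>s. integral {0..w s} (\<lambda>l. g (s, l))) has_real_derivative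
    integral {0..w s0} (\<lambda>l. gs (s0, l)) + g (s0, w s0) * w') (at s0)"
proof -
  define M where "M = w s0 + 1"
  have w0: "0 \<le> w s0" using w_nonneg eventually_nhds_x_imp_x by blast
  have g_cont: "continuous_on S (\<lambda>l. g (s, l))" for S s
    by (rule continuous_on_compose2[OF g]) (auto intro!: continuous_intros)
  have gs_cont: "continuous_on S (\<lambda>l. gs (s, l))" for S s
    by (rule continuous_on_compose2[OF gs]) (auto intro!: continuous_intros)
  have int: "(\<lambda>l. g (s, l)) integrable_on {c..d}" "(\<lambda>l. gs (s, l)) integrable_on {c..d}" for s c d
    by (intro integrable_continuous_real g_cont gs_cont)+
  \<comment> \<open>The lower limit -1 places \<open>w s0\<close>, which may be 0, in the interior
    of \<open>{-1..M}\<close>. The part below 0 is subtracted at the end.\<close>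
  define P where "P s y = integral {-1..y} (\<lambda>l. g (s, l))" for s y
  have ds: "((\<lambda>s. P s y) has_real_derivative integral {-1..y} (\<lambda>l. gs (s0, l))) (at s0)" for y
    unfolding P_def
    using leibniz_rule_field_derivative[of UNIV "-1" y "\<lambda>s l. g (s, l)" "\<lambda>s l. gs (s, l)" s0] deriv int
      continuous_on_subset[OF gs subset_UNIV] by (simp add: cbox_interval)
  have dy: "(P s has_derivative (\<lambda>h. g (s, y) * h)) (at y within {-1..M})" if "y \<in> {-1..M}" for s y
    using integral_has_real_derivative[OF g_cont that] by (simp add: P_def[abs_def] has_field_derivative_def)
  have "((\<lambda>(s, y). P s y) has_derivative (\<lambda>(ds, dy). integral {-1..w s0} (\<lambda>l. gs (s0, l)) * ds
      + blinfun_apply (blinfun_mult_right (g (s0, w s0))) dy)) (at (s0, w s0) within UNIV \<times> {-1..M})"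
  proof (rule has_derivative_partialsI[where f = P and fx = "(*) (integral {-1..w s0} (\<lambda>l. gs (s0, l)))"
      and fy = "\<lambda>s y. blinfun_mult_right (g (s, y))"])
    show "((\<lambda>s. P s (w s0)) has_derivative (*) (integral {-1..w s0} (\<lambda>l. gs (s0, l)))) (at s0)"
      using ds by (simp add: has_field_derivative_def)
    show "(P s has_derivative blinfun_apply (blinfun_mult_right (g (s, y)))) (at y within {-1..M})"
      if "y \<in> {-1..M}" for s y
      using dy[OF that, of s] by (simp only: blinfun_mult_right.rep_eq)
    have "continuous_on UNIV (\<lambda>(s, y). blinfun_mult_right (g (s, y)))"
      unfolding case_prod_unfold prod.collapse
      by (rule bounded_linear.continuous_on[OF bounded_linear_blinfun_mult_right g])
    then show "continuous (at (s0, w s0) within UNIV \<times> {-1..M}) (\<lambda>(s, y). blinfun_mult_right (g (s, y)))"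
      unfolding continuous_on_eq_continuous_at[OF open_UNIV]
      by - (rule continuous_at_imp_continuous_at_within, erule bspec[OF _ UNIV_I])
  qed (use w0 in \<open>auto simp: M_def\<close>)
  moreover have "at (s0, w s0) within UNIV \<times> {-1..M} = at (s0, w s0)"
    by (rule at_within_interior) (use w0 in \<open>simp add: interior_Times M_def\<close>)
  ultimately have D: "((\<lambda>(s, y). P s y) has_derivative (\<lambda>(ds, dy). integral {-1..w s0} (\<lambda>l. gs (s0, l)) * ds
      + g (s0, w s0) * dy)) (at (s0, w s0))"
    by (simp only: blinfun_mult_right.rep_eq)
  have "((\<lambda>s. (s, w s)) has_derivative (\<lambda>h. (h, h * w'))) (at s0)"
    using w by (auto intro!: derivative_eq_intros simp: has_field_derivative_def mult.commute)
  from has_derivative_compose[OF this D, unfolded case_prod_conv]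
  have "((\<lambda>s. P s (w s)) has_real_derivative integral {-1..w s0} (\<lambda>l. gs (s0, l)) + g (s0, w s0) * w') (at s0)"
    unfolding has_field_derivative_def by (rule has_derivative_eq_rhs) (auto simp: fun_eq_iff algebra_simps)
  note D1 = DERIV_diff[OF this ds[of 0]]
  have "((\<lambda>s. P s (w s) - P s 0) has_real_derivative integral {0..w s0} (\<lambda>l. gs (s0, l)) + g (s0, w s0) * w') (at s0)"
    by (rule DERIV_cong[OF D1])
      (use Henstock_Kurzweil_Integration.integral_combine[where a = "-1" and c = 0 and b = "w s0" and f = "\<lambda>l. gs (s0, l)"] w0 int in simp)
  moreover have "\<forall>\<^sub>F s in nhds s0. P s (w s) - P s 0 = integral {0..w s} (\<lambda>l. g (s, l))"
    using w_nonneg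
  proof eventually_elim
    case (elim s)
    then show ?case using Henstock_Kurzweil_Integration.integral_combine[where a = "-1" and c = 0 and b = "w s" and f = "\<lambda>l. g (s, l)"] int by (simp add: P_def)
  qed
  ultimately show ?thesis by (subst (asm) DERIV_cong_ev[OF refl _ refl])
qed

section \<open>The equations and the entropy identity for compactly supported test functions\<close>

text \<open>\<open>G\<close> is the spatial gradient of \<open>v\<close>, continuous up to the
  lateral boundary. \<open>H b\<close> is the pure second derivative in the direction
  \<open>b\<close>, continuous only inside and given only along the line in that direction. Mixed
  second derivatives do not occur, since the only second-order term is the Laplacian.\<close>

locale reaction_diffusion =
  fixes \<Omega> :: "'a::euclidean_space set" and F :: "real \<Rightarrow> real" and \<epsilon> :: real
    and u v :: "real \<Rightarrow> 'a \<Rightarrow> real" and G :: "real \<Rightarrow> 'a \<Rightarrow> 'a" and H :: "'a \<Rightarrow> real \<Rightarrow> 'a \<Rightarrow> real"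
  assumes open_dom: "open \<Omega>"
    and F_cont: "continuous_on UNIV F"
    and eps_pos: "\<epsilon> > 0"
    and u_cont: "continuous_on ({0..} \<times> closure \<Omega>) (\<lambda>z. u (fst z) (snd z))"
    and v_cont: "continuous_on ({0..} \<times> closure \<Omega>) (\<lambda>z. v (fst z) (snd z))"
    and u_deriv: "\<And>t x. t > 0 \<Longrightarrow> x \<in> \<Omega> \<Longrightarrow>
      ((\<lambda>s. u s x) has_real_derivative (v t x - F (u t x)) / \<epsilon>) (at t)"
    and v_deriv: "\<And>t x. t > 0 \<Longrightarrow> x \<in> \<Omega> \<Longrightarrow>
      ((\<lambda>s. v s x) has_real_derivative (\<Sum>b\<in>Basis. H b t x) + (F (u t x) - v t x) / \<epsilon>) (at t)"
    and G_cont: "continuous_on ({0<..} \<times> closure \<Omega>) (\<lambda>z. G (fst z) (snd z))"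
    and G_deriv: "\<And>t x. t > 0 \<Longrightarrow> x \<in> closure \<Omega> \<Longrightarrow>
      (v t has_derivative (\<lambda>h. G t x \<bullet> h)) (at x within closure \<Omega>)"
    and H_cont: "\<And>b. b \<in> Basis \<Longrightarrow> continuous_on ({0<..} \<times> \<Omega>) (\<lambda>z. H b (fst z) (snd z))"
    and H_deriv: "\<And>t x b. t > 0 \<Longrightarrow> x \<in> \<Omega> \<Longrightarrow> b \<in> Basis \<Longrightarrow>
      ((\<lambda>s. G t (x + s *\<^sub>R b) \<bullet> b) has_real_derivative H b t x) (at 0)"
begin

abbreviation cylinder :: "(real \<times> 'a) set" where "cylinder \<equiv> {0<..} \<times> \<Omega>"

lemma open_cylinder: "open cylinder" using open_dom by (auto intro: open_Times)

lemma cylinder_subset: "cylinder \<subseteq> {0<..} \<times> closure \<Omega>" "cylinder \<subseteq> {0..} \<times> closure \<Omega>"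
  using closure_subset[of \<Omega>] by auto

lemma continuous_on_cylinder:
  "continuous_on cylinder (\<lambda>z. u (fst z) (snd z))" "continuous_on cylinder (\<lambda>z. v (fst z) (snd z))"
  "continuous_on cylinder (\<lambda>z. G (fst z) (snd z))" "continuous_on cylinder (\<lambda>z. F (u (fst z) (snd z)))"
proof -
  show u: "continuous_on cylinder (\<lambda>z. u (fst z) (snd z))"
    by (rule continuous_on_subset[OF u_cont cylinder_subset(2)])
  show "continuous_on cylinder (\<lambda>z. v (fst z) (snd z))"
    by (rule continuous_on_subset[OF v_cont cylinder_subset(2)])
  show "continuous_on cylinder (\<lambda>z. G (fst z) (snd z))"
    by (rule continuous_on_subset[OF G_cont cylinder_subset(1)])
  show "continuous_on cylinder (\<lambda>z. F (u (fst z) (snd z)))"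
    by (rule continuous_on_compose2[OF F_cont u]) auto
qed

lemma v_deriv_line:
  assumes "t > 0" "x \<in> \<Omega>"
  shows "((\<lambda>s. v t (x + s *\<^sub>R b)) has_real_derivative G t x \<bullet> b) (at 0)"
proof -
  have "x \<in> interior (closure \<Omega>)" using assms(2) open_dom interior_maximal[OF closure_subset open_dom] by auto
  then have "(v t has_derivative (\<lambda>h. G t x \<bullet> h)) (at x)"
    using G_deriv[OF assms(1), of x] interior_subset by (metis at_within_interior subsetD)
  then have "(v t has_derivative (\<lambda>h. G t x \<bullet> h)) (at (x + 0 *\<^sub>R b))" by simp
  moreover have "((\<lambda>s. x + s *\<^sub>R b) has_derivative (\<lambda>s. s *\<^sub>R b)) (at 0)"
    by (auto intro!: derivative_eq_intros)
  ultimately have "((\<lambda>s. v t (x + s *\<^sub>R b)) has_derivative (\<lambda>s. G t x \<bullet> (s *\<^sub>R b))) (at 0)"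
    using has_derivative_compose by blast
  then show ?thesis by (rule has_derivative_imp_has_field_derivative) simp
qed

text \<open>Integrate the time derivative of \<open>S\<close> and subtract the divergence of
  \<open>\<Phi>(t, x, v) \<nabla>v\<close>; both integrals vanish by compact support.
  \<open>S\<close> stands for the sum of the primitives in \<open>l\<close> of
  \<open>\<Phi>(t, x, F l)\<close> at \<open>u\<close> and of \<open>\<Phi>(t, x, l)\<close> at
  \<open>v\<close>, and \<open>St\<close> for its derivative in the explicit variable
  \<open>t\<close>. \<open>S\<close> is described by its time derivative only, so that the
  primitives may be chosen freely. The support is compact in \<open>(t, x)\<close> but not in
  \<open>\<xi>\<close>, which admits \<open>\<phi>(\<xi>) = \<xi>\<close>.\<close>

lemma kinetic_identity:
  fixes \<Phi> \<Phi>t \<Phi>\<xi> :: "real \<times> 'a \<times> real \<Rightarrow> real" and \<Phi>x :: "real \<times> 'a \<times> real \<Rightarrow> 'a"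
  assumes K: "compact K" "K \<subseteq> cylinder"
    and \<Phi>: "\<And>z. (\<Phi> has_derivative (\<lambda>h. \<Phi>t z * fst h + \<Phi>x z \<bullet> fst (snd h) + \<Phi>\<xi> z * snd (snd h))) (at z)"
    and \<Phi>x: "continuous_on UNIV \<Phi>x" and \<Phi>\<xi>: "continuous_on UNIV \<Phi>\<xi>"
    and supp: "\<And>t x \<xi>. (t, x) \<notin> K \<Longrightarrow> \<Phi> (t, x, \<xi>) = 0"
    and S_deriv: "\<And>t x. t > 0 \<Longrightarrow> x \<in> \<Omega> \<Longrightarrow> ((\<lambda>s. S s x) has_real_derivative
      St t x + \<Phi> (t, x, F (u t x)) * ((v t x - F (u t x)) / \<epsilon>)
        + \<Phi> (t, x, v t x) * ((\<Sum>b\<in>Basis. H b t x) + (F (u t x) - v t x) / \<epsilon>)) (at t)"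
    and S: "continuous_on cylinder (\<lambda>z. S (fst z) (snd z))"
    and St: "continuous_on cylinder (\<lambda>z. St (fst z) (snd z))"
    and S_zero: "\<And>z. z \<in> cylinder - K \<Longrightarrow> S (fst z) (snd z) = 0"
  shows "(LINT z:cylinder|lborel. case z of (t, x) \<Rightarrow> St t x - \<Phi>x (t, x, v t x) \<bullet> G t x
    - (\<Phi>\<xi> (t, x, v t x) * (G t x \<bullet> G t x) + (\<Phi> (t, x, F (u t x)) - \<Phi> (t, x, v t x)) * (F (u t x) - v t x) / \<epsilon>)) = 0"
proof -
  note [continuous_intros] = continuous_on_cylinder St S
  have \<Phi>c: "continuous_on UNIV \<Phi>"
    using \<Phi> has_derivative_continuous by (intro continuous_at_imp_continuous_on) blast
  have comp: "continuous_on cylinder (\<lambda>z. f (fst z, snd z, w z))"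
    if "continuous_on UNIV f" "continuous_on cylinder w"
    for f :: "real \<times> 'a \<times> real \<Rightarrow> 'b::topological_space" and w
    by (rule continuous_on_compose2[OF that(1)]) (auto intro!: continuous_intros that)
  define g1 where "g1 z = (case z of (t, x) \<Rightarrow> St t x + \<Phi> (t, x, F (u t x)) * ((v t x - F (u t x)) / \<epsilon>)
        + \<Phi> (t, x, v t x) * ((\<Sum>b\<in>Basis. H b t x) + (F (u t x) - v t x) / \<epsilon>))" for z
  \<comment> \<open>The derivative of \<open>\<Phi>(t, x, v) (G \<bullet> b)\<close> along
    \<open>b\<close>. Its sum over \<open>b\<close> contains \<open>\<Phi>(t, x, v)\<close> times
    the Laplacian, which cancels the same term in \<open>g1\<close>.\<close>
  define g2 where "g2 b z = (case z of (t, x) \<Rightarrow> \<Phi> (t, x, v t x) * H b t x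
    + (\<Phi>x (t, x, v t x) \<bullet> b + \<Phi>\<xi> (t, x, v t x) * (G t x \<bullet> b)) * (G t x \<bullet> b))" for b z
  have 1: "set_integrable lborel cylinder g1 \<and> (LINT z:cylinder|lborel. g1 z) = 0"
  proof (rule integral_directional_derivative_eq_0[OF open_cylinder K S S_zero, where b = "(1, 0)"])
    show "continuous_on cylinder g1" unfolding g1_def case_prod_beta
      by (intro continuous_intros comp \<Phi>c H_cont) (use eps_pos in auto)
    show "((\<lambda>s. S (fst (z + s *\<^sub>R (1, 0))) (snd (z + s *\<^sub>R (1, 0)))) has_real_derivative g1 z) (at 0)"
      if "z \<in> cylinder" for z
      using S_deriv[of "fst z" "snd z"] that
        DERIV_shift[of "\<lambda>s. S s (snd z)" "g1 z" 0 "fst z"]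
      by (auto simp: g1_def case_prod_beta add.commute)
  qed
  have 2: "set_integrable lborel cylinder (g2 b) \<and> (LINT z:cylinder|lborel. g2 b z) = 0" if b: "b \<in> Basis" for b
  proof (rule integral_directional_derivative_eq_0[OF open_cylinder K, where b = "(0, b)"
      and f = "\<lambda>z. \<Phi> (fst z, snd z, v (fst z) (snd z)) * (G (fst z) (snd z) \<bullet> b)"])
    show "continuous_on cylinder (g2 b)" unfolding g2_def case_prod_beta
      by (intro continuous_intros comp \<Phi>c \<Phi>x \<Phi>\<xi> H_cont b)
    show "continuous_on cylinder (\<lambda>z. \<Phi> (fst z, snd z, v (fst z) (snd z)) * (G (fst z) (snd z) \<bullet> b))"
      by (intro continuous_intros comp \<Phi>c)
    show "\<Phi> (fst z, snd z, v (fst z) (snd z)) * (G (fst z) (snd z) \<bullet> b) = 0" if "z \<in> cylinder - K" for z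
      using supp[of "fst z" "snd z"] that by simp
    fix z assume z: "z \<in> cylinder"
    obtain t x where tx: "z = (t, x)" by (cases z)
    have t: "t > 0" "x \<in> \<Omega>" using z tx by auto
    have "((\<lambda>s. v t (x + s *\<^sub>R b)) has_derivative (\<lambda>s. (G t x \<bullet> b) * s)) (at 0)"
      using v_deriv_line[OF t, of b] by (simp add: has_field_derivative_def)
    then have "((\<lambda>s. (t, x + s *\<^sub>R b, v t (x + s *\<^sub>R b))) has_derivative (\<lambda>s. (0, s *\<^sub>R b, (G t x \<bullet> b) * s))) (at 0)"
      by (auto intro!: derivative_eq_intros)
    from has_derivative_compose[OF this, of \<Phi>, OF \<Phi>]
    have "((\<lambda>s. \<Phi> (t, x + s *\<^sub>R b, v t (x + s *\<^sub>R b))) has_real_derivative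
      \<Phi>x (t, x, v t x) \<bullet> b + \<Phi>\<xi> (t, x, v t x) * (G t x \<bullet> b)) (at 0)"
      by (rule has_derivative_imp_has_field_derivative) (simp add: algebra_simps)
    from DERIV_mult[OF this H_deriv[OF t b]]
    show "((\<lambda>s. \<Phi> (fst (z + s *\<^sub>R (0, b)), snd (z + s *\<^sub>R (0, b)), v (fst (z + s *\<^sub>R (0, b))) (snd (z + s *\<^sub>R (0, b))))
      * (G (fst (z + s *\<^sub>R (0, b))) (snd (z + s *\<^sub>R (0, b))) \<bullet> b)) has_real_derivative g2 b z) (at 0)"
      by (simp add: tx g2_def algebra_simps)
  qed
  have "(LINT z:cylinder|lborel. g1 z - (\<Sum>b\<in>Basis. g2 b z)) = 0"
  proof -
    have "set_integrable lborel cylinder (\<lambda>z. \<Sum>b\<in>Basis. g2 b z)"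
      unfolding set_integrable_def scaleR_sum_right
      by (rule Bochner_Integration.integrable_sum) (use 2 in \<open>simp add: set_integrable_def\<close>)
    moreover have "(LINT z:cylinder|lborel. (\<Sum>b\<in>Basis. g2 b z)) = (\<Sum>b\<in>Basis. LINT z:cylinder|lborel. g2 b z)"
      unfolding set_lebesgue_integral_def scaleR_sum_right
      by (rule Bochner_Integration.integral_sum) (use 2 in \<open>simp add: set_integrable_def\<close>)
    ultimately show ?thesis using 1 2 by (simp add: set_integral_diff)
  qed
  moreover have "g1 z - (\<Sum>b\<in>Basis. g2 b z) = (case z of (t, x) \<Rightarrow> St t x - \<Phi>x (t, x, v t x) \<bullet> G t x
    - (\<Phi>\<xi> (t, x, v t x) * (G t x \<bullet> G t x) + (\<Phi> (t, x, F (u t x)) - \<Phi> (t, x, v t x)) * (F (u t x) - v t x) / \<epsilon>))" for z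
  proof -
    obtain t x where tx: "z = (t, x)" by (cases z)
    have "(\<Sum>b\<in>Basis. g2 b z) = \<Phi> (t, x, v t x) * (\<Sum>b\<in>Basis. H b t x)
      + ((\<Sum>b\<in>Basis. (\<Phi>x (t, x, v t x) \<bullet> b) * (G t x \<bullet> b)) + \<Phi>\<xi> (t, x, v t x) * (\<Sum>b\<in>Basis. (G t x \<bullet> b) * (G t x \<bullet> b)))"
      by (simp add: tx g2_def sum.distrib sum_distrib_left sum_distrib_right algebra_simps)
    also have "\<dots> = \<Phi> (t, x, v t x) * (\<Sum>b\<in>Basis. H b t x) + (\<Phi>x (t, x, v t x) \<bullet> G t x + \<Phi>\<xi> (t, x, v t x) * (G t x \<bullet> G t x))"
      by (simp only: euclidean_inner[symmetric])
    finally show ?thesis by (simp add: tx g1_def algebra_simps diff_divide_distrib add_divide_distrib)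
  qed
  ultimately show ?thesis by simp
qed

end

text \<open>Smoothness of the boundary and the Neumann condition are what removes the spatial cutoff
  in the energy estimate.\<close>

locale neumann_reaction_diffusion = reaction_diffusion +
  assumes dom: "smooth_bounded_domain \<Omega>"
    and neumann: "\<And>t. t > 0 \<Longrightarrow> neumann_bc \<Omega> (v t)"
begin

lemma bounded_dom: "bounded \<Omega>" using dom by (simp add: smooth_bounded_domain_def)

lemma emeasure_dom: "emeasure lborel \<Omega> = ennreal (measure lborel \<Omega>)"
  using emeasure_bounded_finite[OF bounded_dom] by (intro emeasure_eq_ennreal_measure) auto

text \<open>The test function of the kinetic identity is \<open>\<theta>(t) \<kappa>(x) \<phi>(\<xi>)\<close>, where \<open>\<theta>\<close> is a time cutoff and
  \<open>\<kappa>\<close> runs through the cutoffs at the boundary, which are harmless by the Neumann condition.\<close>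

lemma energy_estimate:
  fixes \<phi> \<phi>' P Q :: "real \<Rightarrow> real" and s a b C :: real
  defines "\<theta> \<equiv> \<lambda>t. smooth_step ((t - s) / s) * (1 - smooth_step ((t - a) / (b - a)))"
    and "\<eta> \<equiv> \<lambda>t. smooth_step' ((t - a) / (b - a)) / (b - a)"
  assumes \<phi>: "\<And>y. (\<phi> has_real_derivative \<phi>' y) (at y)" "continuous_on UNIV \<phi>'" "\<And>y. 0 \<le> \<phi>' y"
    and P: "\<And>y. (P has_real_derivative \<phi> (F y)) (at y)" "\<And>y. 0 \<le> P y"
    and Q: "\<And>y. (Q has_real_derivative \<phi> y) (at y)" "\<And>y. 0 \<le> Q y"
    and s: "0 < s" "2 * s < a" "a < b"
    and C: "\<And>t x. s \<le> t \<Longrightarrow> t \<le> 2 * s \<Longrightarrow> x \<in> \<Omega> \<Longrightarrow> P (u t x) + Q (v t x) \<le> C"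
  shows "(\<integral>\<^sup>+z\<in>cylinder. ennreal (case z of (t, x) \<Rightarrow> \<theta> t * (\<phi>' (v t x) * (G t x \<bullet> G t x)
      + (\<phi> (F (u t x)) - \<phi> (v t x)) * (F (u t x) - v t x) / \<epsilon>) + \<eta> t * (P (u t x) + Q (v t x))) \<partial>lborel)
    \<le> ennreal (2 * C * measure lborel \<Omega>)"
proof -
  have dom_ne: "\<Omega> \<noteq> {}" using dom by (simp add: smooth_bounded_domain_def)
  then obtain x0 where "x0 \<in> \<Omega>" by auto
  then have C0: "0 \<le> C" using C[of s x0] P(2)[of "u s x0"] Q(2)[of "v s x0"] s by simp
  have \<theta>_cont: "continuous_on UNIV \<theta>" unfolding \<theta>_def
    by (intro continuous_intros) (use s in auto)
  have \<theta>_bd: "0 \<le> \<theta> t" "\<theta> t \<le> 1" for t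
    unfolding \<theta>_def using smooth_step_bounds by (auto intro!: mult_nonneg_nonneg mult_le_one)
  have \<theta>_out: "\<theta> t = 0" if "t \<notin> {s..b}" for t
  proof (cases "t < s")
    case True
    then have "(t - s) / s \<le> 0" using s by (simp add: field_simps)
    then show ?thesis by (simp add: \<theta>_def smooth_step_simps)
  next
    case False
    then have "1 \<le> (t - a) / (b - a)" using s that by (simp add: field_simps)
    then show ?thesis by (simp add: \<theta>_def smooth_step_simps)
  qed
  \<comment> \<open>\<open>\<theta>\<close> rises from 0 to 1 on \<open>[s, 2 * s]\<close> and
    returns to 0 on \<open>[a, b]\<close>. The rising ramp contributes \<open>\<sigma>\<close>,
    which weighs the entropy near time 0, where it is at most \<open>C\<close>; the falling ramp
    contributes \<open>- \<eta>\<close>, which weighs the entropy that is to be controlled.\<close>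
  define \<sigma> where "\<sigma> t = smooth_step' ((t - s) / s) / s" for t
  have \<sigma>_bd: "0 \<le> \<sigma> t" "\<sigma> t \<le> 2 / s" for t
    using smooth_step'_bounds s by (auto simp: \<sigma>_def divide_right_mono)
  have \<sigma>_out: "\<sigma> t = 0" if "t \<notin> {s..2 * s}" for t
  proof (cases "t < s")
    case True
    then have "(t - s) / s \<le> 0" using s by (simp add: field_simps)
    then show ?thesis by (simp add: \<sigma>_def smooth_step_simps)
  next
    case False
    then have "1 \<le> (t - s) / s" using s that by (simp add: field_simps)
    then show ?thesis by (simp add: \<sigma>_def smooth_step_simps)
  qed
  have \<eta>_nonneg: "0 \<le> \<eta> t" for t using smooth_step'_bounds s by (simp add: \<eta>_def)
  have \<eta>_out: "\<eta> t = 0" if "t \<notin> {a..b}" for t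
  proof (cases "t < a")
    case True
    then have "(t - a) / (b - a) \<le> 0" using s by (simp add: field_simps)
    then show ?thesis by (simp add: \<eta>_def smooth_step_simps)
  next
    case False
    then have "1 \<le> (t - a) / (b - a)" using s that by (simp add: field_simps)
    then show ?thesis by (simp add: \<eta>_def smooth_step_simps)
  qed
  have \<theta>_deriv: "(\<theta> has_real_derivative \<sigma> t - \<eta> t) (at t)" for t
  proof -
    have "((\<lambda>t. (t - s) / s) has_real_derivative 1 / s) (at t)"
      "((\<lambda>t. (t - a) / (b - a)) has_real_derivative 1 / (b - a)) (at t)"
      using s by (auto intro!: derivative_eq_intros)
    note this[THEN DERIV_chain2[OF has_real_derivative_smooth_step]]
    from DERIV_mult[OF this(1) DERIV_diff[OF DERIV_const[of 1] this(2)]]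
    have *: "(\<theta> has_real_derivative \<sigma> t * (1 - smooth_step ((t - a) / (b - a))) - smooth_step ((t - s) / s) * \<eta> t) (at t)"
      unfolding \<theta>_def by (rule DERIV_cong) (simp add: \<sigma>_def \<eta>_def)
    \<comment> \<open>Since \<open>2 * s < a\<close>, each factor of \<open>\<theta>\<close> equals
      1 where the derivative of the other lives, and the product rule reduces to a difference of
      ramps.\<close>
    have "\<sigma> t * (1 - smooth_step ((t - a) / (b - a))) = \<sigma> t"
    proof (cases "t \<in> {s..2 * s}")
      case True
      then have "(t - a) / (b - a) \<le> 0" using s by (simp add: field_simps)
      then show ?thesis by (simp add: smooth_step_simps)
    qed (simp add: \<sigma>_out)
    moreover have "smooth_step ((t - s) / s) * \<eta> t = \<eta> t"
    proof (cases "t \<in> {a..b}")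
      case True
      then have "1 \<le> (t - s) / s" using s by (simp add: field_simps)
      then show ?thesis by (simp add: smooth_step_simps)
    qed (simp add: \<eta>_out)
    ultimately show ?thesis using * by (simp only:)
  qed
  have nrm: "G t x \<bullet> gradient \<rho> x = 0"
    if "0 < t" "x \<in> frontier \<Omega>" "local_defining_function \<Omega> x U \<rho>" for t x U \<rho>
    using that by (intro neumann_bc_gradient[OF that(3) that(2) neumann[OF that(1)]] G_deriv)
      (auto simp: frontier_def)
  have Gc: "continuous_on ({0<..} \<times> closure \<Omega>) (\<lambda>(t, x). G t x)"
    using G_cont by (simp add: case_prod_unfold)
  obtain \<kappa> :: "nat \<Rightarrow> 'a \<Rightarrow> real" and X K where
    \<kappa>: "\<And>n x. 0 \<le> \<kappa> n x" "\<And>n x. \<kappa> n x \<le> 1"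
    "\<And>n x. (\<kappa> n has_derivative (\<lambda>h. X n x \<bullet> h)) (at x)" and X: "\<And>n. continuous_on UNIV (X n)"
    and K: "\<And>n. compact (K n)" "\<And>n. K n \<subseteq> \<Omega>"
    and out: "\<And>n x. x \<notin> K n \<Longrightarrow> \<kappa> n x = 0" "\<And>n x. x \<notin> K n \<Longrightarrow> X n x = 0"
    and \<kappa>_lim: "\<And>x. x \<in> \<Omega> \<Longrightarrow> (\<lambda>n. \<kappa> n x) \<longlonglongrightarrow> 1"
    and X_lim: "(\<lambda>n. \<integral>\<^sup>+z. ennreal (indicator ({0<..} \<times> \<Omega>) z * (\<theta> (fst z) * \<bar>X n (snd z) \<bullet> G (fst z) (snd z)\<bar>)) \<partial>lborel)
        \<longlonglongrightarrow> 0"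
    by (rule neumann_cutoffs[OF dom Gc nrm s(1) \<theta>_cont \<theta>_bd(1) \<theta>_out]) blast+
  have \<phi>_cont: "continuous_on UNIV \<phi>" and P_cont: "continuous_on UNIV P" and Q_cont: "continuous_on UNIV Q"
    using \<phi>(1) P(1) Q(1) DERIV_isCont by (blast intro: continuous_at_imp_continuous_on)+
  have \<kappa>_cont: "continuous_on UNIV (\<kappa> n)" for n
    using has_derivative_continuous[OF \<kappa>(3)] by (blast intro: continuous_at_imp_continuous_on)
  have [continuous_intros]: "continuous_on cylinder (\<lambda>z. \<phi> (v (fst z) (snd z)))"
    "continuous_on cylinder (\<lambda>z. \<phi>' (v (fst z) (snd z)))" "continuous_on cylinder (\<lambda>z. \<phi> (F (u (fst z) (snd z))))"
    "continuous_on cylinder (\<lambda>z. P (u (fst z) (snd z)))" "continuous_on cylinder (\<lambda>z. Q (v (fst z) (snd z)))"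
    by (rule continuous_on_compose2[OF \<phi>_cont] continuous_on_compose2[OF \<phi>(2)] continuous_on_compose2[OF P_cont]
        continuous_on_compose2[OF Q_cont], rule continuous_on_cylinder, simp)+
  have [continuous_intros]: "continuous_on S (\<lambda>z. \<theta> (fst z))" "continuous_on S (\<lambda>z. \<sigma> (fst z))" "continuous_on S (\<lambda>z. \<eta> (fst z))"
    for S :: "(real \<times> 'c::topological_space) set"
    unfolding \<theta>_def \<sigma>_def \<eta>_def by (intro continuous_intros; use s in simp)+
  have [continuous_intros]: "continuous_on S (\<lambda>z. \<kappa> n (snd z))" "continuous_on S (\<lambda>z. X n (snd z))"
    for S :: "('c::topological_space \<times> 'a) set" and n
    by (rule continuous_on_compose2[OF \<kappa>_cont] continuous_on_compose2[OF X], rule continuous_on_snd, rule continuous_on_id, simp)+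
  note [continuous_intros] = continuous_on_cylinder
  define D where "D z = (case z of (t, x) \<Rightarrow> \<phi>' (v t x) * (G t x \<bullet> G t x)
      + (\<phi> (F (u t x)) - \<phi> (v t x)) * (F (u t x) - v t x) / \<epsilon>)" for z
  define A where "A z = (case z of (t, x) \<Rightarrow> P (u t x) + Q (v t x))" for z
  have mono: "\<phi> x \<le> \<phi> y" if "x \<le> y" for x y
    by (rule DERIV_nonneg_imp_nondecreasing[OF that]) (use \<phi> in blast)
  have D_nonneg: "0 \<le> D z" for z
  proof -
    have "0 \<le> (\<phi> x - \<phi> y) * (x - y)" for x y
      using mono[of x y] mono[of y x] by (cases "x \<le> y") (auto intro: mult_nonneg_nonneg mult_nonpos_nonpos)
    then show ?thesis using \<phi>(3) eps_pos by (auto simp: D_def split: prod.split)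
  qed
  have A_nonneg: "0 \<le> A z" for z using P Q by (auto simp: A_def split: prod.split)
  have [continuous_intros]: "continuous_on cylinder D" "continuous_on cylinder A"
    unfolding D_def[abs_def] A_def[abs_def] case_prod_unfold by (intro continuous_intros; use eps_pos in simp)+
  define f where "f z = \<theta> (fst z) * D z + \<eta> (fst z) * A z" for z
  \<comment> \<open>\<open>l n\<close> collects the terms with a sign: dissipation and entropy on
    the falling ramp. \<open>r n\<close> holds what has to be estimated: entropy on the rising ramp
    and the error made by the gradient of the boundary cutoff.\<close>
  define l where "l n z = \<kappa> n (snd z) * f z" for n z
  define r where "r n z = \<sigma> (fst z) * \<kappa> n (snd z) * A z - \<theta> (fst z) * \<phi> (v (fst z) (snd z)) * (X n (snd z) \<bullet> G (fst z) (snd z))" for n z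
  have f_nonneg: "0 \<le> f z" for z using \<theta>_bd D_nonneg \<eta>_nonneg A_nonneg by (simp add: f_def)
  have KK: "compact ({s..b} \<times> K n)" "{s..b} \<times> K n \<subseteq> cylinder" for n
    using K s by (auto intro: compact_Times)
  have lr_int: "set_integrable lborel cylinder (l n)" "set_integrable lborel cylinder (r n)" for n
  proof -
    have 0: "l n z = 0" "r n z = 0" if "z \<notin> {s..b} \<times> K n" for z
    proof -
      have "(\<theta> (fst z) = 0 \<and> \<sigma> (fst z) = 0 \<and> \<eta> (fst z) = 0) \<or> (\<kappa> n (snd z) = 0 \<and> X n (snd z) = 0)"
        using that \<theta>_out[of "fst z"] \<sigma>_out[of "fst z"] \<eta>_out[of "fst z"] out[of "snd z" n] s by (auto simp: mem_Times_iff)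
      then show "l n z = 0" "r n z = 0" by (auto simp: l_def r_def f_def)
    qed
    have c: "continuous_on cylinder (l n)" "continuous_on cylinder (r n)"
      unfolding l_def[abs_def] r_def[abs_def] f_def by (intro continuous_intros)+
    show "set_integrable lborel cylinder (l n)"
      by (rule set_integrable_continuous_compact_support[OF open_cylinder KK[of n] c(1)]) (use 0 in auto)
    show "set_integrable lborel cylinder (r n)"
      by (rule set_integrable_continuous_compact_support[OF open_cylinder KK[of n] c(2)]) (use 0 in auto)
  qed
  have lr: "(LINT z:cylinder|lborel. l n z) = (LINT z:cylinder|lborel. r n z)" for n
  proof -
    define \<Phi> where "\<Phi> z = \<theta> (fst z) * (\<kappa> n (fst (snd z)) * \<phi> (snd (snd z)))" for z
    define \<Phi>t where "\<Phi>t z = (\<sigma> (fst z) - \<eta> (fst z)) * (\<kappa> n (fst (snd z)) * \<phi> (snd (snd z)))" for z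
    define \<Phi>x where "\<Phi>x z = (\<theta> (fst z) * \<phi> (snd (snd z))) *\<^sub>R X n (fst (snd z))" for z :: "real \<times> 'a \<times> real"
    define \<Phi>\<xi> where "\<Phi>\<xi> z = \<theta> (fst z) * (\<kappa> n (fst (snd z)) * \<phi>' (snd (snd z)))" for z
    define S where "S t x = \<theta> t * (\<kappa> n x * (P (u t x) + Q (v t x)))" for t x
    define St where "St t x = (\<sigma> t - \<eta> t) * (\<kappa> n x * (P (u t x) + Q (v t x)))" for t x
    have "(LINT z:cylinder|lborel. case z of (t, x) \<Rightarrow> St t x - \<Phi>x (t, x, v t x) \<bullet> G t x
      - (\<Phi>\<xi> (t, x, v t x) * (G t x \<bullet> G t x) + (\<Phi> (t, x, F (u t x)) - \<Phi> (t, x, v t x)) * (F (u t x) - v t x) / \<epsilon>)) = 0"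
    proof (rule kinetic_identity[OF KK, where \<Phi>t = \<Phi>t and S = S])
      fix z :: "real \<times> 'a \<times> real"
      have 1: "((\<lambda>z. \<theta> (fst z)) has_derivative (\<lambda>h. fst h * (\<sigma> (fst z) - \<eta> (fst z)))) (at z)"
        by (rule DERIV_compose_FDERIV[OF \<theta>_deriv]) (auto intro!: derivative_eq_intros)
      have 2: "((\<lambda>z. \<phi> (snd (snd z))) has_derivative (\<lambda>h. snd (snd h) * \<phi>' (snd (snd z)))) (at z)"
        by (rule DERIV_compose_FDERIV[OF \<phi>(1)]) (auto intro!: derivative_eq_intros)
      have "((\<lambda>z. fst (snd z)) has_derivative (\<lambda>h. fst (snd h))) (at z)"
        by (auto intro!: derivative_eq_intros)
      from has_derivative_compose[OF this \<kappa>(3)]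
      have 3: "((\<lambda>z. \<kappa> n (fst (snd z))) has_derivative (\<lambda>h. X n (fst (snd z)) \<bullet> fst (snd h))) (at z)" .
      show "(\<Phi> has_derivative (\<lambda>h. \<Phi>t z * fst h + \<Phi>x z \<bullet> fst (snd h) + \<Phi>\<xi> z * snd (snd h))) (at z)"
        unfolding \<Phi>_def[abs_def]
        by (rule has_derivative_eq_rhs[OF has_derivative_mult[OF 1 has_derivative_mult[OF 3 2]]])
          (simp add: fun_eq_iff \<Phi>t_def \<Phi>x_def \<Phi>\<xi>_def algebra_simps)
    next
      show "continuous_on UNIV \<Phi>x" "continuous_on UNIV \<Phi>\<xi>"
        unfolding \<Phi>x_def[abs_def] \<Phi>\<xi>_def[abs_def]
        by (intro continuous_intros continuous_on_compose2[OF X] continuous_on_compose2[OF \<kappa>_cont]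
          continuous_on_compose2[OF \<phi>_cont] continuous_on_compose2[OF \<phi>(2)]; simp)+
    next
      show "\<Phi> (t, x, \<xi>) = 0" if "(t, x) \<notin> {s..b} \<times> K n" for t x \<xi>
        using that \<theta>_out[of t] out[of x n] by (auto simp: \<Phi>_def)
    next
      fix t :: real and x :: 'a assume t: "0 < t" "x \<in> \<Omega>"
      note d = DERIV_mult[OF \<theta>_deriv[of t] DERIV_cmult[OF DERIV_add[OF DERIV_chain2[OF P(1) u_deriv[OF t]] DERIV_chain2[OF Q(1) v_deriv[OF t]]], of "\<kappa> n x"]]
      show "((\<lambda>s. S s x) has_real_derivative St t x + \<Phi> (t, x, F (u t x)) * ((v t x - F (u t x)) / \<epsilon>)
        + \<Phi> (t, x, v t x) * ((\<Sum>b\<in>Basis. H b t x) + (F (u t x) - v t x) / \<epsilon>)) (at t)"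
        unfolding S_def by (rule DERIV_cong[OF d]) (simp add: St_def \<Phi>_def algebra_simps)
    next
      show "continuous_on cylinder (\<lambda>z. S (fst z) (snd z))" "continuous_on cylinder (\<lambda>z. St (fst z) (snd z))"
        unfolding S_def St_def by (intro continuous_intros)+
      show "S (fst z) (snd z) = 0" if "z \<in> cylinder - {s..b} \<times> K n" for z
        using that \<theta>_out[of "fst z"] out[of "snd z" n] by (auto simp: S_def mem_Times_iff)
    qed
    moreover have "(case z of (t, x) \<Rightarrow> St t x - \<Phi>x (t, x, v t x) \<bullet> G t x
      - (\<Phi>\<xi> (t, x, v t x) * (G t x \<bullet> G t x) + (\<Phi> (t, x, F (u t x)) - \<Phi> (t, x, v t x)) * (F (u t x) - v t x) / \<epsilon>))
      = r n z - l n z" for z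
      by (cases z) (simp add: St_def \<Phi>x_def \<Phi>\<xi>_def \<Phi>_def r_def l_def f_def D_def A_def algebra_simps
          diff_divide_distrib add_divide_distrib)
    ultimately have "(LINT z:cylinder|lborel. r n z - l n z) = 0" by simp
    then show ?thesis using lr_int by (simp add: set_integral_diff)
  qed
  define E where "E n = (\<integral>\<^sup>+z. ennreal (indicator cylinder z * (\<theta> (fst z) * \<bar>X n (snd z) \<bullet> G (fst z) (snd z)\<bar>)) \<partial>lborel)" for n
  obtain B where B: "\<And>t x. t \<in> {s..b} \<Longrightarrow> x \<in> closure \<Omega> \<Longrightarrow> \<bar>\<phi> (v t x)\<bar> \<le> B"
  proof -
    have "compact ({s..b} \<times> closure \<Omega>)" using bounded_dom by (intro compact_Times) auto
    moreover have "continuous_on ({s..b} \<times> closure \<Omega>) (\<lambda>z. \<phi> (v (fst z) (snd z)))"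
      by (rule continuous_on_compose2[OF \<phi>_cont continuous_on_subset[OF v_cont]]) (use s in auto)
    ultimately have "bounded ((\<lambda>z. \<phi> (v (fst z) (snd z))) ` ({s..b} \<times> closure \<Omega>))"
      by (intro compact_imp_bounded compact_continuous_image)
    then obtain B where B: "\<forall>y\<in>(\<lambda>z. \<phi> (v (fst z) (snd z))) ` ({s..b} \<times> closure \<Omega>). norm y \<le> B"
      unfolding bounded_iff by blast
    have "\<bar>\<phi> (v t x)\<bar> \<le> B" if "t \<in> {s..b}" "x \<in> closure \<Omega>" for t x
      using bspec[OF B imageI[of "(t, x)"]] that by simp
    then show ?thesis using that by blast
  qed
  have "emeasure lborel ({s..2 * s} \<times> \<Omega>) = emeasure lborel {s..2 * s} * emeasure lborel \<Omega>"
    unfolding lborel_prod[symmetric] using open_dom by (intro lborel.emeasure_pair_measure_Times) auto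
  then have meas: "emeasure lborel ({s..2 * s} \<times> \<Omega>) = ennreal (s * measure lborel \<Omega>)"
    using s by (simp add: emeasure_dom ennreal_mult)
  \<comment> \<open>The weight \<open>\<sigma>\<close> is at most \<open>2 / s\<close> and lives on
    a time interval of length \<open>s\<close>; with the entropy bound \<open>C\<close> this is
    where \<open>2 * C * measure lborel \<Omega>\<close> comes from.\<close>
  have bound: "(\<integral>\<^sup>+z. ennreal (indicator cylinder z * l n z) \<partial>lborel)
    \<le> ennreal (2 * C * measure lborel \<Omega>) + ennreal \<bar>B\<bar> * E n" for n
  proof -
    have [measurable]: "\<theta> \<in> borel_measurable borel" "X n \<in> borel_measurable borel"
      using \<theta>_cont X by (auto intro: borel_measurable_continuous_onI)
    have Gm: "(\<lambda>z. indicator cylinder z *\<^sub>R G (fst z) (snd z)) \<in> borel_measurable borel"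
      using open_cylinder by (intro borel_measurable_continuous_on_indicator continuous_on_cylinder) auto
    have "(\<lambda>z. \<theta> (fst z) * \<bar>X n (snd z) \<bullet> (indicator cylinder z *\<^sub>R G (fst z) (snd z))\<bar>) \<in> borel_measurable borel"
      using Gm by measurable
    moreover have "(\<lambda>z. \<theta> (fst z) * \<bar>X n (snd z) \<bullet> (indicator cylinder z *\<^sub>R G (fst z) (snd z))\<bar>)
      = (\<lambda>z. indicator cylinder z * (\<theta> (fst z) * \<bar>X n (snd z) \<bullet> G (fst z) (snd z)\<bar>))"
      by (auto simp: indicator_def fun_eq_iff)
    ultimately have Em: "(\<lambda>z. indicator cylinder z * (\<theta> (fst z) * \<bar>X n (snd z) \<bullet> G (fst z) (snd z)\<bar>)) \<in> borel_measurable borel"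
      by simp
    have "(\<integral>\<^sup>+z. ennreal (indicator cylinder z * l n z) \<partial>lborel) = ennreal (LINT z:cylinder|lborel. l n z)"
      unfolding set_lebesgue_integral_def real_scaleR_def
      by (rule nn_integral_eq_integral)
        (use lr_int(1)[of n] f_nonneg \<kappa>(1) in \<open>auto simp: set_integrable_def l_def\<close>)
    also have "\<dots> \<le> ennreal (norm (LINT z|lborel. indicator cylinder z *\<^sub>R r n z))"
      using lr[of n] by (intro ennreal_leI) (simp add: set_lebesgue_integral_def)
    also have "\<dots> \<le> (\<integral>\<^sup>+z. norm (indicator cylinder z *\<^sub>R r n z) \<partial>lborel)"
      by (rule integral_norm_bound_ennreal) (use lr_int(2)[of n] in \<open>simp add: set_integrable_def\<close>)
    also have "\<dots> \<le> (\<integral>\<^sup>+z. ennreal (2 / s * C) * indicator ({s..2 * s} \<times> \<Omega>) z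
      + ennreal \<bar>B\<bar> * ennreal (indicator cylinder z * (\<theta> (fst z) * \<bar>X n (snd z) \<bullet> G (fst z) (snd z)\<bar>)) \<partial>lborel)"
    proof (rule nn_integral_mono)
      fix z :: "real \<times> 'a"
      obtain t x where z: "z = (t, x)" by (cases z)
      show "ennreal (norm (indicator cylinder z *\<^sub>R r n z)) \<le> ennreal (2 / s * C) * indicator ({s..2 * s} \<times> \<Omega>) z
        + ennreal \<bar>B\<bar> * ennreal (indicator cylinder z * (\<theta> (fst z) * \<bar>X n (snd z) \<bullet> G (fst z) (snd z)\<bar>))"
      proof (cases "z \<in> cylinder")
        case True
        then have x: "x \<in> \<Omega>" "0 < t" by (auto simp: z)
        have i: "\<bar>\<sigma> t * \<kappa> n x * A z\<bar> \<le> 2 / s * C * indicator ({s..2 * s} \<times> \<Omega>) z"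
        proof (cases "t \<in> {s..2 * s}")
          case True
          have "A z \<le> C" using C[of t x] True x by (simp add: A_def z)
          then have "(\<sigma> t * \<kappa> n x) * A z \<le> (2 / s * 1) * C"
            using \<sigma>_bd[of t] \<kappa>(1,2)[of n x] A_nonneg s by (intro mult_mono) auto
          then show ?thesis using True x \<sigma>_bd(1) \<kappa>(1) A_nonneg by (simp add: z)
        qed (use \<sigma>_out C0 s in \<open>simp add: indicator_def\<close>)
        have ii: "\<bar>\<theta> t * \<phi> (v t x) * (X n x \<bullet> G t x)\<bar> \<le> \<bar>B\<bar> * (\<theta> t * \<bar>X n x \<bullet> G t x\<bar>)"
        proof (cases "t \<in> {s..b}")
          case True
          then have "\<bar>\<phi> (v t x)\<bar> \<le> \<bar>B\<bar>" using B[OF True, of x] x closure_subset[of \<Omega>] by fastforce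
          then have "\<bar>\<phi> (v t x)\<bar> * (\<theta> t * \<bar>X n x \<bullet> G t x\<bar>) \<le> \<bar>B\<bar> * (\<theta> t * \<bar>X n x \<bullet> G t x\<bar>)"
            by (rule mult_right_mono) (simp add: \<theta>_bd)
          then show ?thesis using \<theta>_bd(1)[of t] by (simp add: abs_mult mult_ac)
        qed (simp add: \<theta>_out)
        have "norm (indicator cylinder z *\<^sub>R r n z) \<le> 2 / s * C * indicator ({s..2 * s} \<times> \<Omega>) z + \<bar>B\<bar> * (\<theta> t * \<bar>X n x \<bullet> G t x\<bar>)"
          using i ii True by (simp add: r_def z)
        then have "ennreal (norm (indicator cylinder z *\<^sub>R r n z))
          \<le> ennreal (2 / s * C * indicator ({s..2 * s} \<times> \<Omega>) z + \<bar>B\<bar> * (\<theta> t * \<bar>X n x \<bullet> G t x\<bar>))"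
          by (rule ennreal_leI)
        also have "\<dots> = ennreal (2 / s * C) * indicator ({s..2 * s} \<times> \<Omega>) z + ennreal \<bar>B\<bar> * ennreal (\<theta> t * \<bar>X n x \<bullet> G t x\<bar>)"
          using C0 s \<theta>_bd(1)[of t] by (simp add: ennreal_plus ennreal_mult'' indicator_def)
        finally show ?thesis using True by (simp add: z)
      qed simp
    qed
    also have "\<dots> = ennreal (2 / s * C) * emeasure lborel ({s..2 * s} \<times> \<Omega>) + ennreal \<bar>B\<bar> * E n"
    proof (subst nn_integral_add)
      have "{s..2 * s} \<times> \<Omega> \<in> sets lborel" using open_dom by (simp add: borel_Times)
      then show "(\<integral>\<^sup>+z. ennreal (2 / s * C) * indicator ({s..2 * s} \<times> \<Omega>) z \<partial>lborel)
        + (\<integral>\<^sup>+z. ennreal \<bar>B\<bar> * ennreal (indicator cylinder z * (\<theta> (fst z) * \<bar>X n (snd z) \<bullet> G (fst z) (snd z)\<bar>)) \<partial>lborel)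
        = ennreal (2 / s * C) * emeasure lborel ({s..2 * s} \<times> \<Omega>) + ennreal \<bar>B\<bar> * E n"
        and "(\<lambda>z. ennreal (2 / s * C) * indicator ({s..2 * s} \<times> \<Omega>) z) \<in> borel_measurable lborel"
        unfolding E_def using Em by (auto simp: nn_integral_cmult_indicator intro!: nn_integral_cmult)
    qed (use Em in auto)
    also have "ennreal (2 / s * C) * emeasure lborel ({s..2 * s} \<times> \<Omega>) = ennreal (2 * C * measure lborel \<Omega>)"
      unfolding meas using s C0 by (simp add: ennreal_mult''[symmetric])
    finally show ?thesis .
  qed
  \<comment> \<open>For an upper bound Fatou's lemma is enough: the integrands are nonnegative, the
    cutoffs tend to 1 inside the domain, and the errors \<open>E n\<close> tend to 0.\<close>
  have "(\<integral>\<^sup>+z\<in>cylinder. ennreal (f z) \<partial>lborel) = (\<integral>\<^sup>+z. liminf (\<lambda>n. ennreal (indicator cylinder z * l n z)) \<partial>lborel)"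
  proof (rule nn_integral_cong)
    fix z :: "real \<times> 'a"
    show "ennreal (f z) * indicator cylinder z = liminf (\<lambda>n. ennreal (indicator cylinder z * l n z))"
    proof (cases "z \<in> cylinder")
      case True
      then have "(\<lambda>n. \<kappa> n (snd z)) \<longlonglongrightarrow> 1" by (intro \<kappa>_lim) auto
      then have "(\<lambda>n. \<kappa> n (snd z) * f z) \<longlonglongrightarrow> 1 * f z" by (intro tendsto_intros)
      then have "(\<lambda>n. ennreal (indicator cylinder z * l n z)) \<longlonglongrightarrow> ennreal (f z)"
        using True by (simp add: l_def)
      then show ?thesis using True lim_imp_Liminf[OF sequentially_bot] by (metis indicator_simps(1) mult.right_neutral)
    qed (simp add: Liminf_const)
  qed
  also have "\<dots> \<le> liminf (\<lambda>n. \<integral>\<^sup>+z. ennreal (indicator cylinder z * l n z) \<partial>lborel)"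
    by (rule nn_integral_liminf) (use lr_int(1) in \<open>auto simp: set_integrable_def\<close>)
  also have "\<dots> \<le> liminf (\<lambda>n. ennreal (2 * C * measure lborel \<Omega>) + ennreal \<bar>B\<bar> * E n)"
    by (rule Liminf_mono) (simp add: bound)
  also have "\<dots> = ennreal (2 * C * measure lborel \<Omega>) + ennreal \<bar>B\<bar> * 0"
  proof (rule lim_imp_Liminf)
    show "(\<lambda>n. ennreal (2 * C * measure lborel \<Omega>) + ennreal \<bar>B\<bar> * E n) \<longlonglongrightarrow> ennreal (2 * C * measure lborel \<Omega>) + ennreal \<bar>B\<bar> * 0"
      using X_lim by (intro tendsto_add tendsto_const ennreal_tendsto_cmult) (simp_all add: E_def)
  qed simp
  finally show ?thesis by (simp add: f_def D_def A_def case_prod_unfold)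
qed

end

section \<open>The invariant region and the total dissipation\<close>

lemma ex_antiderivative:
  fixes f :: "real \<Rightarrow> real"
  assumes "continuous_on UNIV f"
  obtains P where "\<And>y. (P has_real_derivative f y) (at y)" "P 0 = 0"
proof -
  have "\<exists>P. \<forall>x. (-\<infinity>::ereal) < ereal x \<longrightarrow> ereal x < \<infinity> \<longrightarrow> (P has_vector_derivative f x) (at x)"
    using assms by (intro einterval_antiderivative) (auto simp: continuous_on_eq_continuous_at)
  then obtain P where "\<And>x. (P has_real_derivative f x) (at x)"
    by (auto simp: has_real_derivative_iff_has_vector_derivative)
  then have "((\<lambda>x. P x - P 0) has_real_derivative f y) (at y)" for y
    by (auto intro!: derivative_eq_intros)
  then show ?thesis using that[of "\<lambda>x. P x - P 0"] by simp
qed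

lemma antiderivative_nonneg:
  fixes P f :: "real \<Rightarrow> real"
  assumes P: "\<And>y. (P has_real_derivative f y) (at y)" "P 0 = 0"
    and f: "\<And>y. 0 \<le> y \<Longrightarrow> 0 \<le> f y" "\<And>y. y \<le> 0 \<Longrightarrow> f y \<le> 0"
  shows "0 \<le> P y"
proof (cases "0 \<le> y")
  case True
  have "P 0 \<le> P y"
    by (rule DERIV_nonneg_imp_nondecreasing[OF True]) (use P f in blast)
  then show ?thesis using P by simp
next
  case False
  have "P 0 \<le> P y"
    by (rule DERIV_nonpos_imp_nonincreasing[of y 0]) (use P f False in auto)
  then show ?thesis using P by simp
qed

lemma deriv_zero_at_zero_of_nonneg:
  fixes P :: "real \<Rightarrow> real"
  assumes "(P has_real_derivative d) (at y)" "\<And>z. 0 \<le> P z" "P y = 0"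
  shows "d = 0"
  by (rule DERIV_local_min[OF assms(1), of 1]) (use assms in auto)

lemma open_null_set_lborel:
  fixes W :: "'a::euclidean_space set"
  assumes "open W" "emeasure lborel W = 0"
  shows "W = {}"
proof (rule ccontr)
  assume "W \<noteq> {}"
  have "W \<in> null_sets lborel" using assms by (intro null_setsI) auto
  then have "negligible W" by (simp add: negligible_iff_null_sets null_sets_completionI)
  then show False using open_not_negligible[OF assms(1) \<open>W \<noteq> {}\<close>] by simp
qed

context neumann_reaction_diffusion
begin

lemma closed_cylinder_compact: "compact ({a..b} \<times> closure \<Omega>)" for a b :: real
  using bounded_dom by (intro compact_Times) auto

text \<open>The entropy belonging to \<open>max(0, y - N)\<^sup>2 - max(0, -y)\<^sup>2\<close>, which vanishes exactly on \<open>[0, N]\<close>, is zero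
  initially and does not increase.\<close>

lemma invariant_region:
  assumes F: "\<And>y. 0 \<le> y \<Longrightarrow> 0 \<le> F y" "\<And>y. y < 0 \<Longrightarrow> F y < 0" "F 0 = 0" and N: "0 \<le> N"
    and init: "\<And>x. x \<in> closure \<Omega> \<Longrightarrow> 0 \<le> u 0 x" "\<And>x. x \<in> closure \<Omega> \<Longrightarrow> 0 \<le> v 0 x"
      "\<And>x. x \<in> closure \<Omega> \<Longrightarrow> v 0 x \<le> N" "\<And>x l. x \<in> closure \<Omega> \<Longrightarrow> 0 \<le> l \<Longrightarrow> l \<le> u 0 x \<Longrightarrow> F l \<le> N"
    and t1: "0 < t1" "x1 \<in> \<Omega>"
  shows "0 \<le> u t1 x1" "F (u t1 x1) \<le> N" "0 \<le> v t1 x1" "v t1 x1 \<le> N"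
proof -
  define \<phi> where "\<phi> y = (max 0 (y - N))\<^sup>2 - (max 0 (- y))\<^sup>2" for y
  define \<phi>' where "\<phi>' y = 2 * max 0 (y - N) + 2 * max 0 (- y)" for y
  have \<phi>: "(\<phi> has_real_derivative \<phi>' y) (at y)" for y
    unfolding \<phi>_def[abs_def] \<phi>'_def
    by (rule DERIV_cong[OF DERIV_diff[OF DERIV_chain2[OF has_real_derivative_max_0_square, of "\<lambda>y. y - N"]
        DERIV_chain2[OF has_real_derivative_max_0_square, of "\<lambda>y. - y"]]]) (auto intro!: derivative_eq_intros)
  have \<phi>'_cont: "continuous_on UNIV \<phi>'" unfolding \<phi>'_def[abs_def] by (intro continuous_intros)
  have \<phi>_cont: "continuous_on UNIV \<phi>" unfolding \<phi>_def[abs_def] by (intro continuous_intros)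
  have \<phi>_zero: "\<phi> y = 0 \<longleftrightarrow> 0 \<le> y \<and> y \<le> N" for y
    using N by (cases "y < 0"; cases "y > N") (auto simp: \<phi>_def max_def)
  have \<phi>_sign: "0 \<le> y \<Longrightarrow> 0 \<le> \<phi> y" "y \<le> 0 \<Longrightarrow> \<phi> y \<le> 0" for y
    using N by (auto simp: \<phi>_def max_def)
  obtain P where P: "\<And>y. (P has_real_derivative \<phi> (F y)) (at y)" "P 0 = 0"
    using ex_antiderivative[OF continuous_on_compose2[OF \<phi>_cont F_cont]] by auto
  obtain Q where Q: "\<And>y. (Q has_real_derivative \<phi> y) (at y)" "Q 0 = 0"
    using ex_antiderivative[OF \<phi>_cont] by auto
  have F0: "F y \<le> 0" if "y \<le> 0" for y using F(2)[of y] F(3) that by (cases "y = 0") auto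
  have P_nonneg: "0 \<le> P y" for y
    by (rule antiderivative_nonneg[OF P]) (use F F0 \<phi>_sign in auto)
  have Q_nonneg: "0 \<le> Q y" for y
    by (rule antiderivative_nonneg[OF Q]) (use \<phi>_sign in auto)
  have const: "R y = 0" if R: "\<And>y. (R has_real_derivative f y) (at y)" "R 0 = 0" and f: "\<And>l. 0 \<le> l \<Longrightarrow> l \<le> y \<Longrightarrow> f l = 0"
    and y: "0 \<le> y" for R f :: "real \<Rightarrow> real" and y
  proof (cases "y = 0")
    case False
    then obtain z where "0 < z" "z < y" "R y - R 0 = (y - 0) * f z"
      using MVT2[of 0 y R f] R y by auto
    then show ?thesis using f[of z] R(2) by simp
  qed (use R in simp)
  define A where "A z = P (u (fst z) (snd z)) + Q (v (fst z) (snd z))" for z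
  have A_nonneg: "0 \<le> A z" for z using P_nonneg Q_nonneg by (simp add: A_def)
  have PQc: "continuous_on UNIV P" "continuous_on UNIV Q"
    using P(1) Q(1) DERIV_isCont by (blast intro: continuous_at_imp_continuous_on)+
  have A_cont: "continuous_on ({0..} \<times> closure \<Omega>) A"
    unfolding A_def[abs_def]
    by (intro continuous_on_add continuous_on_compose2[OF PQc(1) u_cont] continuous_on_compose2[OF PQc(2) v_cont]) auto
  have A_init: "A (0, x) = 0" if "x \<in> closure \<Omega>" for x
  proof -
    have "P (u 0 x) = 0"
      by (rule const[OF P]) (use init that F(1) \<phi>_zero in auto)
    moreover have "Q (v 0 x) = 0"
      by (rule const[OF Q]) (use init[OF that] \<phi>_zero in auto)
    ultimately show ?thesis by (simp add: A_def)
  qed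
  \<comment> \<open>A time window around \<open>t1\<close>, in the interior of which the weight
    \<open>\<eta>\<close> of the falling ramp is positive.\<close>
  define a where "a = t1 / 2"
  define b where "b = 2 * t1"
  have ab: "0 < a" "a < t1" "t1 < b" "a < b" using t1 by (auto simp: a_def b_def)
  define \<eta> where "\<eta> t = smooth_step' ((t - a) / (b - a)) / (b - a)" for t
  have \<eta>_nonneg: "0 \<le> \<eta> t" for t using smooth_step'_bounds ab by (simp add: \<eta>_def)
  \<comment> \<open>The entropy is continuous down to \<open>t = 0\<close>, where it vanishes, so it
    is below \<open>e\<close> on a short initial time interval. The energy estimate, with its rising
    ramp in that interval, carries this over to the window.\<close>
  have small: "(\<integral>\<^sup>+z\<in>cylinder. ennreal (\<eta> (fst z) * A z) \<partial>lborel) \<le> ennreal (2 * e * measure lborel \<Omega>)"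
    if e: "0 < e" for e
  proof -
    obtain d where d: "d > 0" "\<And>z. z \<in> {0..1} \<times> closure \<Omega> \<Longrightarrow> \<bar>fst z\<bar> \<le> d \<Longrightarrow> \<bar>A z\<bar> < e"
    proof -
      have 1: "continuous_on ({0..1} \<times> closure \<Omega>) (fst :: real \<times> 'a \<Rightarrow> real)" by (intro continuous_intros)
      have 2: "continuous_on ({0..1} \<times> closure \<Omega>) A" by (rule continuous_on_subset[OF A_cont]) auto
      have 3: "A z = 0" if "z \<in> {0..1} \<times> closure \<Omega>" "fst z = 0" for z
        using A_init[of "snd z"] that by (cases z) auto
      show ?thesis using compact_small_near_zero_set[OF closed_cylinder_compact 1 2 3 e] that by blast
    qed
    \<comment> \<open>\<open>2 * s\<close> has to stay within \<open>d\<close>, within the interval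
      \<open>[0, 1]\<close> on which \<open>d\<close> was found, and strictly below
      \<open>a\<close>.\<close>
    define s where "s = min (min d 1) (a / 2) / 2"
    have s: "0 < s" "2 * s \<le> d" "2 * s \<le> 1" "2 * s < a" using d ab by (auto simp: s_def min_def)
    have C: "P (u t x) + Q (v t x) \<le> e" if "s \<le> t" "t \<le> 2 * s" "x \<in> \<Omega>" for t x
      using d(2)[of "(t, x)"] that s closure_subset[of \<Omega>] by (auto simp: A_def)
    have \<phi>'_nonneg: "0 \<le> \<phi>' y" for y by (simp add: \<phi>'_def)
    have mono: "\<phi> x \<le> \<phi> y" if "x \<le> y" for x y
      by (rule DERIV_nonneg_imp_nondecreasing[OF that]) (use \<phi> \<phi>'_nonneg in blast)
    have D: "0 \<le> (\<phi> x - \<phi> y) * (x - y) / \<epsilon>" for x y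
      using mono[of x y] mono[of y x] eps_pos
      by (cases "x \<le> y") (auto intro!: divide_nonneg_pos mult_nonneg_nonneg mult_nonpos_nonpos)
    have "(\<integral>\<^sup>+z\<in>cylinder. ennreal (\<eta> (fst z) * A z) \<partial>lborel) \<le> (\<integral>\<^sup>+z\<in>cylinder. ennreal (case z of (t, x) \<Rightarrow>
      smooth_step ((t - s) / s) * (1 - smooth_step ((t - a) / (b - a))) * (\<phi>' (v t x) * (G t x \<bullet> G t x)
      + (\<phi> (F (u t x)) - \<phi> (v t x)) * (F (u t x) - v t x) / \<epsilon>)
      + smooth_step' ((t - a) / (b - a)) / (b - a) * (P (u t x) + Q (v t x))) \<partial>lborel)"
    proof (intro nn_integral_mono mult_right_mono ennreal_leI)
      fix z :: "real \<times> 'a"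
      obtain t x where z: "z = (t, x)" by (cases z)
      have "0 \<le> smooth_step ((t - s) / s) * (1 - smooth_step ((t - a) / (b - a))) * (\<phi>' (v t x) * (G t x \<bullet> G t x)
        + (\<phi> (F (u t x)) - \<phi> (v t x)) * (F (u t x) - v t x) / \<epsilon>)"
        using smooth_step_bounds D \<phi>'_nonneg by (intro mult_nonneg_nonneg add_nonneg_nonneg) auto
      then show "\<eta> (fst z) * A z \<le> (case z of (t, x) \<Rightarrow>
        smooth_step ((t - s) / s) * (1 - smooth_step ((t - a) / (b - a))) * (\<phi>' (v t x) * (G t x \<bullet> G t x)
        + (\<phi> (F (u t x)) - \<phi> (v t x)) * (F (u t x) - v t x) / \<epsilon>)
        + smooth_step' ((t - a) / (b - a)) / (b - a) * (P (u t x) + Q (v t x)))"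
        unfolding z case_prod_conv by (simp add: \<eta>_def A_def)
    qed simp
    also have "\<dots> \<le> ennreal (2 * e * measure lborel \<Omega>)"
      by (rule energy_estimate[OF \<phi> \<phi>'_cont \<phi>'_nonneg P(1) P_nonneg Q(1) Q_nonneg s(1) s(4) ab(4) C])
    finally show ?thesis .
  qed
  have "(\<integral>\<^sup>+z\<in>cylinder. ennreal (\<eta> (fst z) * A z) \<partial>lborel) \<le> 0"
  proof (rule ennreal_le_epsilon)
    fix e :: real assume e: "0 < e"
    define e' where "e' = e / (2 * (measure lborel \<Omega> + 1))"
    have e': "0 < e'" using e measure_nonneg[of lborel \<Omega>] by (simp add: e'_def add_nonneg_pos)
    have "0 < 2 * (measure lborel \<Omega> + 1)"
      using measure_nonneg[of lborel \<Omega>] by (intro mult_pos_pos add_nonneg_pos) auto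
    then have "2 * (measure lborel \<Omega> + 1) \<noteq> 0" by (rule less_imp_neq[THEN not_sym])
    from nonzero_eq_divide_eq[THEN iffD1, OF this e'_def]
    have "e' * (2 * (measure lborel \<Omega> + 1)) = e" .
    then have "2 * e' * measure lborel \<Omega> \<le> e" using e' by (simp add: algebra_simps)
    then have "ennreal (2 * e' * measure lborel \<Omega>) \<le> ennreal e" by (rule ennreal_leI)
    then show "(\<integral>\<^sup>+z\<in>cylinder. ennreal (\<eta> (fst z) * A z) \<partial>lborel) \<le> 0 + ennreal e"
      using small[OF e'] by simp
  qed
  then have zero: "(\<integral>\<^sup>+z. ennreal (indicator cylinder z * (\<eta> (fst z) * A z)) \<partial>lborel) = 0"
  proof -
    have "ennreal (indicator cylinder z * y) = ennreal y * indicator cylinder z" for z y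
      by (simp add: indicator_def)
    with \<open>_ \<le> 0\<close> show ?thesis by simp
  qed
  \<comment> \<open>By continuity the set where the weighted entropy is positive is open, and it is
    a null set. Hence it is empty, and the entropy vanishes at the given point and not just almost
    everywhere.\<close>
  define W where "W = {z \<in> cylinder. 0 < \<eta> (fst z) * A z}"
  have hc: "continuous_on cylinder (\<lambda>z. \<eta> (fst z) * A z)"
    unfolding \<eta>_def using ab by (intro continuous_intros continuous_on_subset[OF A_cont cylinder_subset(2)]) auto
  have "open W"
  proof -
    have "W = cylinder \<inter> (\<lambda>z. \<eta> (fst z) * A z) -` {0<..}" by (auto simp: W_def)
    then show ?thesis using continuous_open_preimage[OF hc open_cylinder] by simp
  qed
  moreover have "emeasure lborel W = 0"
  proof -
    have "(\<lambda>z. indicator cylinder z *\<^sub>R (\<eta> (fst z) * A z)) \<in> borel_measurable borel"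
      using open_cylinder by (intro borel_measurable_continuous_on_indicator hc) auto
    then have "AE z in lborel. ennreal (indicator cylinder z * (\<eta> (fst z) * A z)) = 0"
      using zero by (subst (asm) nn_integral_0_iff_AE) auto
    then have "AE z in lborel. z \<notin> W"
      by eventually_elim (auto simp: W_def ennreal_eq_0_iff)
    then show ?thesis using \<open>open W\<close> by (subst (asm) AE_iff_measurable[of W]) auto
  qed
  ultimately have "W = {}" by (rule open_null_set_lborel)
  moreover have "0 < \<eta> t1"
  proof -
    have "0 < (t1 - a) / (b - a)" "(t1 - a) / (b - a) < 1" using ab by (auto simp: field_simps)
    then show ?thesis using ab smooth_step'_pos by (simp add: \<eta>_def)
  qed
  ultimately have "A (t1, x1) = 0"
    using t1 A_nonneg[of "(t1, x1)"] unfolding W_def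
    by (smt (verit, best) SigmaI empty_Collect_eq fst_conv greaterThan_iff mult_pos_pos)
  then have "P (u t1 x1) = 0" "Q (v t1 x1) = 0"
    using P_nonneg[of "u t1 x1"] Q_nonneg[of "v t1 x1"] by (auto simp: A_def)
  \<comment> \<open>A nonnegative primitive that takes the value 0 has a minimum there, so its
    derivative vanishes: \<open>F u\<close> and \<open>v\<close> are zeros of \<open>\<phi>\<close>,
    that is, points of \<open>[0, N]\<close>.\<close>
  then have "\<phi> (F (u t1 x1)) = 0" "\<phi> (v t1 x1) = 0"
    using deriv_zero_at_zero_of_nonneg[OF P(1) P_nonneg] deriv_zero_at_zero_of_nonneg[OF Q(1) Q_nonneg] by auto
  then show "0 \<le> u t1 x1" "F (u t1 x1) \<le> N" "0 \<le> v t1 x1" "v t1 x1 \<le> N"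
    using \<phi>_zero F(2)[of "u t1 x1"] by (auto simp: not_less[symmetric])
qed

text \<open>The energy estimate for \<open>\<phi>(\<xi>) = \<xi>\<close>, whose entropy is
  \<open>P(u) + v\<^sup>2 / 2\<close>. The falling ramp is placed on \<open>[T, T + 1]\<close>, so
  that the time cutoff is 1 from the end of the rising ramp up to \<open>T\<close>. As
  \<open>C\<close> bounds the entropy at all positive times, the rising ramp can be pushed to 0,
  again by Fatou's lemma.\<close>

lemma dissipation_bound:
  assumes P: "\<And>y. (P has_real_derivative F y) (at y)" "\<And>y. 0 \<le> P y"
    and C: "\<And>t x. 0 < t \<Longrightarrow> x \<in> \<Omega> \<Longrightarrow> P (u t x) + (v t x)\<^sup>2 / 2 \<le> C"
    and T: "0 < T"
  shows "(\<integral>\<^sup>+z\<in>{0<..<T} \<times> \<Omega>. ennreal (case z of (t, x) \<Rightarrow> G t x \<bullet> G t x + (F (u t x) - v t x)\<^sup>2 / \<epsilon>) \<partial>lborel)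
    \<le> ennreal (2 * C * measure lborel \<Omega>)"
proof -
  define D where "D z = (case z of (t, x) \<Rightarrow> G t x \<bullet> G t x + (F (u t x) - v t x)\<^sup>2 / \<epsilon>)" for z
  have D_nonneg: "0 \<le> D z" for z using eps_pos by (auto simp: D_def split: prod.split)
  \<comment> \<open>The factor 4 gives \<open>2 * s n \<le> T / 2\<close>, so the rising ramp ends
    before \<open>T\<close>.\<close>
  define s where "s n = T / (4 * real (Suc n))" for n
  have s: "0 < s n" "2 * s n < T" for n
    using T by (auto simp: s_def field_simps intro!: add_pos_nonneg)
  have s_lim: "(\<lambda>n. 2 * s n) \<longlonglongrightarrow> 0"
  proof -
    have "(\<lambda>n. T / 2 * (1 / real (Suc n))) \<longlonglongrightarrow> T / 2 * 0"
      using LIMSEQ_Suc[OF lim_1_over_n[where ?'a=real]] by (intro tendsto_mult tendsto_const) simp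
    moreover have "(\<lambda>n. 2 * s n) = (\<lambda>n. T / 2 * (1 / real (Suc n)))"
      by (simp add: s_def fun_eq_iff del: of_nat_Suc)
    ultimately show ?thesis by simp
  qed
  define I where "I n = ({2 * s n<..<T} \<times> \<Omega> :: (real \<times> 'a) set)" for n
  have bound: "(\<integral>\<^sup>+z. ennreal (indicator (I n) z * D z) \<partial>lborel) \<le> ennreal (2 * C * measure lborel \<Omega>)" for n
  proof -
    have "(\<integral>\<^sup>+z. ennreal (indicator (I n) z * D z) \<partial>lborel) \<le> (\<integral>\<^sup>+z\<in>cylinder. ennreal (case z of (t, x) \<Rightarrow>
      smooth_step ((t - s n) / s n) * (1 - smooth_step ((t - T) / (T + 1 - T))) * (1 * (G t x \<bullet> G t x)
      + (F (u t x) - v t x) * (F (u t x) - v t x) / \<epsilon>)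
      + smooth_step' ((t - T) / (T + 1 - T)) / (T + 1 - T) * (P (u t x) + (v t x)\<^sup>2 / 2)) \<partial>lborel)"
    proof (intro nn_integral_mono)
      fix z :: "real \<times> 'a"
      obtain t x where z: "z = (t, x)" by (cases z)
      show "ennreal (indicator (I n) z * D z) \<le> ennreal (case z of (t, x) \<Rightarrow>
      smooth_step ((t - s n) / s n) * (1 - smooth_step ((t - T) / (T + 1 - T))) * (1 * (G t x \<bullet> G t x)
      + (F (u t x) - v t x) * (F (u t x) - v t x) / \<epsilon>)
      + smooth_step' ((t - T) / (T + 1 - T)) / (T + 1 - T) * (P (u t x) + (v t x)\<^sup>2 / 2)) * indicator cylinder z"
      proof (cases "z \<in> I n")
        case True
        then have t: "2 * s n < t" "t < T" "x \<in> \<Omega>" by (auto simp: I_def z)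
        then have "1 \<le> (t - s n) / s n" "0 < t" using s[of n] by (auto simp: field_simps)
        then show ?thesis using True t by (simp add: z D_def smooth_step_simps power2_eq_square)
      qed simp
    qed
    also have "\<dots> \<le> ennreal (2 * C * measure lborel \<Omega>)"
    proof (rule energy_estimate[where \<phi> = "\<lambda>y. y" and \<phi>' = "\<lambda>_. 1"])
      show "((\<lambda>y. y\<^sup>2 / 2) has_real_derivative y) (at y)" for y :: real
        by (auto intro!: derivative_eq_intros)
      show "P (u t x) + (v t x)\<^sup>2 / 2 \<le> C" if "s n \<le> t" "x \<in> \<Omega>" for t x
        using that s[of n] by (intro C) auto
    qed (use s[of n] P in auto)
    finally show ?thesis .
  qed
  have Dc: "continuous_on cylinder D"
    unfolding D_def[abs_def] case_prod_unfold using eps_pos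
    by (intro continuous_intros continuous_on_cylinder) auto
  have Im: "(\<lambda>z. indicator (I n) z * D z) \<in> borel_measurable borel" for n
  proof -
    have "open (I n)" using open_dom by (auto simp: I_def intro: open_Times)
    moreover have "I n \<subseteq> cylinder"
    proof -
      have "{2 * s n<..<T} \<subseteq> {0<..}" using s(1)[of n] by auto
      then show ?thesis unfolding I_def by (intro Sigma_mono) auto
    qed
    ultimately show ?thesis
      using borel_measurable_continuous_on_indicator[OF _ continuous_on_subset[OF Dc], of "I n"] by simp
  qed
  have "(\<integral>\<^sup>+z\<in>{0<..<T} \<times> \<Omega>. ennreal (D z) \<partial>lborel) = (\<integral>\<^sup>+z. liminf (\<lambda>n. ennreal (indicator (I n) z * D z)) \<partial>lborel)"
  proof (rule nn_integral_cong)
    fix z :: "real \<times> 'a"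
    have "(\<lambda>n. ennreal (indicator (I n) z * D z)) \<longlonglongrightarrow> ennreal (D z) * indicator ({0<..<T} \<times> \<Omega>) z"
    proof (rule tendsto_eventually)
      show "\<forall>\<^sub>F n in sequentially. ennreal (indicator (I n) z * D z) = ennreal (D z) * indicator ({0<..<T} \<times> \<Omega>) z"
      proof (cases "z \<in> {0<..<T} \<times> \<Omega>")
        case True
        then have "\<forall>\<^sub>F n in sequentially. 2 * s n < fst z" using order_tendstoD(2)[OF s_lim, of "fst z"] by auto
        then show ?thesis
        proof eventually_elim
          case (elim n)
          then have "z \<in> I n" using True by (auto simp: I_def)
          then show ?case using True by simp
        qed
      next
        case False
        have "z \<notin> I n" for n
        proof
          assume "z \<in> I n"
          then have "z \<in> {0<..<T} \<times> \<Omega>" using s(1)[of n] by (auto simp: I_def)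
          then show False using False by simp
        qed
        then show ?thesis using False by simp
      qed
    qed
    then show "ennreal (D z) * indicator ({0<..<T} \<times> \<Omega>) z = liminf (\<lambda>n. ennreal (indicator (I n) z * D z))"
      using lim_imp_Liminf[OF sequentially_bot] by metis
  qed
  also have "\<dots> \<le> liminf (\<lambda>n. \<integral>\<^sup>+z. ennreal (indicator (I n) z * D z) \<partial>lborel)"
    by (rule nn_integral_liminf) (use Im in auto)
  also have "\<dots> \<le> liminf (\<lambda>n. ennreal (2 * C * measure lborel \<Omega>))"
    by (rule Liminf_mono) (simp add: bound)
  also have "\<dots> = ennreal (2 * C * measure lborel \<Omega>)" by (simp add: Liminf_const)
  finally show ?thesis by (simp add: D_def)
qed

end

section \<open>Classical solutions as instances of the locale\<close>

lemma differentiable_line_derivative: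
  fixes f :: "'a::euclidean_space \<Rightarrow> real"
  assumes "f differentiable (at x)"
  shows "((\<lambda>s. f (x + s *\<^sub>R b)) has_real_derivative partial b f x) (at 0)"
proof -
  have "(f has_derivative frechet_derivative f (at x)) (at x)"
    using assms by (rule frechet_derivative_works[THEN iffD1])
  then have "(f has_derivative frechet_derivative f (at x)) (at (x + 0 *\<^sub>R b))" by simp
  moreover have "((\<lambda>s. x + s *\<^sub>R b) has_derivative (\<lambda>s. s *\<^sub>R b)) (at 0)"
    by (auto intro!: derivative_eq_intros)
  ultimately have D: "((\<lambda>s. f (x + s *\<^sub>R b)) has_derivative (\<lambda>s. frechet_derivative f (at x) (s *\<^sub>R b))) (at 0)"
    using has_derivative_compose by blast
  have "linear (frechet_derivative f (at x))"
    using assms by (rule linear_frechet_derivative)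
  then show ?thesis
    by (intro has_derivative_imp_has_field_derivative[OF D]) (simp add: partial_def linear_cmul)
qed

text \<open>At interior points the gradient within the closure is the ordinary one, so
  \<open>G \<bullet> b\<close> agrees near each such point with the partial derivative of
  \<open>v\<close>, and its derivative along \<open>b\<close> is the pure second partial
  derivative.\<close>

lemma classical_solution_neumann_reaction_diffusion:
  fixes \<Omega> :: "'a::euclidean_space set"
  assumes dom: "smooth_bounded_domain \<Omega>" and F: "continuous_on UNIV F" and e: "0 < \<epsilon>"
    and sol: "classical_solution \<Omega> F u0 v0 \<epsilon> u v"
  shows "\<exists>G H. neumann_reaction_diffusion \<Omega> F \<epsilon> u v G H"
proof -
  have op: "open \<Omega>" using dom by (simp add: smooth_bounded_domain_def)
  from sol[unfolded classical_solution_def]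
  have uc: "continuous_on ({0..} \<times> closure \<Omega>) (\<lambda>(t, x). u t x)"
    and vc: "continuous_on ({0..} \<times> closure \<Omega>) (\<lambda>(t, x). v t x)"
    and diff: "\<And>t x. t > 0 \<Longrightarrow> x \<in> \<Omega> \<Longrightarrow> (\<lambda>s. u s x) differentiable (at t) \<and> (\<lambda>s. v s x) differentiable (at t)"
    and C2: "\<And>t. t > 0 \<Longrightarrow> Ck_on 2 (v t) \<Omega>"
    and Hc: "\<And>b c. b \<in> Basis \<Longrightarrow> c \<in> Basis \<Longrightarrow>
        continuous_on ({0<..} \<times> \<Omega>) (\<lambda>(t, x). partial c (partial b (v t)) x)"
    and G: "\<exists>G. continuous_on ({0<..} \<times> closure \<Omega>) (\<lambda>(t, x). G t x) \<and>
        (\<forall>t>0. \<forall>x\<in>closure \<Omega>. (v t has_derivative (\<lambda>h. G t x \<bullet> h)) (at x within closure \<Omega>))"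
    and eq: "\<And>t x. t > 0 \<Longrightarrow> x \<in> \<Omega> \<Longrightarrow>
        deriv (\<lambda>s. u s x) t = (v t x - F (u t x)) / \<epsilon> \<and>
        deriv (\<lambda>s. v s x) t = laplacian (v t) x + (F (u t x) - v t x) / \<epsilon>"
    and bc: "\<And>t. t > 0 \<Longrightarrow> neumann_bc \<Omega> (v t)"
    by blast+
  from G obtain G where Gc: "continuous_on ({0<..} \<times> closure \<Omega>) (\<lambda>(t, x). G t x)"
    and Gd: "\<And>t x. t > 0 \<Longrightarrow> x \<in> closure \<Omega> \<Longrightarrow> (v t has_derivative (\<lambda>h. G t x \<bullet> h)) (at x within closure \<Omega>)"
    by blast
  define H where "H b t x = partial b (partial b (v t)) x" for b t x
  have D: "((\<lambda>s. f s) has_real_derivative deriv f t) (at t)" if "f differentiable (at t)" for f :: "real \<Rightarrow> real" and t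
    using that by (simp add: DERIV_deriv_iff_real_differentiable)
  have "neumann_reaction_diffusion \<Omega> F \<epsilon> u v G H"
  proof (intro neumann_reaction_diffusion.intro reaction_diffusion.intro neumann_reaction_diffusion_axioms.intro)
    show "open \<Omega>" "continuous_on UNIV F" "0 < \<epsilon>" "smooth_bounded_domain \<Omega>" by fact+
    show "neumann_bc \<Omega> (v t)" if "0 < t" for t by (rule bc[OF that])
    show "continuous_on ({0..} \<times> closure \<Omega>) (\<lambda>z. u (fst z) (snd z))"
      "continuous_on ({0..} \<times> closure \<Omega>) (\<lambda>z. v (fst z) (snd z))"
      "continuous_on ({0<..} \<times> closure \<Omega>) (\<lambda>z. G (fst z) (snd z))"
      using uc vc Gc by (simp_all add: case_prod_unfold)
    show "continuous_on ({0<..} \<times> \<Omega>) (\<lambda>z. H b (fst z) (snd z))" if "b \<in> Basis" for b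
      using Hc[OF that that] by (simp add: case_prod_unfold H_def)
    show "(v t has_derivative (\<lambda>h. G t x \<bullet> h)) (at x within closure \<Omega>)" if "0 < t" "x \<in> closure \<Omega>" for t x
      by (rule Gd[OF that])
    show "((\<lambda>s. u s x) has_real_derivative (v t x - F (u t x)) / \<epsilon>) (at t)" if "0 < t" "x \<in> \<Omega>" for t x
      using D[of "\<lambda>s. u s x" t] diff[OF that] eq[OF that] by simp
    show "((\<lambda>s. v s x) has_real_derivative (\<Sum>b\<in>Basis. H b t x) + (F (u t x) - v t x) / \<epsilon>) (at t)" if "0 < t" "x \<in> \<Omega>" for t x
      using D[of "\<lambda>s. v s x" t] diff[OF that] eq[OF that] by (simp add: H_def laplacian_def)
    show "((\<lambda>s. G t (x + s *\<^sub>R b) \<bullet> b) has_real_derivative H b t x) (at 0)" if t: "0 < t" "x \<in> \<Omega>" "b \<in> Basis" for t x b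
    proof -
      have "Ck_on (Suc (Suc 0)) (v t) \<Omega>" using C2[OF t(1)] by (simp add: numeral_2_eq_2)
      then have "partial b (v t) differentiable_on \<Omega>" using t(3) by simp
      then have "partial b (v t) differentiable (at x)"
        using differentiable_on_eq_differentiable_at[OF op] t(2) by blast
      then have "((\<lambda>s. partial b (v t) (x + s *\<^sub>R b)) has_real_derivative H b t x) (at 0)"
        unfolding H_def by (rule differentiable_line_derivative)
      moreover have "\<forall>\<^sub>F s in nhds 0. partial b (v t) (x + s *\<^sub>R b) = G t (x + s *\<^sub>R b) \<bullet> b"
      proof -
        have "((\<lambda>s. x + s *\<^sub>R b) \<longlongrightarrow> x + 0 *\<^sub>R b) (nhds 0)" by (intro tendsto_intros filterlim_ident)
        then have "\<forall>\<^sub>F s in nhds 0. x + s *\<^sub>R b \<in> \<Omega>" using op t(2) by (simp add: tendsto_def)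
        then show ?thesis
        proof eventually_elim
          case (elim s)
          let ?y = "x + s *\<^sub>R b"
          have int: "?y \<in> interior (closure \<Omega>)" using elim interior_maximal[OF closure_subset op] by auto
          then have "(v t has_derivative (\<lambda>h. G t ?y \<bullet> h)) (at ?y)"
            using Gd[OF t(1), of ?y] at_within_interior[OF int] interior_subset by fastforce
          then show ?case using frechet_derivative_at[of "v t" "\<lambda>h. G t ?y \<bullet> h" ?y] by (simp add: partial_def)
        qed
      qed
      ultimately show ?thesis by (subst (asm) DERIV_cong_ev[OF refl _ refl])
    qed
  qed
  then show ?thesis by blast
qed

section \<open>Weak compactness of bounded measures\<close>

text \<open>Digits are counted from 0, and digit \<open>i\<close> has weight
  \<open>1 / 2 ^ Suc i\<close>. The formula by floors makes each digit a Borel function of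
  \<open>y\<close>.\<close>

definition binary_digit :: "nat \<Rightarrow> real \<Rightarrow> real" where
  "binary_digit i y = of_int (\<lfloor>2 ^ Suc i * y\<rfloor> - 2 * \<lfloor>2 ^ i * y\<rfloor>)"

lemma binary_digit_cases: "binary_digit i y = 0 \<or> binary_digit i y = 1"
proof -
  have "\<lfloor>2 * (2 ^ i * y)\<rfloor> - 2 * \<lfloor>2 ^ i * y\<rfloor> \<in> {0, 1}" by (simp, linarith)
  then show ?thesis unfolding binary_digit_def by (simp add: mult.assoc) fastforce
qed

text \<open>The partial sums telescope to
  \<open>\<lfloor>2 ^ n * y\<rfloor> / 2 ^ n\<close>.\<close>

lemma binary_digit_sums:
  assumes "0 \<le> y" "y < 1"
  shows "(\<lambda>i. binary_digit i y / 2 ^ Suc i) sums y"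
proof -
  have part: "(\<Sum>i<n. binary_digit i y / 2 ^ Suc i) = of_int \<lfloor>2 ^ n * y\<rfloor> / 2 ^ n" for n
  proof (induction n)
    case 0
    have "\<lfloor>y\<rfloor> = 0" using assms by (simp add: floor_eq_iff)
    then show ?case by simp
  qed (simp add: binary_digit_def field_simps)
  have "(\<lambda>n. of_int \<lfloor>2 ^ n * y\<rfloor> / 2 ^ n) \<longlonglongrightarrow> y"
  proof (rule real_tendsto_sandwich)
    show "\<forall>\<^sub>F n in sequentially. y - (1/2) ^ n \<le> of_int \<lfloor>2 ^ n * y\<rfloor> / 2 ^ n"
    proof (rule always_eventually, rule allI)
      fix n
      have "2 ^ n * y - 1 \<le> of_int \<lfloor>2 ^ n * y\<rfloor>" by linarith
      then have "(2 ^ n * y - 1) / 2 ^ n \<le> of_int \<lfloor>2 ^ n * y\<rfloor> / 2 ^ n" by (simp add: divide_right_mono)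
      then show "y - (1/2) ^ n \<le> of_int \<lfloor>2 ^ n * y\<rfloor> / 2 ^ n" by (simp add: diff_divide_distrib power_one_over)
    qed
    show "\<forall>\<^sub>F n in sequentially. of_int \<lfloor>2 ^ n * y\<rfloor> / 2 ^ n \<le> y"
    proof (rule always_eventually, rule allI)
      fix n
      have "of_int \<lfloor>2 ^ n * y\<rfloor> \<le> 2 ^ n * y" by linarith
      then show "of_int \<lfloor>2 ^ n * y\<rfloor> / 2 ^ n \<le> y" by (simp add: divide_le_eq mult.commute)
    qed
    show "(\<lambda>n. y - (1/2) ^ n) \<longlonglongrightarrow> y"
      using tendsto_diff[OF tendsto_const[of y] LIMSEQ_power_zero[of "1/2::real"]] by simp
  qed simp
  then show ?thesis unfolding sums_def part .
qed

text \<open>An expansion in base 4 with digits 0 and 2 only. Its values form a Cantor set, and the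
  gaps leave room for a continuous function to change from one digit value to the other.\<close>

definition quaternary_code :: "(nat \<Rightarrow> real) \<Rightarrow> real" where
  "quaternary_code d = (\<Sum>i. 2 * d i / 4 ^ Suc i)"

text \<open>A clipped cosine of period 1: it is 0 where the cosine is at least 1/2, that is, within
  distance 1/6 of the integers, and 1 where the cosine is at most -1/2, in particular on
  \<open>[1/2, 2/3]\<close>.\<close>

definition digit_wave :: "real \<Rightarrow> real" where
  "digit_wave y = max 0 (min 1 (1 / 2 - cos (2 * pi * y)))"

lemma digit_wave_bounds: "0 \<le> digit_wave y" "digit_wave y \<le> 1"
  by (auto simp: digit_wave_def)

lemma quaternary_summable:
  assumes "\<And>i. d i = 0 \<or> d i = (1::real)"
  shows "summable (\<lambda>i. 2 * d i / 4 ^ Suc i)"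
proof (rule summable_comparison_test')
  show "summable (\<lambda>i. (1/4::real) ^ i)" by (rule summable_geometric) simp
  show "norm (2 * d i / 4 ^ Suc i) \<le> (1/4) ^ i" if "i \<ge> 0" for i
    using assms[of i] by (auto simp: power_one_over field_simps)
qed

lemma quaternary_code_bounds:
  assumes "\<And>i. d i = 0 \<or> d i = (1::real)"
  shows "0 \<le> quaternary_code d" "quaternary_code d \<le> 2 / 3"
proof -
  have d: "0 \<le> d i \<and> d i \<le> 1" for i using assms[of i] by auto
  show "0 \<le> quaternary_code d" unfolding quaternary_code_def
    by (rule suminf_nonneg[OF quaternary_summable[OF assms]]) (use d in simp)
  have s: "(\<lambda>i. (1/2) * (1/4::real) ^ i) sums (2/3)"
    using sums_mult[OF geometric_sums[of "1/4::real"], of "1/2"] by simp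
  have "quaternary_code d \<le> (\<Sum>i. (1/2) * (1/4) ^ i)" unfolding quaternary_code_def
    by (rule suminf_le[OF _ quaternary_summable[OF assms] sums_summable[OF s]])
      (use d in \<open>simp add: power_one_over field_simps\<close>)
  then show "quaternary_code d \<le> 2 / 3" using s sums_unique by fastforce
qed

text \<open>Multiplication by \<open>4 ^ n\<close> shifts the digits, and the wave, having period 1, only sees the
  fractional part: it lies in \<open>[0, 1/6]\<close> if digit number \<open>n\<close> is 0 and in \<open>[1/2, 2/3]\<close> if it is 1.\<close>

lemma digit_wave_quaternary_code:
  assumes "\<And>i. d i = 0 \<or> d i = (1::real)"
  shows "digit_wave (4 ^ n * quaternary_code d) = d n"
proof -
  \<comment> \<open>What follows digit \<open>n\<close>: the code of the shifted sequence divided by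
    4. A code is at most 2/3, whence the bound 1/6.\<close>
  define r where "r = quaternary_code (\<lambda>k. d (k + Suc n)) / 4"
  have r: "0 \<le> r" "r \<le> 1 / 6"
    using quaternary_code_bounds[of "\<lambda>k. d (k + Suc n)"] assms by (auto simp: r_def)
  have "quaternary_code d = (\<Sum>k. 2 * d (k + Suc n) / 4 ^ Suc (k + Suc n)) + (\<Sum>i<Suc n. 2 * d i / 4 ^ Suc i)"
    unfolding quaternary_code_def by (rule suminf_split_initial_segment[OF quaternary_summable[OF assms]])
  also have "(\<Sum>k. 2 * d (k + Suc n) / 4 ^ Suc (k + Suc n)) = (\<Sum>k. (1 / 4 ^ Suc n) * (2 * d (k + Suc n) / 4 ^ Suc k))"
    by (simp add: power_add mult_ac)
  also have "\<dots> = (1 / 4 ^ Suc n) * (4 * r)"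
    by (subst suminf_mult[OF quaternary_summable]) (use assms in \<open>auto simp: r_def quaternary_code_def\<close>)
  finally have "4 ^ n * quaternary_code d = r + d n / 2 + (\<Sum>i<n. 4 ^ n * (2 * d i / 4 ^ Suc i))"
    by (simp add: distrib_left sum_distrib_left)
  moreover have "(\<Sum>i<n. 4 ^ n * (2 * d i / 4 ^ Suc i)) \<in> \<int>"
  proof (rule Ints_sum)
    fix i assume "i \<in> {..<n}"
    then have "(4::real) ^ n = 4 ^ (n - Suc i) * 4 ^ Suc i"
      by (subst power_add[symmetric]) auto
    then have "4 ^ n * (2 * d i / 4 ^ Suc i) = 4 ^ (n - Suc i) * (2 * d i)" by (simp add: field_simps)
    then show "4 ^ n * (2 * d i / 4 ^ Suc i) \<in> \<int>" using assms[of i] by auto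
  qed
  then obtain m where "(\<Sum>i<n. 4 ^ n * (2 * d i / 4 ^ Suc i)) = of_int m" by (auto elim: Ints_cases)
  ultimately have "cos (2 * pi * (4 ^ n * quaternary_code d)) = cos ((2 * pi * r + d n * pi) + of_int m * (2 * pi))"
    by (simp add: algebra_simps)
  also have "\<dots> = cos (2 * pi * r + d n * pi)"
    using cos_add[of "2 * pi * r + d n * pi" "2 * pi * of_int m"] cos_int_2pin[of m] sin_int_2pin[of m]
    by (simp add: mult.commute)
  finally have *: "cos (2 * pi * (4 ^ n * quaternary_code d)) = cos (2 * pi * r + d n * pi)" .
  \<comment> \<open>A digit 1 shifts the argument by \<open>pi\<close> and flips the sign of the
    cosine. So the cosine is at least 1/2 for digit 0 and at most -1/2 for digit 1, and clipping
    returns the digit exactly.\<close>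
  have "cos (pi / 3) \<le> cos (2 * pi * r)"
    by (rule cos_monotone_0_pi_le) (use r in auto)
  then have "cos (2 * pi * r) \<ge> 1 / 2" by (simp add: cos_60)
  then show ?thesis unfolding digit_wave_def * using assms[of n] by auto
qed

text \<open>The map \<open>g\<close> is a Schoenberg type space-filling curve: it reads the binary digits of all
  coordinates, interleaved, off the base 4 digits of its argument.\<close>

lemma space_filling_curve:
  fixes A :: real
  assumes A: "A > 0"
  obtains g :: "real \<Rightarrow> 'a::euclidean_space" and s where
    "continuous_on UNIV g" "s \<in> borel_measurable borel" "\<And>x. 0 \<le> s x \<and> s x \<le> 1"
    "\<And>x. (\<And>b. b \<in> Basis \<Longrightarrow> \<bar>x \<bullet> b\<bar> < A) \<Longrightarrow> g (s x) = x"
proof -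
  define m where "m = DIM('a)"
  have m: "m > 0" by (simp add: m_def)
  obtain e where e: "bij_betw e {..<m} (Basis :: 'a set)"
    using ex_bij_betw_nat_finite[of "Basis :: 'a set"] by (auto simp: m_def atLeast0LessThan)
  define c where "c x j = (x \<bullet> e j + A) / (2 * A)" for x j
  \<comment> \<open>Digit \<open>i * m + j\<close> of the code is binary digit \<open>i\<close> of
    coordinate \<open>j\<close>, rescaled to \<open>[0, 1)\<close>; \<open>\<gamma>\<close> looks it
    up at that position.\<close>
  define d where "d x n = binary_digit (n div m) (c x (n mod m))" for x n
  \<comment> \<open>The map \<open>s\<close> need only be Borel: measures are pushed forward along
    it, whereas continuous functions are composed with \<open>g\<close>.\<close>
  define s where "s x = quaternary_code (d x)" for x
  define \<gamma> where "\<gamma> j y = (\<Sum>i. digit_wave (4 ^ (i * m + j) * y) / 2 ^ Suc i)" for j y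
  define g where "g y = (\<Sum>j<m. (2 * A * \<gamma> j y - A) *\<^sub>R e j)" for y
  have d: "d x n = 0 \<or> d x n = 1" for x n unfolding d_def by (rule binary_digit_cases)
  have "continuous_on UNIV (\<gamma> j)" for j
  proof (rule uniform_limit_theorem)
    show "uniform_limit UNIV (\<lambda>n y. \<Sum>i<n. digit_wave (4 ^ (i * m + j) * y) / 2 ^ Suc i) (\<gamma> j) sequentially"
      unfolding \<gamma>_def
    proof (rule Weierstrass_m_test)
      show "norm (digit_wave (4 ^ (i * m + j) * y) / 2 ^ Suc i) \<le> (1/2) ^ i" for i y
        using digit_wave_bounds[of "4 ^ (i * m + j) * y"] by (simp add: power_one_over divide_simps)
      show "summable (\<lambda>i. (1/2::real) ^ i)" by (rule summable_geometric) simp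
    qed
  qed (auto simp: digit_wave_def intro!: always_eventually continuous_intros)
  then have 1: "continuous_on UNIV g" unfolding g_def by (intro continuous_intros)
  have "(\<lambda>x. d x n) \<in> borel_measurable borel" for n
    unfolding d_def binary_digit_def c_def by measurable
  then have 2: "s \<in> borel_measurable borel"
    unfolding s_def quaternary_code_def by measurable
  have 3: "0 \<le> s x \<and> s x \<le> 1" for x
    using quaternary_code_bounds[of "d x"] d by (auto simp: s_def intro: order_trans)
  have 4: "g (s x) = x" if x: "\<And>b. b \<in> Basis \<Longrightarrow> \<bar>x \<bullet> b\<bar> < A" for x
  proof -
    have "\<gamma> j (s x) = c x j" if j: "j < m" for j
    proof -
      have "e j \<in> Basis" using e j by (auto dest: bij_betwE)
      then have "\<bar>x \<bullet> e j\<bar> < A" using x by auto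
      then have "0 \<le> c x j" "c x j < 1" using A by (auto simp: c_def field_simps)
      moreover have "digit_wave (4 ^ (i * m + j) * s x) = binary_digit i (c x j)" for i
        unfolding s_def by (subst digit_wave_quaternary_code[OF d]) (use j in \<open>simp add: d_def\<close>)
      ultimately show ?thesis unfolding \<gamma>_def using binary_digit_sums sums_unique by fastforce
    qed
    then have "g (s x) = (\<Sum>j<m. (x \<bullet> e j) *\<^sub>R e j)"
      unfolding g_def using A by (intro sum.cong) (auto simp: c_def)
    also have "\<dots> = (\<Sum>b\<in>Basis. (x \<bullet> b) *\<^sub>R b)"
      by (rule sum.reindex_bij_betw[OF e])
    finally show ?thesis by (simp add: euclidean_representation)
  qed
  show ?thesis using that[OF 1 2 3 4] by blast
qed

text \<open>The space-filling curve transports the problem to the real line, where Helly's selection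
  theorem applies.\<close>

lemma weakly_convergent_subsequence:
  fixes M :: "nat \<Rightarrow> 'a::euclidean_space measure"
  assumes sets_M: "\<And>k. sets (M k) = sets borel"
    and mass: "\<And>k. emeasure (M k) UNIV \<le> ennreal C"
    and supp: "\<And>k. AE x in M k. norm x \<le> R"
  obtains r N where "strict_mono (r :: nat \<Rightarrow> nat)" "sets N = sets borel" "finite_measure N"
    "\<And>f :: 'a \<Rightarrow> real. continuous_on UNIV f \<Longrightarrow> bounded (range f) \<Longrightarrow>
      (\<lambda>k. integral\<^sup>L (M (r k)) f) \<longlonglongrightarrow> integral\<^sup>L N f"
proof -
  \<comment> \<open>The half width \<open>max R 0 + 1\<close> is positive and strictly exceeds every
    coordinate of a point of norm at most \<open>R\<close>.\<close>
  obtain g :: "real \<Rightarrow> 'a" and s where g: "continuous_on UNIV g"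
    and s[measurable]: "s \<in> borel_measurable borel" and s01: "\<And>x. 0 \<le> s x \<and> s x \<le> 1"
    and gs: "\<And>x. (\<And>b. b \<in> Basis \<Longrightarrow> \<bar>x \<bullet> b\<bar> < max R 0 + 1) \<Longrightarrow> g (s x) = x"
    by (rule space_filling_curve[of "max R 0 + 1"]) auto
  have gm[measurable]: "g \<in> borel_measurable borel" using g by (rule borel_measurable_continuous_onI)
  have space_M: "space (M k) = UNIV" for k using sets_eq_imp_space_eq[OF sets_M[of k]] by simp
  have fin: "finite_measure (M k)" for k
    using mass[of k] by (intro finite_measureI) (auto simp: space_M top_unique)
  have sM[measurable]: "s \<in> borel_measurable (M k)" for k
    using s measurable_cong_sets[OF sets_M[of k] refl] by blast
  define m where "m k = measure (M k) UNIV" for k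
  have em: "emeasure (M k) UNIV = ennreal (m k)" for k
    unfolding m_def by (rule finite_measure.emeasure_eq_measure[OF fin])
  have m_nonneg: "0 \<le> m k" for k by (simp add: m_def)
  \<comment> \<open>Tightness and Helly selection concern probability measures, hence the division
    by the mass. For mass 0 the integrals over \<open>P k\<close> are later multiplied by 0; the
    point mass at 0 is chosen because it lies in the interval that gives tightness.\<close>
  define P where "P k = (if m k > 0 then distr (density (M k) (\<lambda>_. ennreal (1 / m k))) borel s
      else return borel 0)" for k
  have dens: "emeasure (density (M k) (\<lambda>_. ennreal (1 / m k))) UNIV = 1" if "m k > 0" for k
    using that by (subst emeasure_density)
      (auto simp: sets_M em nn_integral_cmult_indicator space_M ennreal_mult[symmetric] simp flip: ennreal_1)
  have probP: "prob_space (P k)" for k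
    by (cases "m k > 0") (auto simp: P_def dens space_M emeasure_distr intro!: prob_spaceI prob_space_return)
  have setsP: "sets (P k) = sets borel" for k by (simp add: P_def)
  have rd: "real_distribution (P k)" for k
    using probP setsP by (intro real_distribution.intro real_distribution_axioms.intro)
  \<comment> \<open>All codes lie in \<open>[0, 1]\<close>, so this single interval carries the full
    mass of every \<open>P k\<close>.\<close>
  have supP: "measure (P k) {-1<..1} = 1" for k
  proof (cases "m k > 0")
    case True
    have "s -` {-1<..1} = UNIV" using s01 by (force intro: less_le_trans[of "-1" 0])
    then show ?thesis using True dens[OF True] by (simp add: P_def measure_def emeasure_distr space_M)
  qed (simp add: P_def measure_return indicator_def)
  have "tight P" unfolding tight_def
  proof (intro conjI allI impI)
    fix e :: real assume "e > 0"
    then have "-1 < (1::real) \<and> (\<forall>k. measure (P k) {-1<..1} > 1 - e)" by (simp add: supP)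
    then show "\<exists>a b::real. a < b \<and> (\<forall>k. measure (P k) {a<..b} > 1 - e)" by blast
  qed (rule rd)
  \<comment> \<open>Normalization forgets the masses; they lie in a compact interval and converge
    along a subsequence of their own.\<close>
  moreover obtain r1 l where r1: "strict_mono (r1 :: nat \<Rightarrow> nat)" "(m \<circ> r1) \<longlonglongrightarrow> l"
  proof -
    have "m k \<in> {0..max C 0}" for k
      using mass[of k] m_nonneg[of k] by (auto simp: em ennreal_le_iff2 le_max_iff_disj)
    then show ?thesis using that compact_Icc[of 0 "max C 0"] unfolding compact_def by (metis comp_apply)
  qed
  ultimately obtain r2 N0 where r2: "strict_mono r2" "real_distribution N0" "weak_conv_m (P \<circ> r1 \<circ> r2) N0"
    using tight_imp_convergent_subsubsequence by blast
  interpret N0: real_distribution N0 by (rule r2)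
  have l: "0 \<le> l" using r1(2) m_nonneg by (intro LIMSEQ_le_const) auto
  define r where "r = r1 \<circ> r2"
  \<comment> \<open>The limit law of the codes is carried back by \<open>g\<close> and receives the
    limit \<open>l\<close> of the masses as its total mass.\<close>
  define N where "N = density (distr N0 borel g) (\<lambda>_. ennreal l)"
  have finN: "finite_measure N"
    unfolding N_def by (intro finite_measureI)
      (simp add: emeasure_density nn_integral_cmult ennreal_mult_eq_top_iff N0.emeasure_space_1
        emeasure_distr flip: N0.emeasure_space_1)
  have conv: "(\<lambda>k. integral\<^sup>L (M (r k)) f) \<longlonglongrightarrow> integral\<^sup>L N f"
    if f: "continuous_on UNIV f" "bounded (range f)" for f :: "'a \<Rightarrow> real"
  proof -
    obtain B where B: "\<And>x. \<bar>f x\<bar> \<le> B" using f(2) by (auto simp: bounded_iff)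
    have fm[measurable]: "f \<in> borel_measurable borel" using f(1) by (rule borel_measurable_continuous_onI)
    have eq: "integral\<^sup>L (M k) f = m k * integral\<^sup>L (P k) (\<lambda>y. f (g y))" for k
    proof (cases "m k > 0")
      case True
      have "integral\<^sup>L (M k) f = (LINT x|M k. f (g (s x)))"
      proof (rule integral_cong_AE)
        show "AE x in M k. f x = f (g (s x))" using supp[of k]
        proof eventually_elim
          case (elim x)
          have "\<bar>x \<bullet> b\<bar> < max R 0 + 1" if "b \<in> Basis" for b
            using Basis_le_norm[OF that, of x] elim by simp
          then show ?case using gs by simp
        qed
      qed (auto simp: measurable_cong_sets[OF sets_M refl])
      moreover have "integral\<^sup>L (P k) (\<lambda>y. f (g y)) = (1 / m k) * (LINT x|M k. f (g (s x)))"
        using True by (simp add: P_def integral_distr integral_density measurable_cong_sets[OF sets_M refl])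
      ultimately show ?thesis using True by simp
    next
      case False
      then have "m k = 0" using m_nonneg[of k] by simp
      then have "AE x in M k. f x = 0"
        using em[of k] by (intro AE_I[of _ _ UNIV]) (auto simp: sets_M)
      then show ?thesis using \<open>m k = 0\<close> by (simp add: integral_eq_zero_AE)
    qed
    have "(\<lambda>k. integral\<^sup>L ((P \<circ> r1 \<circ> r2) k) (\<lambda>y. f (g y))) \<longlonglongrightarrow> integral\<^sup>L N0 (\<lambda>y. f (g y))"
    proof (rule weak_conv_imp_integral_bdd_continuous_conv[OF _ r2(2,3)])
      have "continuous_on UNIV (\<lambda>y. f (g y))"
        by (rule continuous_on_compose2[OF f(1) g]) auto
      then show "isCont (\<lambda>y. f (g y)) y" for y by (simp add: continuous_on_eq_continuous_at)
    qed (use rd B in auto)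
    moreover have "(\<lambda>k. m (r k)) \<longlonglongrightarrow> l"
      using LIMSEQ_subseq_LIMSEQ[OF r1(2) r2(1)] by (simp add: r_def o_def)
    ultimately have "(\<lambda>k. m (r k) * integral\<^sup>L (P (r k)) (\<lambda>y. f (g y))) \<longlonglongrightarrow> l * integral\<^sup>L N0 (\<lambda>y. f (g y))"
      by (intro tendsto_mult) (simp_all add: r_def)
    moreover have "integral\<^sup>L N f = l * integral\<^sup>L N0 (\<lambda>y. f (g y))"
      using l by (simp add: N_def integral_density integral_distr)
    ultimately show ?thesis by (simp add: eq)
  qed
  show ?thesis
    by (rule that[of r N]) (use r1 r2 finN conv in \<open>auto simp: r_def N_def strict_mono_o\<close>)
qed

section \<open>Kinetic formulation\<close>

lemma nn_integral_lborel_prod: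
  fixes f :: "'a::euclidean_space \<times> 'b::euclidean_space \<Rightarrow> ennreal"
  assumes "f \<in> borel_measurable borel"
  shows "(\<integral>\<^sup>+z. f z \<partial>lborel) = (\<integral>\<^sup>+x. \<integral>\<^sup>+y. f (x, y) \<partial>lborel \<partial>lborel)"
  using lborel.nn_integral_fst[of f lborel] assms by (simp add: lborel_prod)

text \<open>Triples are nested to the right, whereas Fubini is wanted with the pair
  \<open>(t, x)\<close> as outer variable and \<open>\<xi>\<close> as inner one.\<close>

lemma lborel_prod_assoc:
  "distr lborel borel (\<lambda>z. (fst (fst z), snd (fst z), snd z))
    = (lborel :: ('a::euclidean_space \<times> 'b::euclidean_space \<times> 'c::euclidean_space) measure)"
proof (rule measure_eqI)
  have m: "(\<lambda>z. (fst (fst z), snd (fst z), snd z)) \<in> borel_measurable (borel :: (('a \<times> 'b) \<times> 'c) measure)"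
    by (intro borel_measurable_continuous_onI continuous_intros)
  fix A :: "('a \<times> 'b \<times> 'c) set"
  assume "A \<in> sets (distr (lborel :: (('a \<times> 'b) \<times> 'c) measure) borel (\<lambda>z. (fst (fst z), snd (fst z), snd z)))"
  then have A: "A \<in> sets borel" by simp
  have iA: "(indicator A :: _ \<Rightarrow> ennreal) \<in> borel_measurable borel" using A by simp
  have mA: "(\<lambda>z. indicator A (fst (fst z), snd (fst z), snd z) :: ennreal) \<in> borel_measurable (borel :: (('a \<times> 'b) \<times> 'c) measure)"
    using measurable_compose[OF m iA] by simp
  have "emeasure (distr (lborel :: (('a \<times> 'b) \<times> 'c) measure) borel (\<lambda>z. (fst (fst z), snd (fst z), snd z))) A
    = (\<integral>\<^sup>+z. indicator A z \<partial>distr (lborel :: (('a \<times> 'b) \<times> 'c) measure) borel (\<lambda>z. (fst (fst z), snd (fst z), snd z)))"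
    using A by simp
  also have "\<dots> = (\<integral>\<^sup>+z. indicator A (fst (fst z), snd (fst z), snd z) \<partial>(lborel :: (('a \<times> 'b) \<times> 'c) measure))"
    by (rule nn_integral_distr) (use m iA in simp_all)
  also have "\<dots> = (\<integral>\<^sup>+w. \<integral>\<^sup>+l. indicator A (fst w, snd w, l) \<partial>lborel \<partial>(lborel :: ('a \<times> 'b) measure))"
    by (subst nn_integral_lborel_prod[OF mA]) simp
  also have "\<dots> = (\<integral>\<^sup>+t. \<integral>\<^sup>+x. \<integral>\<^sup>+l. indicator A (t, x, l) \<partial>lborel \<partial>lborel \<partial>lborel)"
  proof (subst nn_integral_lborel_prod)
    have "(\<lambda>w. \<integral>\<^sup>+l. (case (w, l) of (w, l) \<Rightarrow> indicator A (fst w, snd w, l)) \<partial>lborel) \<in> borel_measurable (lborel :: ('a \<times> 'b) measure)"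
      by (rule lborel.borel_measurable_nn_integral) (use mA in \<open>simp add: lborel_prod case_prod_unfold\<close>)
    then show "(\<lambda>w. \<integral>\<^sup>+l. indicator A (fst w, snd w, l) \<partial>lborel) \<in> borel_measurable (borel :: ('a \<times> 'b) measure)"
      by simp
  qed simp
  also have "\<dots> = (\<integral>\<^sup>+t. \<integral>\<^sup>+y. indicator A (t, y) \<partial>lborel \<partial>lborel)"
  proof (intro nn_integral_cong)
    fix t :: 'a
    have "(\<lambda>y. indicator A (t, y) :: ennreal) \<in> borel_measurable borel"
      using measurable_compose[OF _ iA, of "\<lambda>y. (t, y)" borel]
      by (simp add: borel_measurable_continuous_onI continuous_intros)
    then show "(\<integral>\<^sup>+x. \<integral>\<^sup>+l. indicator A (t, x, l) \<partial>lborel \<partial>lborel) = (\<integral>\<^sup>+y. indicator A (t, y) \<partial>lborel)"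
      by (simp add: nn_integral_lborel_prod)
  qed
  also have "\<dots> = (\<integral>\<^sup>+z. indicator A z \<partial>lborel)"
    by (rule nn_integral_lborel_prod[OF iA, symmetric])
  also have "\<dots> = emeasure lborel A" using A by simp
  finally show "emeasure (distr (lborel :: (('a \<times> 'b) \<times> 'c) measure) borel (\<lambda>z. (fst (fst z), snd (fst z), snd z))) A
    = emeasure lborel A" .
qed simp

lemma integral_lborel_triple:
  fixes f :: "'a::euclidean_space \<times> 'b::euclidean_space \<times> 'c::euclidean_space \<Rightarrow> real"
  assumes f: "integrable lborel f"
  shows "(LINT z|lborel. f z) = (LINT w|lborel. LINT l|lborel. f (fst w, snd w, l))"
proof -
  let ?\<alpha> = "\<lambda>z :: ('a \<times> 'b) \<times> 'c. (fst (fst z), snd (fst z), snd z)"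
  have m: "?\<alpha> \<in> measurable lborel borel"
    by (simp add: borel_measurable_continuous_onI continuous_intros)
  have fm: "f \<in> borel_measurable borel" using f by auto
  have "integrable (distr lborel borel ?\<alpha>) f" using f by (simp add: lborel_prod_assoc)
  then have i: "integrable (lborel \<Otimes>\<^sub>M lborel) (\<lambda>z. f (?\<alpha> z))"
    unfolding lborel_prod using integrable_distr_eq[OF m fm] by simp
  have "(LINT z|lborel. f z) = (LINT z|distr lborel borel ?\<alpha>. f z)" by (simp add: lborel_prod_assoc)
  also have "\<dots> = (LINT z|lborel. f (?\<alpha> z))" by (rule integral_distr[OF m fm])
  also have "\<dots> = (LINT w|lborel. LINT l|lborel. f (?\<alpha> (w, l)))"
    using lborel_pair.integral_fst'[OF i] by (simp add: lborel_prod)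
  finally show ?thesis by simp
qed

lemma set_integral_phase_space:
  fixes f :: "real \<times> 'a::euclidean_space \<times> real \<Rightarrow> real"
  assumes "set_integrable lborel (phase_space T \<Omega>) f"
  shows "(LINT z:phase_space T \<Omega>|lborel. f z)
    = (LINT w:{0<..<T} \<times> \<Omega>|lborel. LINT l|lborel. f (fst w, snd w, l))"
proof -
  have ind: "indicator (phase_space T \<Omega>) (fst w, snd w, l) = (indicator ({0<..<T} \<times> \<Omega>) w :: real)" for w l
    by (simp add: phase_space_def indicator_def mem_Times_iff)
  show ?thesis
    unfolding set_lebesgue_integral_def real_scaleR_def
    using integral_lborel_triple[OF assms[unfolded set_integrable_def real_scaleR_def]] by (simp add: ind)
qed

lemma open_phase_space: "open \<Omega> \<Longrightarrow> open (phase_space T \<Omega>)"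
  unfolding phase_space_def by (intro open_Times) auto

text \<open>The substitution \<open>l = w z * s\<close> moves the dependence on the endpoint into
  the integrand, over the fixed interval \<open>[0, 1]\<close>.\<close>

lemma continuous_on_integral_moving_endpoint:
  fixes g :: "'z::topological_space \<times> real \<Rightarrow> real" and w :: "'z \<Rightarrow> real"
  assumes g: "continuous_on UNIV g" and w: "continuous_on U w" "\<And>z. z \<in> U \<Longrightarrow> 0 \<le> w z"
  shows "continuous_on U (\<lambda>z. integral {0..w z} (\<lambda>l. g (z, l)))"
proof -
  have "continuous_on U (\<lambda>z. integral (cbox 0 1) (\<lambda>s. w z * g (z, w z * s)))"
  proof (rule integral_continuous_on_param)
    show "continuous_on (U \<times> cbox 0 1) (\<lambda>(z, s). w z * g (z, w z * s))"
      unfolding case_prod_unfold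
      by (intro continuous_on_mult continuous_on_compose2[OF w(1)] continuous_on_compose2[OF g] continuous_intros) auto
  qed
  then show ?thesis
  proof (rule continuous_on_eq)
    fix z assume z: "z \<in> U"
    have c: "continuous_on {0..w z} (\<lambda>l. g (z, l))"
      by (rule continuous_on_compose2[OF g]) (auto intro!: continuous_intros)
    have "((\<lambda>s. w z *\<^sub>R g (z, w z * s)) has_integral integral {w z * 0..w z * 1} (\<lambda>l. g (z, l))) {0..1}"
    proof (rule has_integral_substitution[where c = 0 and d = "w z"])
      show "(\<lambda>s. w z * s) ` {0..1} \<subseteq> {0..w z}" using w(2)[OF z] by (auto simp: mult_left_le)
    qed (use c w(2)[OF z] in \<open>auto intro!: derivative_eq_intros\<close>)
    from integral_unique[OF this]
    show "integral (cbox 0 1) (\<lambda>s. w z * g (z, w z * s)) = integral {0..w z} (\<lambda>l. g (z, l))"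
      by (simp only: cbox_interval real_scaleR_def mult_zero_right mult_1_right)
  qed
qed

text \<open>This translates between the two forms of the kinetic terms: weak limits are tested in
  the form on the left, while integration by parts produces the form on the right.\<close>

lemma set_integral_subgraph:
  fixes h :: "real \<times> 'a::euclidean_space \<times> real \<Rightarrow> real" and w :: "real \<Rightarrow> 'a \<Rightarrow> real"
  assumes \<Omega>: "open \<Omega>" and h: "continuous_on UNIV h" and K: "compact K" "K \<subseteq> phase_space T \<Omega>"
    and h_out: "\<And>z. z \<notin> K \<Longrightarrow> h z = 0"
    and w: "continuous_on ({0<..<T} \<times> \<Omega>) (\<lambda>z. w (fst z) (snd z))"
  shows "(LINT z:phase_space T \<Omega>|lborel. (case z of (t, x, \<xi>) \<Rightarrow> indicator {0..w t x} \<xi>) * h z)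
    = (LINT z:{0<..<T} \<times> \<Omega>|lborel. integral {0..w (fst z) (snd z)} (\<lambda>l. h (fst z, snd z, l)))"
proof -
  let ?Q = "phase_space T \<Omega>"
  have hQ: "set_integrable lborel ?Q h"
    by (rule set_integrable_continuous_compact_support[OF open_phase_space[OF \<Omega>] K continuous_on_subset[OF h]])
      (use h_out in auto)
  define g where "g z = (case z of (t, x, \<xi>) \<Rightarrow> indicator {0..w t x} \<xi>) * h z" for z
  have "set_integrable lborel ?Q g"
    unfolding set_integrable_def
  proof (rule Bochner_Integration.integrable_bound[OF hQ[unfolded set_integrable_def]])
    define W where "W = {z \<in> ?Q. 0 \<le> snd (snd z) \<and> snd (snd z) \<le> w (fst z) (fst (snd z))}"
    have "W \<in> sets borel"
    proof -
      have c: "continuous_on ?Q (\<lambda>z. w (fst z) (fst (snd z)))"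
        by (rule continuous_on_compose2[OF w, of _ "\<lambda>z. (fst z, fst (snd z))", simplified])
          (auto intro!: continuous_intros simp: phase_space_def)
      have c1: "continuous_on ?Q (\<lambda>z. w (fst z) (fst (snd z)) - snd (snd z))"
        by (intro continuous_on_diff c continuous_intros)
      have c2: "continuous_on ?Q (\<lambda>z. snd (snd z))" by (intro continuous_intros)
      have "closedin (top_of_set ?Q) {z \<in> ?Q. snd (snd z) \<le> w (fst z) (fst (snd z))}"
        "closedin (top_of_set ?Q) {z \<in> ?Q. 0 \<le> snd (snd z)}"
        using continuous_closedin_preimage[OF c1, of "{0..}"] continuous_closedin_preimage[OF c2, of "{0..}"]
        by (simp_all add: vimage_def Int_def)
      then have "closedin (top_of_set ?Q) ({z \<in> ?Q. snd (snd z) \<le> w (fst z) (fst (snd z))} \<inter> {z \<in> ?Q. 0 \<le> snd (snd z)})"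
        by (rule closedin_Int)
      then obtain V where "closed V" "{z \<in> ?Q. snd (snd z) \<le> w (fst z) (fst (snd z))} \<inter> {z \<in> ?Q. 0 \<le> snd (snd z)} = ?Q \<inter> V"
        unfolding closedin_closed by blast
      moreover have "W = {z \<in> ?Q. snd (snd z) \<le> w (fst z) (fst (snd z))} \<inter> {z \<in> ?Q. 0 \<le> snd (snd z)}"
        by (auto simp: W_def)
      ultimately show ?thesis using open_phase_space[OF \<Omega>, of T] by auto
    qed
    moreover have "indicator ?Q z *\<^sub>R g z = indicator W z * h z" for z
      by (cases z) (auto simp: g_def W_def indicator_def)
    moreover have "h \<in> borel_measurable borel" using h by (rule borel_measurable_continuous_onI)
    ultimately show "(\<lambda>z. indicator ?Q z *\<^sub>R g z) \<in> borel_measurable lborel" by simp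
    show "AE z in lborel. norm (indicator ?Q z *\<^sub>R g z) \<le> norm (indicator ?Q z *\<^sub>R h z)"
      by (auto simp: g_def indicator_def split: prod.split)
  qed
  from set_integral_phase_space[OF this]
  have "(LINT z:?Q|lborel. g z) = (LINT w:{0<..<T} \<times> \<Omega>|lborel. LINT l|lborel. g (fst w, snd w, l))" .
  moreover have inner: "(LINT l|lborel. g (fst z, snd z, l)) = integral {0..w (fst z) (snd z)} (\<lambda>l. h (fst z, snd z, l))" for z
  proof -
    have "continuous_on {0..w (fst z) (snd z)} (\<lambda>l. h (fst z, snd z, l))"
      by (rule continuous_on_compose2[OF h]) (auto intro!: continuous_intros)
    then have "set_integrable lborel {0..w (fst z) (snd z)} (\<lambda>l. h (fst z, snd z, l))"
      by (rule borel_integrable_atLeastAtMost')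
    from set_borel_integral_eq_integral(2)[OF this] show ?thesis
      by (simp add: g_def set_lebesgue_integral_def)
  qed
  ultimately have "(LINT z:?Q|lborel. g z) = (LINT z:{0<..<T} \<times> \<Omega>|lborel. integral {0..w (fst z) (snd z)} (\<lambda>l. h (fst z, snd z, l)))"
    by (simp only:)
  then show ?thesis by (simp only: g_def)
qed

section \<open>Partial derivatives of test functions on phase space\<close>

lemma gradient_eq_0_outside_support:
  fixes f :: "'a::euclidean_space \<Rightarrow> real"
  assumes "closed K" "\<And>x. x \<notin> K \<Longrightarrow> f x = 0" "x \<notin> K" "f differentiable (at x)"
  shows "gradient f x = 0"
proof -
  have "((\<lambda>x. 0) has_derivative (\<lambda>h. 0)) (at x)" by simp
  then have "(f has_derivative (\<lambda>h. 0)) (at x)"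
    by (rule has_derivative_transform_within_open[of _ _ _ _ "- K"]) (use assms in auto)
  from has_derivative_unique[OF this has_derivative_gradient[OF assms(4)]]
  have "gradient f x \<bullet> gradient f x = 0" by metis
  then show ?thesis by simp
qed

lemma smooth_on_partial: "smooth_on f U \<Longrightarrow> b \<in> Basis \<Longrightarrow> smooth_on (partial b f) U"
  unfolding smooth_on_def by (metis Ck_on.simps(2))

lemma gradient_inner_Basis: "b \<in> Basis \<Longrightarrow> gradient f x \<bullet> b = partial b f x"
  by (simp add: gradient_def inner_sum_left inner_Basis if_distrib cong: if_cong)

text \<open>The derivatives in the three groups of variables are components of the joint gradient,
  so their joint continuity is immediate. The derivatives of slices, by which distributional
  derivatives are defined, are identified with them afterwards.\<close>

definition dt :: "(real \<times> 'a::euclidean_space \<times> real \<Rightarrow> real) \<Rightarrow> real \<times> 'a \<times> real \<Rightarrow> real" where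
  "dt \<Phi> z = fst (gradient \<Phi> z)"

definition dx :: "(real \<times> 'a::euclidean_space \<times> real \<Rightarrow> real) \<Rightarrow> real \<times> 'a \<times> real \<Rightarrow> 'a" where
  "dx \<Phi> z = fst (snd (gradient \<Phi> z))"

definition d\<xi> :: "(real \<times> 'a::euclidean_space \<times> real \<Rightarrow> real) \<Rightarrow> real \<times> 'a \<times> real \<Rightarrow> real" where
  "d\<xi> \<Phi> z = snd (snd (gradient \<Phi> z))"

definition dxx :: "'a \<Rightarrow> (real \<times> 'a::euclidean_space \<times> real \<Rightarrow> real) \<Rightarrow> real \<times> 'a \<times> real \<Rightarrow> real" where
  "dxx b \<Phi> z = dx (\<lambda>z. dx \<Phi> z \<bullet> b) z \<bullet> b"

context
  fixes \<Phi> :: "real \<times> 'a::euclidean_space \<times> real \<Rightarrow> real"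
  assumes smooth: "smooth_on \<Phi> UNIV"
begin

lemma has_derivative_dt_dx_d\<xi>:
  "(\<Phi> has_derivative (\<lambda>h. dt \<Phi> z * fst h + dx \<Phi> z \<bullet> fst (snd h) + d\<xi> \<Phi> z * snd (snd h))) (at z)"
  using smooth_on_gradient(1)[OF smooth open_UNIV, of z]
  by (simp add: dt_def dx_def d\<xi>_def inner_prod_def add.assoc)

lemma continuous_on_dt_dx_d\<xi>: "continuous_on S (dt \<Phi>)" "continuous_on S (dx \<Phi>)" "continuous_on S (d\<xi> \<Phi>)"
  unfolding dt_def[abs_def] dx_def[abs_def] d\<xi>_def[abs_def]
  by (intro continuous_intros continuous_on_subset[OF smooth_on_gradient(2)[OF smooth open_UNIV]]; simp)+

lemma DERIV_t: "((\<lambda>s. \<Phi> (s, x, \<xi>)) has_real_derivative dt \<Phi> (t, x, \<xi>)) (at t)"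
proof -
  have "((\<lambda>s. (s, x, \<xi>)) has_derivative (\<lambda>h. (h, 0, 0))) (at t)"
    by (auto intro!: derivative_eq_intros simp: zero_prod_def)
  from has_derivative_compose[OF this has_derivative_dt_dx_d\<xi>]
  show ?thesis by (rule has_derivative_imp_has_field_derivative) simp
qed

lemma DERIV_\<xi>: "((\<lambda>s. \<Phi> (t, x, s)) has_real_derivative d\<xi> \<Phi> (t, x, \<xi>)) (at \<xi>)"
proof -
  have "((\<lambda>s. (t, x, s)) has_derivative (\<lambda>h. (0, 0, h))) (at \<xi>)" by (auto intro!: derivative_eq_intros)
  from has_derivative_compose[OF this has_derivative_dt_dx_d\<xi>]
  show ?thesis by (rule has_derivative_imp_has_field_derivative) simp
qed

lemma has_derivative_x: "((\<lambda>y. \<Phi> (t, y, \<xi>)) has_derivative (\<lambda>h. dx \<Phi> (t, x, \<xi>) \<bullet> h)) (at x)"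
proof -
  have "((\<lambda>y. (t, y, \<xi>)) has_derivative (\<lambda>h. (0, h, 0))) (at x)" by (auto intro!: derivative_eq_intros)
  from has_derivative_compose[OF this has_derivative_dt_dx_d\<xi>]
  show ?thesis by simp
qed

lemma partial_x: "partial b (\<lambda>y. \<Phi> (t, y, \<xi>)) x = dx \<Phi> (t, x, \<xi>) \<bullet> b"
proof -
  have "(\<lambda>h. dx \<Phi> (t, x, \<xi>) \<bullet> h) = frechet_derivative (\<lambda>y. \<Phi> (t, y, \<xi>)) (at x)"
    by (rule frechet_derivative_at[OF has_derivative_x])
  then show ?thesis unfolding partial_def by metis
qed

lemma smooth_on_dx_inner:
  assumes "b \<in> Basis"
  shows "smooth_on (\<lambda>z. dx \<Phi> z \<bullet> b) UNIV"
proof -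
  have B: "(0, b, 0) \<in> (Basis :: (real \<times> 'a \<times> real) set)" using assms by (simp add: Basis_prod_def zero_prod_def)
  have "(\<lambda>z. dx \<Phi> z \<bullet> b) = partial (0, b, 0) \<Phi>"
    using gradient_inner_Basis[OF B, of \<Phi>] by (auto simp: fun_eq_iff dx_def inner_prod_def)
  then show ?thesis using smooth_on_partial[OF smooth B] by simp
qed

lemma dt_dx_d\<xi>_eq_0:
  assumes "closed K" "\<And>z. z \<notin> K \<Longrightarrow> \<Phi> z = 0" "z \<notin> K"
  shows "dt \<Phi> z = 0" "dx \<Phi> z = 0" "d\<xi> \<Phi> z = 0"
proof -
  have "\<Phi> differentiable (at z)" using has_derivative_dt_dx_d\<xi> differentiableI by blast
  from gradient_eq_0_outside_support[OF assms this]
  show "dt \<Phi> z = 0" "dx \<Phi> z = 0" "d\<xi> \<Phi> z = 0" by (simp_all add: dt_def dx_def d\<xi>_def)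
qed

end

lemma laplacian_x:
  assumes "smooth_on \<Phi> UNIV"
  shows "laplacian (\<lambda>y. \<Phi> (t, y, \<xi>)) x = (\<Sum>b\<in>Basis. dxx b \<Phi> (t, x, \<xi>))"
proof -
  have "partial b (partial b (\<lambda>y. \<Phi> (t, y, \<xi>))) x = dxx b \<Phi> (t, x, \<xi>)" if "b \<in> Basis" for b
  proof -
    have "partial b (\<lambda>y. \<Phi> (t, y, \<xi>)) = (\<lambda>y. dx \<Phi> (t, y, \<xi>) \<bullet> b)"
      using partial_x[OF assms] by blast
    then show ?thesis
      using partial_x[OF smooth_on_dx_inner[OF assms that]] by (simp add: dxx_def)
  qed
  then show ?thesis by (simp add: laplacian_def)
qed

section \<open>The kinetic equation for a fixed \<epsilon>\<close>

context neumann_reaction_diffusion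
begin

text \<open>The result of testing the entropy dissipation measure of the solution with
  \<open>d\<xi> \<Phi>\<close>, before integration over \<open>(t, x)\<close>: the difference of the
  two values of \<open>\<Phi>\<close> is the integral of \<open>d\<xi> \<Phi>\<close> over the
  segment from \<open>v\<close> to \<open>F u\<close>.\<close>

definition dissipation :: "(real \<times> 'a \<times> real \<Rightarrow> real) \<Rightarrow> real \<times> 'a \<Rightarrow> real" where
  "dissipation \<Phi> z = (case z of (t, x) \<Rightarrow> d\<xi> \<Phi> (t, x, v t x) * (G t x \<bullet> G t x)
    + (\<Phi> (t, x, F (u t x)) - \<Phi> (t, x, v t x)) * (F (u t x) - v t x) / \<epsilon>)"

text \<open>The entropy identity leaves the term
  \<open>dx \<Phi>(t, x, v) \<bullet> \<nabla>v\<close>. This term also appears when the divergence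
  of the integral of \<open>dx \<Phi>\<close> over \<open>l\<close> from 0 to \<open>v\<close> is
  computed, as the contribution of the moving endpoint; the rest of that divergence is the integral
  of the Laplacian of \<open>\<Phi>\<close>. Eliminating it leaves a right side without derivatives
  of \<open>v\<close>, linear in the subgraph indicators.\<close>

lemma weak_identity:
  fixes \<Phi> :: "real \<times> 'a \<times> real \<Rightarrow> real"
  assumes smooth: "smooth_on \<Phi> UNIV" and K: "compact K" "K \<subseteq> phase_space T \<Omega>" and out: "\<And>z. z \<notin> K \<Longrightarrow> \<Phi> z = 0"
    and nonneg: "\<And>t x. 0 < t \<Longrightarrow> x \<in> \<Omega> \<Longrightarrow> 0 \<le> u t x" "\<And>t x. 0 < t \<Longrightarrow> x \<in> \<Omega> \<Longrightarrow> 0 \<le> v t x"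
  shows "(LINT z:{0<..<T} \<times> \<Omega>|lborel. dissipation \<Phi> z)
    = (LINT z:{0<..<T} \<times> \<Omega>|lborel. integral {0..u (fst z) (snd z)} (\<lambda>l. dt \<Phi> (fst z, snd z, F l)))
    + (LINT z:{0<..<T} \<times> \<Omega>|lborel. integral {0..v (fst z) (snd z)} (\<lambda>l. dt \<Phi> (fst z, snd z, l)))
    + (LINT z:{0<..<T} \<times> \<Omega>|lborel. integral {0..v (fst z) (snd z)} (\<lambda>l. \<Sum>b\<in>Basis. dxx b \<Phi> (fst z, snd z, l)))"
proof -
  let ?O = "{0<..<T} \<times> \<Omega>"
  \<comment> \<open>The projection of the support to time and space; integrals over the cylinder and
    over times below \<open>T\<close> agree because it lies in both sets.\<close>
  define K' where "K' = (\<lambda>z. (fst z, fst (snd z))) ` K"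
  have K': "compact K'" unfolding K'_def by (intro compact_continuous_image K continuous_intros)
  have K'O: "K' \<subseteq> ?O" using K(2) by (auto simp: K'_def phase_space_def)
  have K'cyl: "K' \<subseteq> cylinder" using K'O by auto
  have out': "(t, x, \<xi>) \<notin> K" if "(t, x) \<notin> K'" for t x \<xi>
    using that by (force simp: K'_def)
  have clK: "closed K" using K(1) by (rule compact_imp_closed)
  note zero = dt_dx_d\<xi>_eq_0[OF smooth clK out]
  have bsmooth: "smooth_on (\<lambda>z. dx \<Phi> z \<bullet> b) UNIV" if "b \<in> Basis" for b
    by (rule smooth_on_dx_inner[OF smooth that])
  have dxx_zero: "dxx b \<Phi> z = 0" if "b \<in> Basis" "z \<notin> K" for b z
    unfolding dxx_def using dt_dx_d\<xi>_eq_0(2)[OF bsmooth[OF that(1)] clK _ that(2)] zero(2) by simp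
  have dxx_cont: "continuous_on S (dxx b \<Phi>)" if "b \<in> Basis" for b S
    unfolding dxx_def[abs_def] by (intro continuous_intros continuous_on_dt_dx_d\<xi> bsmooth that)
  have \<Phi>_cont: "continuous_on S \<Phi>" for S
    using has_derivative_dt_dx_d\<xi>[OF smooth] has_derivative_continuous
    by (blast intro: continuous_at_imp_continuous_on continuous_on_subset)
  note dcont = continuous_on_dt_dx_d\<xi>[OF smooth]
  have tr: "continuous_on UNIV (\<lambda>p :: (real \<times> 'a) \<times> real. f (fst (fst p), snd (fst p), k (snd p)))"
    if "continuous_on UNIV f" "continuous_on UNIV k" for f :: "real \<times> 'a \<times> real \<Rightarrow> real" and k :: "real \<Rightarrow> real"
    by (rule continuous_on_compose2[OF that(1)]) (auto intro!: continuous_intros continuous_on_compose2[OF that(2)])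
  have endpoint: "continuous_on cylinder (\<lambda>z. integral {0..w (fst z) (snd z)} (\<lambda>l. f (fst z, snd z, k l)))"
    if "continuous_on UNIV f" "continuous_on UNIV k" "continuous_on cylinder (\<lambda>z. w (fst z) (snd z))"
      "\<And>t x. 0 < t \<Longrightarrow> x \<in> \<Omega> \<Longrightarrow> 0 \<le> w t x"
    for f :: "real \<times> 'a \<times> real \<Rightarrow> real" and k :: "real \<Rightarrow> real" and w
    using continuous_on_integral_moving_endpoint[OF tr[OF that(1,2)] that(3)] that(4) by auto
  have near: "\<forall>\<^sub>F s in nhds t. 0 < s" if "0 < t" for t :: real
  proof -
    have "\<forall>\<^sub>F s in nhds t. s \<in> {0<..}" using that by (intro eventually_nhds_in_open) auto
    then show ?thesis by simp
  qed
  define S where "S t x = integral {0..u t x} (\<lambda>l. \<Phi> (t, x, F l)) + integral {0..v t x} (\<lambda>l. \<Phi> (t, x, l))" for t x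
  define S1 where "S1 z = integral {0..u (fst z) (snd z)} (\<lambda>l. dt \<Phi> (fst z, snd z, F l))" for z
  define S2 where "S2 z = integral {0..v (fst z) (snd z)} (\<lambda>l. dt \<Phi> (fst z, snd z, l))" for z
  define S3 where "S3 z = integral {0..v (fst z) (snd z)} (\<lambda>l. \<Sum>b\<in>Basis. dxx b \<Phi> (fst z, snd z, l))" for z
  define X where "X z = (case z of (t, x) \<Rightarrow> dx \<Phi> (t, x, v t x) \<bullet> G t x)" for z
  have idc: "continuous_on UNIV (\<lambda>l::real. l)" by (rule continuous_on_id)
  have S_cont: "continuous_on cylinder (\<lambda>z. S (fst z) (snd z))"
    unfolding S_def by (intro continuous_on_add endpoint \<Phi>_cont F_cont idc continuous_on_cylinder nonneg)
  have S12_cont: "continuous_on cylinder S1" "continuous_on cylinder S2"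
    unfolding S1_def[abs_def] S2_def[abs_def]
    by (intro endpoint dcont F_cont idc continuous_on_cylinder nonneg; assumption)+
  have S3_cont: "continuous_on cylinder S3"
  proof -
    have "continuous_on UNIV (\<lambda>z. \<Sum>b\<in>Basis. dxx b \<Phi> z)" by (intro continuous_intros dxx_cont)
    from endpoint[OF this idc continuous_on_cylinder(2) nonneg(2)] show ?thesis by (simp add: S3_def[abs_def])
  qed
  have comp: "continuous_on cylinder (\<lambda>z. f (fst z, snd z, w z))"
    if "continuous_on UNIV f" "continuous_on cylinder w"
    for f :: "real \<times> 'a \<times> real \<Rightarrow> 'b::topological_space" and w
    by (rule continuous_on_compose2[OF that(1)]) (auto intro!: continuous_intros that)
  have X_cont: "continuous_on cylinder X"
    unfolding X_def[abs_def] case_prod_unfold by (intro continuous_intros comp dcont continuous_on_cylinder)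
  have D_cont: "continuous_on cylinder (dissipation \<Phi>)"
    unfolding dissipation_def[abs_def] case_prod_unfold
    by (intro continuous_intros comp dcont \<Phi>_cont continuous_on_cylinder) (use eps_pos in auto)
  have S_zero: "S1 z = 0" "S2 z = 0" "S3 z = 0" "X z = 0" "dissipation \<Phi> z = 0" if "z \<notin> K'" for z
  proof -
    note z = out'[of "fst z" "snd z", simplified, OF that]
    show "S1 z = 0" "S2 z = 0" "S3 z = 0" using z zero dxx_zero by (simp_all add: S1_def S2_def S3_def)
    show "X z = 0" "dissipation \<Phi> z = 0"
      using z zero out by (simp_all add: X_def dissipation_def case_prod_unfold)
  qed
  have int: "set_integrable lborel cylinder f" if "continuous_on cylinder f" "\<And>z. z \<notin> K' \<Longrightarrow> f z = 0" for f :: "real \<times> 'a \<Rightarrow> real"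
    by (rule set_integrable_continuous_compact_support[OF open_cylinder K' K'cyl that(1)]) (use that(2) in auto)
  have id1: "(LINT z:cylinder|lborel. S1 z + S2 z - X z - dissipation \<Phi> z) = 0"
  proof -
    have "(LINT z:cylinder|lborel. case z of (t, x) \<Rightarrow> (S1 (t, x) + S2 (t, x)) - dx \<Phi> (t, x, v t x) \<bullet> G t x
      - (d\<xi> \<Phi> (t, x, v t x) * (G t x \<bullet> G t x) + (\<Phi> (t, x, F (u t x)) - \<Phi> (t, x, v t x)) * (F (u t x) - v t x) / \<epsilon>)) = 0"
    proof (rule kinetic_identity[OF K' K'cyl has_derivative_dt_dx_d\<xi>[OF smooth] dcont(2) dcont(3), where S = S and St = "\<lambda>t x. S1 (t, x) + S2 (t, x)"])
      show "\<Phi> (t, x, \<xi>) = 0" if "(t, x) \<notin> K'" for t x \<xi> by (rule out[OF out'[OF that]])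
      show "continuous_on cylinder (\<lambda>z. S (fst z) (snd z))" by (rule S_cont)
      show "continuous_on cylinder (\<lambda>z. S1 (fst z, snd z) + S2 (fst z, snd z))"
        using continuous_on_add[OF S12_cont] by simp
      show "S (fst z) (snd z) = 0" if "z \<in> cylinder - K'" for z
        using that out'[of "fst z" "snd z"] out by (simp add: S_def)
    next
      fix t :: real and x :: 'a assume t: "0 < t" "x \<in> \<Omega>"
      have g: "continuous_on UNIV (\<lambda>p. f (fst p, x, k (snd p)))"
        if "continuous_on UNIV f" "continuous_on UNIV k" for f :: "real \<times> 'a \<times> real \<Rightarrow> real" and k :: "real \<Rightarrow> real"
        by (rule continuous_on_compose2[OF that(1)]) (auto intro!: continuous_intros continuous_on_compose2[OF that(2)])
      have 1: "((\<lambda>s. integral {0..u s x} (\<lambda>l. \<Phi> (s, x, F l))) has_real_derivative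
        integral {0..u t x} (\<lambda>l. dt \<Phi> (t, x, F l)) + \<Phi> (t, x, F (u t x)) * ((v t x - F (u t x)) / \<epsilon>)) (at t)"
        using has_real_derivative_integral_moving_endpoint[OF g[OF \<Phi>_cont F_cont] g[OF dcont(1) F_cont] _ u_deriv[OF t]]
          DERIV_t[OF smooth] eventually_mono[OF near[OF t(1)], of "\<lambda>s. 0 \<le> u s x"] nonneg(1) t(2) by simp
      have 2: "((\<lambda>s. integral {0..v s x} (\<lambda>l. \<Phi> (s, x, l))) has_real_derivative
        integral {0..v t x} (\<lambda>l. dt \<Phi> (t, x, l)) + \<Phi> (t, x, v t x) * ((\<Sum>b\<in>Basis. H b t x) + (F (u t x) - v t x) / \<epsilon>)) (at t)"
        using has_real_derivative_integral_moving_endpoint[OF g[OF \<Phi>_cont idc] g[OF dcont(1) idc] _ v_deriv[OF t]]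
          DERIV_t[OF smooth] eventually_mono[OF near[OF t(1)], of "\<lambda>s. 0 \<le> v s x"] nonneg(2) t(2) by simp
      show "((\<lambda>s. S s x) has_real_derivative S1 (t, x) + S2 (t, x) + \<Phi> (t, x, F (u t x)) * ((v t x - F (u t x)) / \<epsilon>)
        + \<Phi> (t, x, v t x) * ((\<Sum>b\<in>Basis. H b t x) + (F (u t x) - v t x) / \<epsilon>)) (at t)"
        unfolding S_def by (rule DERIV_cong[OF DERIV_add[OF 1 2]]) (simp add: S1_def S2_def)
    qed
    moreover have "(case z of (t, x) \<Rightarrow> (S1 (t, x) + S2 (t, x)) - dx \<Phi> (t, x, v t x) \<bullet> G t x
      - (d\<xi> \<Phi> (t, x, v t x) * (G t x \<bullet> G t x) + (\<Phi> (t, x, F (u t x)) - \<Phi> (t, x, v t x)) * (F (u t x) - v t x) / \<epsilon>))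
      = S1 z + S2 z - X z - dissipation \<Phi> z" for z
      by (cases z) (simp add: X_def dissipation_def)
    ultimately show ?thesis by simp
  qed
  \<comment> \<open>\<open>S3 + X\<close> is the divergence described above, a sum of derivatives
    along basis directions, each with integral 0.\<close>
  have id2: "(LINT z:cylinder|lborel. S3 z + X z) = 0"
  proof -
    define g where "g b z = integral {0..v (fst z) (snd z)} (\<lambda>l. dxx b \<Phi> (fst z, snd z, l))
      + (dx \<Phi> (fst z, snd z, v (fst z) (snd z)) \<bullet> b) * (G (fst z) (snd z) \<bullet> b)" for b z
    have g: "set_integrable lborel cylinder (g b) \<and> (LINT z:cylinder|lborel. g b z) = 0" if b: "b \<in> Basis" for b
    proof (rule integral_directional_derivative_eq_0[OF open_cylinder K' K'cyl, where b = "(0, b)"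
        and f = "\<lambda>z. integral {0..v (fst z) (snd z)} (\<lambda>l. dx \<Phi> (fst z, snd z, l) \<bullet> b)"])
      have bc: "continuous_on UNIV (\<lambda>z. dx \<Phi> z \<bullet> b)" by (intro continuous_intros dcont)
      show "continuous_on cylinder (\<lambda>z. integral {0..v (fst z) (snd z)} (\<lambda>l. dx \<Phi> (fst z, snd z, l) \<bullet> b))"
        by (rule endpoint[OF bc idc continuous_on_cylinder(2) nonneg(2)])
      show "continuous_on cylinder (g b)" unfolding g_def[abs_def]
        by (intro continuous_on_add endpoint[OF dxx_cont[OF b] idc continuous_on_cylinder(2) nonneg(2)]
            continuous_intros comp dcont continuous_on_cylinder)
      show "integral {0..v (fst z) (snd z)} (\<lambda>l. dx \<Phi> (fst z, snd z, l) \<bullet> b) = 0" if "z \<in> cylinder - K'" for z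
        using that out'[of "fst z" "snd z"] zero(2) by simp
      fix z assume z: "z \<in> cylinder"
      obtain t x where tx: "z = (t, x)" by (cases z)
      have t: "0 < t" "x \<in> \<Omega>" using z tx by auto
      have gc: "continuous_on UNIV (\<lambda>p. f (t, x + fst p *\<^sub>R b, snd p))"
        if "continuous_on UNIV f" for f :: "real \<times> 'a \<times> real \<Rightarrow> real"
        by (rule continuous_on_compose2[OF that(1)]) (auto intro!: continuous_intros)
      have d: "((\<lambda>s. dx \<Phi> (t, x + s *\<^sub>R b, l) \<bullet> b) has_real_derivative dxx b \<Phi> (t, x + s *\<^sub>R b, l)) (at s)" for s l
      proof -
        have "((\<lambda>s. x + s *\<^sub>R b) has_derivative (\<lambda>s. s *\<^sub>R b)) (at s)" by (auto intro!: derivative_eq_intros)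
        from has_derivative_compose[OF this has_derivative_x[OF bsmooth[OF b]]]
        show ?thesis by (rule has_derivative_imp_has_field_derivative) (simp add: dxx_def)
      qed
      have "\<forall>\<^sub>F s in nhds 0. x + s *\<^sub>R b \<in> \<Omega>"
      proof -
        have "((\<lambda>s. x + s *\<^sub>R b) \<longlongrightarrow> x + 0 *\<^sub>R b) (nhds 0)" by (intro tendsto_intros filterlim_ident)
        then show ?thesis using open_dom t(2) by (simp add: tendsto_def)
      qed
      then have nn: "\<forall>\<^sub>F s in nhds 0. 0 \<le> v t (x + s *\<^sub>R b)"
        by (rule eventually_mono) (rule nonneg(2)[OF t(1)])
      from has_real_derivative_integral_moving_endpoint[OF gc[OF bc] gc[OF dxx_cont[OF b]] _ v_deriv_line[OF t] nn]
      have "((\<lambda>s. integral {0..v t (x + s *\<^sub>R b)} (\<lambda>l. dx \<Phi> (t, x + s *\<^sub>R b, l) \<bullet> b)) has_real_derivative g b z) (at 0)"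
        using d by (simp add: g_def tx)
      then show "((\<lambda>s. integral {0..v (fst (z + s *\<^sub>R (0, b))) (snd (z + s *\<^sub>R (0, b)))}
        (\<lambda>l. dx \<Phi> (fst (z + s *\<^sub>R (0, b)), snd (z + s *\<^sub>R (0, b)), l) \<bullet> b)) has_real_derivative g b z) (at 0)"
        by (simp add: tx)
    qed
    have sum: "(\<Sum>b\<in>Basis. g b z) = S3 z + X z" for z
    proof -
      have "continuous_on {0..v (fst z) (snd z)} (\<lambda>l. dxx b \<Phi> (fst z, snd z, l))" if "b \<in> Basis" for b
        by (rule continuous_on_compose2[OF dxx_cont[OF that, of UNIV]]) (auto intro!: continuous_intros)
      then have "S3 z = (\<Sum>b\<in>Basis. integral {0..v (fst z) (snd z)} (\<lambda>l. dxx b \<Phi> (fst z, snd z, l)))"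
        unfolding S3_def by (intro integral_sum integrable_continuous_real) auto
      moreover have "X z = (\<Sum>b\<in>Basis. (dx \<Phi> (fst z, snd z, v (fst z) (snd z)) \<bullet> b) * (G (fst z) (snd z) \<bullet> b))"
        unfolding X_def case_prod_unfold by (rule euclidean_inner)
      ultimately show ?thesis by (simp add: g_def sum.distrib)
    qed
    have "(LINT z:cylinder|lborel. (\<Sum>b\<in>Basis. g b z)) = (\<Sum>b\<in>Basis. LINT z:cylinder|lborel. g b z)"
      unfolding set_lebesgue_integral_def scaleR_sum_right
      by (rule Bochner_Integration.integral_sum) (use g in \<open>simp add: set_integrable_def\<close>)
    then show ?thesis using g by (simp add: sum)
  qed
  note ints = int[OF S12_cont(1) S_zero(1)] int[OF S12_cont(2) S_zero(2)] int[OF S3_cont S_zero(3)]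
    int[OF X_cont S_zero(4)] int[OF D_cont S_zero(5)]
  have "(LINT z:cylinder|lborel. S1 z + S2 z - X z - dissipation \<Phi> z)
    = (LINT z:cylinder|lborel. S1 z) + (LINT z:cylinder|lborel. S2 z) - (LINT z:cylinder|lborel. X z)
      - (LINT z:cylinder|lborel. dissipation \<Phi> z)"
    using ints by simp
  moreover have "(LINT z:cylinder|lborel. S3 z + X z) = (LINT z:cylinder|lborel. S3 z) + (LINT z:cylinder|lborel. X z)"
    using ints by simp
  ultimately have "(LINT z:cylinder|lborel. dissipation \<Phi> z)
    = (LINT z:cylinder|lborel. S1 z) + (LINT z:cylinder|lborel. S2 z) + (LINT z:cylinder|lborel. S3 z)"
    using id1 id2 by simp
  moreover have "(LINT z:cylinder|lborel. f z) = (LINT z:?O|lborel. f z)" if "\<And>z. z \<notin> K' \<Longrightarrow> f z = 0" for f :: "real \<times> 'a \<Rightarrow> real"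
  proof -
    have "indicator cylinder z *\<^sub>R f z = indicator ?O z *\<^sub>R f z" for z
      using that[of z] K'O K'cyl by (cases "z \<in> K'") (auto simp: indicator_def)
    then show ?thesis unfolding set_lebesgue_integral_def by presburger
  qed
  ultimately have "(LINT z:?O|lborel. dissipation \<Phi> z)
    = (LINT z:?O|lborel. S1 z) + (LINT z:?O|lborel. S2 z) + (LINT z:?O|lborel. S3 z)"
    using S_zero by simp
  then show ?thesis by (simp only: S1_def S2_def S3_def)
qed

text \<open>The measure \<open>|\<nabla>v|\<^sup>2 \<delta>(\<xi> = v) + (F(u) - v)/\<epsilon> (1(v \<le> \<xi> \<le> F(u)) - 1(F(u) \<le> \<xi> \<le> v))\<close> is written as the image
  of a single weighted Lebesgue measure: an additional variable \<open>s\<close> in \<open>(-1, 1)\<close> selects the first part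
  if it is negative and parametrizes the segment from \<open>v\<close> to \<open>F(u)\<close> otherwise.\<close>

lemma dissipation_measure:
  assumes bound: "(\<integral>\<^sup>+z\<in>{0<..<T} \<times> \<Omega>. ennreal (case z of (t, x) \<Rightarrow> G t x \<bullet> G t x + (F (u t x) - v t x)\<^sup>2 / \<epsilon>) \<partial>lborel)
      \<le> ennreal C"
    and range: "\<And>t x. 0 < t \<Longrightarrow> x \<in> \<Omega> \<Longrightarrow> v t x \<in> {0..N}" "\<And>t x. 0 < t \<Longrightarrow> x \<in> \<Omega> \<Longrightarrow> F (u t x) \<in> {0..N}"
    and R: "\<And>x. x \<in> \<Omega> \<Longrightarrow> norm x \<le> R" and T: "0 < T"
  shows "\<exists>M. sets M = sets borel \<and> emeasure M UNIV \<le> ennreal C \<and> (AE z in M. norm z \<le> T + (R + N))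
    \<and> (\<forall>\<Phi>. smooth_on \<Phi> UNIV \<longrightarrow> bounded (range (d\<xi> \<Phi>)) \<longrightarrow>
        (LINT z|M. d\<xi> \<Phi> z) = (LINT z:{0<..<T} \<times> \<Omega>|lborel. dissipation \<Phi> z))"
proof -
  let ?O = "{0<..<T} \<times> \<Omega>"
  have Ocyl: "?O \<subseteq> cylinder" by auto
  have oO: "open ?O" using open_dom by (intro open_Times) auto
  define W where "W = ?O \<times> {-1<..<1::real}"
  have oW: "open W" unfolding W_def by (intro open_Times oO) auto
  define a where "a z = G (fst z) (snd z) \<bullet> G (fst z) (snd z)" for z
  define e where "e z = F (u (fst z) (snd z)) - v (fst z) (snd z)" for z
  \<comment> \<open>With \<open>\<xi> = v + s * (F u - v)\<close> the density
    \<open>(F u - v) / \<epsilon>\<close> in \<open>\<xi>\<close>, with its sign, becomes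
    \<open>(F u - v)\<^sup>2 / \<epsilon>\<close> in \<open>s\<close>, which is nonnegative
    whichever endpoint is larger. Negative \<open>s\<close> fill an interval of length 1, so the
    weight \<open>|\<nabla>v|\<^sup>2\<close> there gives a point mass of just that size at
    \<open>v\<close>.\<close>
  define w where "w p = indicator W p * (if snd p < 0 then a (fst p) else (e (fst p))\<^sup>2 / \<epsilon>)" for p
  define \<Gamma> where "\<Gamma> p = indicator W p *\<^sub>R (fst (fst p), snd (fst p), v (fst (fst p)) (snd (fst p)) + max 0 (snd p) * e (fst p))" for p
  note cyl = continuous_on_subset[OF continuous_on_cylinder(1) Ocyl] continuous_on_subset[OF continuous_on_cylinder(2) Ocyl]
    continuous_on_subset[OF continuous_on_cylinder(3) Ocyl] continuous_on_subset[OF continuous_on_cylinder(4) Ocyl]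
  have ac: "continuous_on ?O a" "continuous_on ?O e" "continuous_on ?O (\<lambda>z. v (fst z) (snd z))"
    unfolding a_def[abs_def] e_def[abs_def] by (intro continuous_intros cyl)+
  have acW: "continuous_on W (\<lambda>p. a (fst p))" "continuous_on W (\<lambda>p. e (fst p))" "continuous_on W (\<lambda>p. v (fst (fst p)) (snd (fst p)))"
    by (rule continuous_on_compose2[OF ac(1)] continuous_on_compose2[OF ac(2)] continuous_on_compose2[OF ac(3)];
        auto intro!: continuous_intros simp: W_def)+
  have w_nonneg: "0 \<le> w p" for p using eps_pos by (simp add: w_def a_def)
  have [measurable]: "w \<in> borel_measurable borel"
  proof -
    have "(\<lambda>p. indicator W p *\<^sub>R a (fst p)) \<in> borel_measurable borel" "(\<lambda>p. indicator W p *\<^sub>R ((e (fst p))\<^sup>2 / \<epsilon>)) \<in> borel_measurable borel"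
      using oW eps_pos by (intro borel_measurable_continuous_on_indicator continuous_intros acW; simp)+
    then have "(\<lambda>p. if snd p < 0 then indicator W p *\<^sub>R a (fst p) else indicator W p *\<^sub>R ((e (fst p))\<^sup>2 / \<epsilon>)) \<in> borel_measurable borel"
      by measurable
    moreover have "w = (\<lambda>p. if snd p < 0 then indicator W p *\<^sub>R a (fst p) else indicator W p *\<^sub>R ((e (fst p))\<^sup>2 / \<epsilon>))"
      by (auto simp: w_def fun_eq_iff)
    ultimately show ?thesis by simp
  qed
  have [measurable]: "\<Gamma> \<in> borel_measurable borel"
    unfolding \<Gamma>_def[abs_def] using oW
    by (intro borel_measurable_continuous_on_indicator continuous_intros acW) auto
  define M where "M = distr (density lborel (\<lambda>p. ennreal (w p))) borel \<Gamma>"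
  have sets: "sets M = sets borel" by (simp add: M_def)
  have w_slice: "w (z, s) = indicator ?O z * (if -1 < s \<and> s < 0 then a z else if 0 \<le> s \<and> s < 1 then (e z)\<^sup>2 / \<epsilon> else 0)" for z s
    by (auto simp: w_def W_def indicator_def)
  have inner_nn: "(\<integral>\<^sup>+s. ennreal (w (z, s)) \<partial>lborel)
    = ennreal (case z of (t, x) \<Rightarrow> G t x \<bullet> G t x + (F (u t x) - v t x)\<^sup>2 / \<epsilon>) * indicator ?O z" for z
  proof (cases "z \<in> ?O")
    case True
    have "ennreal (w (z, s)) = ennreal (a z) * indicator {-1<..<0} s + ennreal ((e z)\<^sup>2 / \<epsilon>) * indicator {0..<1} s" for s
      using True by (auto simp: w_slice)
    then have "(\<integral>\<^sup>+s. ennreal (w (z, s)) \<partial>lborel) = ennreal (a z) + ennreal ((e z)\<^sup>2 / \<epsilon>)"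
      by (simp add: nn_integral_add nn_integral_cmult_indicator)
    also have "\<dots> = ennreal (a z + (e z)\<^sup>2 / \<epsilon>)" using eps_pos by (subst ennreal_plus) (auto simp: a_def)
    finally show ?thesis using True by (simp add: a_def e_def case_prod_unfold)
  qed (simp add: w_slice)
  have total: "(\<integral>\<^sup>+p. ennreal (w p) \<partial>lborel) \<le> ennreal C"
    using bound by (subst nn_integral_lborel_prod) (simp_all add: inner_nn)
  have mass: "emeasure M UNIV \<le> ennreal C"
    unfolding M_def using total by (simp add: emeasure_distr emeasure_density)
  have supp: "AE z in M. norm z \<le> T + (R + N)"
  proof -
    have "norm (\<Gamma> p) \<le> T + (R + N)" if "w p \<noteq> 0" for p
    proof -
      have "p \<in> W" using that by (auto simp: w_def indicator_def split: if_splits)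
      then obtain t x s where p: "p = ((t, x), s)" and t: "0 < t" "t < T" "x \<in> \<Omega>" "-1 < s" "s < 1"
        by (auto simp: W_def)
      define m where "m = max 0 s"
      have m: "0 \<le> m" "m \<le> 1" using t by (auto simp: m_def)
      \<comment> \<open>The last component of \<open>\<Gamma>\<close> is a convex combination of
        \<open>v\<close> and \<open>F u\<close>, both of which lie in \<open>[0, N]\<close>.\<close>
      have "v t x + m * e (t, x) = (1 - m) * v t x + m * F (u t x)" by (simp add: e_def algebra_simps)
      moreover have "0 \<le> (1 - m) * v t x" "(1 - m) * v t x \<le> (1 - m) * N" "0 \<le> m * F (u t x)" "m * F (u t x) \<le> m * N"
        using range[of t x] t m by (auto intro!: mult_left_mono)
      ultimately have "\<bar>v t x + m * e (t, x)\<bar> \<le> N" by (simp add: algebra_simps abs_le_iff)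
      moreover have "norm (t, x, v t x + m * e (t, x)) \<le> norm t + (norm x + norm (v t x + m * e (t, x)))"
        using norm_Pair_le[of t "(x, v t x + m * e (t, x))"] norm_Pair_le[of x "v t x + m * e (t, x)"] by linarith
      ultimately have "norm (t, x, v t x + m * e (t, x)) \<le> T + (R + N)" using t R[of x] by simp
      then show ?thesis using \<open>p \<in> W\<close> by (simp add: \<Gamma>_def p m_def)
    qed
    moreover have "Measurable.pred borel (\<lambda>z::real \<times> 'a \<times> real. norm z \<le> T + (R + N))" by measurable
    ultimately show ?thesis unfolding M_def
      by (subst AE_distr_iff) (auto simp: AE_density simp flip: space_borel)
  qed
  have act: "(LINT z|M. d\<xi> \<Phi> z) = (LINT z:?O|lborel. dissipation \<Phi> z)"
    if smooth: "smooth_on \<Phi> UNIV" and bd: "bounded (range (d\<xi> \<Phi>))" for \<Phi>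
  proof -
    have [measurable]: "d\<xi> \<Phi> \<in> borel_measurable borel"
      using continuous_on_dt_dx_d\<xi>(3)[OF smooth] by (rule borel_measurable_continuous_onI)
    obtain B where B: "\<And>z. \<bar>d\<xi> \<Phi> z\<bar> \<le> B" using bd by (auto simp: bounded_iff)
    have w_int: "integrable lborel w"
      using total w_nonneg by (intro integrableI_nonneg) (auto simp: le_less_trans[OF _ ennreal_less_top])
    have int: "integrable lborel (\<lambda>p. w p * d\<xi> \<Phi> (\<Gamma> p))"
    proof (rule Bochner_Integration.integrable_bound)
      show "integrable lborel (\<lambda>p. B * w p)" using w_int by simp
      show "AE p in lborel. norm (w p * d\<xi> \<Phi> (\<Gamma> p)) \<le> norm (B * w p)"
      proof (rule AE_I2)
        fix p
        have "\<bar>d\<xi> \<Phi> (\<Gamma> p)\<bar> * \<bar>w p\<bar> \<le> \<bar>B\<bar> * \<bar>w p\<bar>"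
          using B[of "\<Gamma> p"] by (intro mult_right_mono) auto
        then show "norm (w p * d\<xi> \<Phi> (\<Gamma> p)) \<le> norm (B * w p)" by (simp add: abs_mult mult.commute)
      qed
    qed measurable
    have "(LINT z|M. d\<xi> \<Phi> z) = (LINT p|lborel. w p * d\<xi> \<Phi> (\<Gamma> p))"
      unfolding M_def using w_nonneg by (simp add: integral_distr integral_density)
    also have "\<dots> = (LINT z|lborel. LINT s|lborel. w (z, s) * d\<xi> \<Phi> (\<Gamma> (z, s)))"
      using lborel_pair.integral_fst'[of "\<lambda>p. w p * d\<xi> \<Phi> (\<Gamma> p)"] int by (simp add: lborel_prod)
    also have "\<dots> = (LINT z:?O|lborel. dissipation \<Phi> z)"
      unfolding set_lebesgue_integral_def
    proof (rule Bochner_Integration.integral_cong[OF refl])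
      fix z :: "real \<times> 'a"
      obtain t x where z: "z = (t, x)" by (cases z)
      show "(LINT s|lborel. w (z, s) * d\<xi> \<Phi> (\<Gamma> (z, s))) = indicator ?O z *\<^sub>R dissipation \<Phi> z"
      proof (cases "z \<in> ?O")
        case True
        define k where "k s = (e z)\<^sup>2 / \<epsilon> * d\<xi> \<Phi> (t, x, v t x + s * e z)" for s
        have slice: "w (z, s) * d\<xi> \<Phi> (\<Gamma> (z, s))
          = indicator {-1<..<0} s *\<^sub>R (a z * d\<xi> \<Phi> (t, x, v t x)) + indicator {0..<1} s *\<^sub>R k s" for s
          using True by (auto simp: w_slice \<Gamma>_def W_def k_def z indicator_def)
        have kc: "continuous_on {0..1} k"
          unfolding k_def[abs_def]
          by (intro continuous_on_mult continuous_on_const continuous_on_compose2[OF continuous_on_dt_dx_d\<xi>(3)[OF smooth, of UNIV]])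
            (auto intro!: continuous_intros)
        then have ki: "set_integrable lborel {0..1} k" by (rule borel_integrable_atLeastAtMost')
        have ki': "set_integrable lborel {0..<1} k" by (rule set_integrable_subset[OF ki]) auto
        \<comment> \<open>\<open>k\<close> is the derivative of \<open>e / \<epsilon>\<close> times
          \<open>\<Phi>\<close> along the segment: one factor \<open>e\<close> of the weight is used
          up by the chain rule.\<close>
        have "(k has_integral (e z / \<epsilon> * \<Phi> (t, x, v t x + 1 * e z) - e z / \<epsilon> * \<Phi> (t, x, v t x + 0 * e z))) {0..1}"
        proof (rule fundamental_theorem_of_calculus)
          fix s :: real
          have "((\<lambda>s. v t x + s * e z) has_real_derivative e z) (at s)" by (auto intro!: derivative_eq_intros)
          from DERIV_cmult[OF DERIV_chain2[OF DERIV_\<xi>[OF smooth] this], of "e z / \<epsilon>" t x]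
          have "((\<lambda>s. e z / \<epsilon> * \<Phi> (t, x, v t x + s * e z)) has_real_derivative k s) (at s)"
            by (rule DERIV_cong) (simp add: k_def power2_eq_square)
          then show "((\<lambda>s. e z / \<epsilon> * \<Phi> (t, x, v t x + s * e z)) has_vector_derivative k s) (at s within {0..1})"
            by (simp add: has_real_derivative_iff_has_vector_derivative has_vector_derivative_at_within)
        qed simp
        then have "integral {0..1} k = (\<Phi> (t, x, F (u t x)) - \<Phi> (t, x, v t x)) * (F (u t x) - v t x) / \<epsilon>"
          by (simp add: integral_unique e_def z algebra_simps diff_divide_distrib add_divide_distrib)
        moreover have "(LINT s:{0..<1}|lborel. k s) = (LINT s:{0..1}|lborel. k s)"
          unfolding set_lebesgue_integral_def
        proof (rule integral_cong_AE)
          show "(\<lambda>s. indicator {0..<1} s *\<^sub>R k s) \<in> borel_measurable lborel"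
            "(\<lambda>s. indicator {0..1} s *\<^sub>R k s) \<in> borel_measurable lborel"
            using ki ki' unfolding set_integrable_def by (auto dest: borel_measurable_integrable)
          show "AE s in lborel. indicator {0..<1} s *\<^sub>R k s = indicator {0..1} s *\<^sub>R k s"
            using AE_lborel_singleton[of "1::real"] by eventually_elim (auto simp: indicator_def)
        qed
        ultimately have k1: "(LINT s:{0..<1}|lborel. k s) = (\<Phi> (t, x, F (u t x)) - \<Phi> (t, x, v t x)) * (F (u t x) - v t x) / \<epsilon>"
          using set_borel_integral_eq_integral(2)[OF ki] by simp
        have i1: "integrable lborel (\<lambda>s. indicator {-1<..<0::real} s *\<^sub>R (a z * d\<xi> \<Phi> (t, x, v t x)))"
          by (rule integrable_scaleR_left) (simp add: integrable_real_indicator)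
        have "(LINT s|lborel. w (z, s) * d\<xi> \<Phi> (\<Gamma> (z, s)))
          = (LINT s|lborel. indicator {-1<..<0::real} s *\<^sub>R (a z * d\<xi> \<Phi> (t, x, v t x))) + (LINT s:{0..<1}|lborel. k s)"
          using Bochner_Integration.integral_add[OF i1 ki'[unfolded set_integrable_def]]
          by (simp only: slice set_lebesgue_integral_def)
        also have "(LINT s|lborel. indicator {-1<..<0::real} s *\<^sub>R (a z * d\<xi> \<Phi> (t, x, v t x))) = a z * d\<xi> \<Phi> (t, x, v t x)"
          by simp
        finally show ?thesis using True k1 by (simp add: dissipation_def a_def z mult.commute)
      qed (simp add: w_slice)
    qed
    finally show ?thesis .
  qed
  show ?thesis using sets mass supp act by blast
qed

end

section \<open>Uniform bounds and passage to the limit\<close>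

theorem theorem2p4:
  fixes \<Omega> :: "'a::euclidean_space set"
    and F :: "real \<Rightarrow> real" and \<alpha>_minus \<alpha>_plus \<beta>_minus \<beta>_plus :: real
    and u0 v0 :: "'a \<Rightarrow> real"
    and u v :: "real \<Rightarrow> real \<Rightarrow> 'a \<Rightarrow> real"
    and T :: real and \<epsilon> :: "nat \<Rightarrow> real"
    and p q :: "real \<times> 'a \<times> real \<Rightarrow> real"
  assumes "smooth_bounded_domain \<Omega>"
    and "reaction_function F \<alpha>_minus \<alpha>_plus \<beta>_minus \<beta>_plus"
    and "initial_data \<Omega> u0 v0"
    and "\<And>e. e \<in> {0<..<1} \<Longrightarrow> classical_solution \<Omega> F u0 v0 e (u e) (v e)"
    and "T > 0"
    and "\<And>k. \<epsilon> k \<in> {0<..<1}" and "\<epsilon> \<longlonglongrightarrow> 0"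
    and "Linf_weak_star_limit (phase_space T \<Omega>)
           (\<lambda>k (t, x, \<xi>). indicator {0..u (\<epsilon> k) t x} \<xi>) p"
    and "Linf_weak_star_limit (phase_space T \<Omega>)
           (\<lambda>k (t, x, \<xi>). indicator {0..v (\<epsilon> k) t x} \<xi>) q"
  shows "\<exists>n :: (real \<times> 'a \<times> real) measure.
    sets n = sets (restrict_space borel (phase_space T \<Omega>)) \<and> finite_measure n \<and>
    (\<forall>\<Phi>\<in>test_functions (phase_space T \<Omega>).
       distr_dt (\<lambda>\<Psi>. kinetic_pushforward T \<Omega> F p \<Psi> + distr_of_fun T \<Omega> q \<Psi>) \<Phi>
         - distr_laplacian_x (distr_of_fun T \<Omega> q) \<Phi>
       = distr_dxi (distr_of_measure n) \<Phi>)"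
proof -
  note dom = assms(1) and rf = assms(2) and T = assms(5) and \<epsilon> = assms(6)
  let ?Q = "phase_space T \<Omega>" and ?O = "{0<..<T} \<times> \<Omega>"
  have op: "open \<Omega>" and bd: "bounded \<Omega>" using dom by (auto simp: smooth_bounded_domain_def)
  have oQ: "open ?Q" by (rule open_phase_space[OF op])
  have F_diff: "F differentiable (at y)" for y using rf by (simp add: reaction_function_def)
  have F_cont: "continuous_on UNIV F"
    using F_diff differentiable_imp_continuous_within by (blast intro: continuous_at_imp_continuous_on)
  have F0: "F 0 = 0" and F_pos: "\<And>y. 0 \<le> y \<Longrightarrow> 0 \<le> F y" and F_top: "filterlim F at_top at_top"
    and F_bot: "filterlim F at_bot at_bot"
    using rf by (auto simp: reaction_function_def)
  have F_neg: "F y < 0" if "y < 0" for y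
  proof -
    have "0 < \<alpha>_plus" "strict_mono_on {..<\<alpha>_plus} F" using rf by (auto simp: reaction_function_def)
    then have "F y < F 0" using that by (intro strict_mono_onD[of "{..<\<alpha>_plus}" F]) auto
    then show ?thesis by (simp add: F0)
  qed
  have sol: "classical_solution \<Omega> F u0 v0 (\<epsilon> k) (u (\<epsilon> k)) (v (\<epsilon> k))" for k
    by (rule assms(4)[OF \<epsilon>])
  have "\<forall>k. \<exists>G H. neumann_reaction_diffusion \<Omega> F (\<epsilon> k) (u (\<epsilon> k)) (v (\<epsilon> k)) G H"
    using classical_solution_neumann_reaction_diffusion[OF dom F_cont _ sol] \<epsilon> by simp
  then obtain G H where nrd: "\<And>k. neumann_reaction_diffusion \<Omega> F (\<epsilon> k) (u (\<epsilon> k)) (v (\<epsilon> k)) (G k) (H k)"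
    by metis
  have init: "u (\<epsilon> k) 0 x = u0 x" "v (\<epsilon> k) 0 x = v0 x" if "x \<in> closure \<Omega>" for k x
    using sol[of k] that by (auto simp: classical_solution_def)
  have init_nonneg: "0 \<le> u0 x" "0 \<le> v0 x" if "x \<in> closure \<Omega>" for x
    using assms(3) that by (auto simp: initial_data_def)
  have cl: "compact (closure \<Omega>)" using bd by simp
  \<comment> \<open>Continuity of the initial data up to the boundary is read off from the solution
    for index 0, which is continuous down to \<open>t = 0\<close>.\<close>
  obtain B where B: "\<And>x. x \<in> closure \<Omega> \<Longrightarrow> u0 x \<le> B" "\<And>x. x \<in> closure \<Omega> \<Longrightarrow> v0 x \<le> B"
  proof -
    interpret neumann_reaction_diffusion \<Omega> F "\<epsilon> 0" "u (\<epsilon> 0)" "v (\<epsilon> 0)" "G 0" "H 0" by (rule nrd)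
    have pc: "continuous_on (closure \<Omega>) (\<lambda>x. (0 :: real, x))" by (intro continuous_intros)
    have "continuous_on (closure \<Omega>) (\<lambda>x. u (\<epsilon> 0) 0 x)"
      using continuous_on_compose2[OF u_cont pc] by (simp add: image_subset_iff)
    then have c1: "continuous_on (closure \<Omega>) u0" using init by (auto cong: continuous_on_cong)
    have "continuous_on (closure \<Omega>) (\<lambda>x. v (\<epsilon> 0) 0 x)"
      using continuous_on_compose2[OF v_cont pc] by (simp add: image_subset_iff)
    then have c2: "continuous_on (closure \<Omega>) v0" using init by (auto cong: continuous_on_cong)
    have "bounded (u0 ` closure \<Omega>)" "bounded (v0 ` closure \<Omega>)"
      using compact_imp_bounded[OF compact_continuous_image[OF c1 cl]]
        compact_imp_bounded[OF compact_continuous_image[OF c2 cl]] .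
    then obtain B1 B2 where "\<forall>x\<in>closure \<Omega>. \<bar>u0 x\<bar> \<le> B1" "\<forall>x\<in>closure \<Omega>. \<bar>v0 x\<bar> \<le> B2"
      unfolding bounded_iff by auto
    then show ?thesis using that[of "max B1 B2"] by (meson abs_le_D1 max.coboundedI1 max.coboundedI2)
  qed
  \<comment> \<open>\<open>F\<close> is not monotone, so \<open>N\<close> has to dominate
    \<open>F\<close> on all of \<open>[0, B]\<close>, not just at the values of \<open>u0\<close>.
    Only then is the composition of \<open>\<phi>\<close> with \<open>F\<close> zero between 0 and
    the initial value, and its primitive zero initially.\<close>
  obtain N where N: "0 \<le> N" "B \<le> N" "\<And>y. 0 \<le> y \<Longrightarrow> y \<le> B \<Longrightarrow> F y \<le> N"
  proof -
    have "bounded (F ` {0..B})"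
      by (intro compact_imp_bounded compact_continuous_image continuous_on_subset[OF F_cont]) auto
    then obtain c where "\<forall>y\<in>{0..B}. \<bar>F y\<bar> \<le> c" unfolding bounded_iff by auto
    then have "F y \<le> max (max 0 B) c" if "0 \<le> y" "y \<le> B" for y
      using that by (meson abs_le_D1 atLeastAtMost_iff max.coboundedI2)
    then show ?thesis by (intro that[of "max (max 0 B) c"]) auto
  qed
  have region: "0 \<le> u (\<epsilon> k) t x" "F (u (\<epsilon> k) t x) \<le> N" "0 \<le> v (\<epsilon> k) t x" "v (\<epsilon> k) t x \<le> N"
    if "0 < t" "x \<in> \<Omega>" for k t x
  proof -
    interpret neumann_reaction_diffusion \<Omega> F "\<epsilon> k" "u (\<epsilon> k)" "v (\<epsilon> k)" "G k" "H k" by (rule nrd)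
    have N': "v (\<epsilon> k) 0 y \<le> N" "\<And>l. 0 \<le> l \<Longrightarrow> l \<le> u (\<epsilon> k) 0 y \<Longrightarrow> F l \<le> N" if "y \<in> closure \<Omega>" for y
      using init[OF that] B[OF that] N by (auto intro: order_trans)
    have nn: "0 \<le> u (\<epsilon> k) 0 y" "0 \<le> v (\<epsilon> k) 0 y" if "y \<in> closure \<Omega>" for y
      using init[OF that] init_nonneg[OF that] by simp_all
    show "0 \<le> u (\<epsilon> k) t x" "F (u (\<epsilon> k) t x) \<le> N" "0 \<le> v (\<epsilon> k) t x" "v (\<epsilon> k) t x \<le> N"
      using invariant_region[OF F_pos F_neg F0 N(1) nn N' that] by simp_all
  qed
  \<comment> \<open>The invariant region bounds \<open>F u\<close>; growth of \<open>F\<close> at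
    infinity converts this into a bound of \<open>u\<close> that is uniform in
    \<open>k\<close>.\<close>
  obtain L where L: "0 \<le> L" "\<And>y. L < y \<Longrightarrow> N < F y"
  proof -
    have "\<forall>\<^sub>F y in at_top. N < F y" using F_top by (simp add: filterlim_at_top_dense)
    then obtain L where "\<And>y. L \<le> y \<Longrightarrow> N < F y" unfolding eventually_at_top_linorder by auto
    then show ?thesis by (intro that[of "max 0 L"]) auto
  qed
  have u_le: "u (\<epsilon> k) t x \<le> L" if "0 < t" "x \<in> \<Omega>" for k t x
    using region(2)[OF that, of k] L(2)[of "u (\<epsilon> k) t x"] by linarith
  obtain P where P: "\<And>y. (P has_real_derivative F y) (at y)" "P 0 = 0"
    using ex_antiderivative[OF F_cont] by blast
  have P_nonneg: "0 \<le> P y" for y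
    by (rule antiderivative_nonneg[OF P]) (use F_pos F_neg F0 in \<open>auto simp: le_less\<close>)
  have P_mono: "P y \<le> P L" if "0 \<le> y" "y \<le> L" for y
    by (rule DERIV_nonneg_imp_nondecreasing[OF that(2)]) (use P F_pos that in fastforce)
  \<comment> \<open>\<open>P L + N\<^sup>2 / 2\<close> bounds the entropy for all \<open>k\<close>
    at all positive times; the other factors are those of the energy estimate. Nothing here depends
    on \<epsilon>.\<close>
  define C where "C = 2 * (P L + N\<^sup>2 / 2) * measure lborel \<Omega>"
  obtain R where R: "\<And>x. x \<in> \<Omega> \<Longrightarrow> norm x \<le> R" using bd by (auto simp: bounded_iff)
  define Dis where "Dis k = neumann_reaction_diffusion.dissipation F (\<epsilon> k) (u (\<epsilon> k)) (v (\<epsilon> k)) (G k)" for k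
  have "\<exists>M. sets M = sets borel \<and> emeasure M UNIV \<le> ennreal C \<and> (AE z in M. norm z \<le> T + (R + N))
    \<and> (\<forall>\<Phi>. smooth_on \<Phi> UNIV \<longrightarrow> bounded (range (d\<xi> \<Phi>)) \<longrightarrow>
        (LINT z|M. d\<xi> \<Phi> z) = (LINT z:?O|lborel. Dis k \<Phi> z))" for k
  proof -
    interpret neumann_reaction_diffusion \<Omega> F "\<epsilon> k" "u (\<epsilon> k)" "v (\<epsilon> k)" "G k" "H k" by (rule nrd)
    have A: "P (u (\<epsilon> k) t x) + (v (\<epsilon> k) t x)\<^sup>2 / 2 \<le> P L + N\<^sup>2 / 2" if "0 < t" "x \<in> \<Omega>" for t x
      using region[OF that, of k] u_le[OF that, of k]
      by (intro add_mono P_mono divide_right_mono power_mono) auto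
    show ?thesis unfolding Dis_def
      by (rule dissipation_measure[OF dissipation_bound[OF P(1) P_nonneg A T, folded C_def] _ _ R T])
        (use region F_pos in auto)
  qed
  then obtain M where M: "\<And>k. sets (M k) = sets borel" "\<And>k. emeasure (M k) UNIV \<le> ennreal C"
    "\<And>k. AE z in M k. norm z \<le> T + (R + N)"
    and M_act: "\<And>k \<Phi>. smooth_on \<Phi> UNIV \<Longrightarrow> bounded (range (d\<xi> \<Phi>)) \<Longrightarrow>
        (LINT z|M k. d\<xi> \<Phi> z) = (LINT z:?O|lborel. Dis k \<Phi> z)"
    by metis
  obtain r Nu where r: "strict_mono (r :: nat \<Rightarrow> nat)" and Nu: "sets Nu = sets borel" "finite_measure Nu"
    and conv: "\<And>f :: real \<times> 'a \<times> real \<Rightarrow> real. continuous_on UNIV f \<Longrightarrow> bounded (range f) \<Longrightarrow>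
      (\<lambda>k. integral\<^sup>L (M (r k)) f) \<longlonglongrightarrow> integral\<^sup>L Nu f"
    using weakly_convergent_subsequence[of M C "T + (R + N)", OF M] by blast
  define n where "n = restrict_space Nu ?Q"
  have "sets n = sets (restrict_space borel ?Q)" unfolding n_def by (rule sets_restrict_space_cong[OF Nu(1)])
  moreover have "finite_measure n" unfolding n_def by (rule finite_measure_restrict_space[OF Nu(2)]) (use oQ Nu in auto)
  moreover have "distr_dt (\<lambda>\<Psi>. kinetic_pushforward T \<Omega> F p \<Psi> + distr_of_fun T \<Omega> q \<Psi>) \<Phi>
         - distr_laplacian_x (distr_of_fun T \<Omega> q) \<Phi> = distr_dxi (distr_of_measure n) \<Phi>"
    if "\<Phi> \<in> test_functions ?Q" for \<Phi>
  proof -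
    define K where "K = closure {z. \<Phi> z \<noteq> 0}"
    have smooth: "smooth_on \<Phi> UNIV" and K: "compact K" "K \<subseteq> ?Q"
      using that by (auto simp: test_functions_def K_def)
    have out: "\<Phi> z = 0" if "z \<notin> K" for z
      using that closure_subset[of "{z. \<Phi> z \<noteq> 0}"] by (auto simp: K_def)
    note zero = dt_dx_d\<xi>_eq_0[OF smooth compact_imp_closed[OF K(1)] out]
    note dcont = continuous_on_dt_dx_d\<xi>[OF smooth]
    define lap where "lap z = (\<Sum>b\<in>Basis. dxx b \<Phi> z)" for z
    have lap_zero: "lap z = 0" if "z \<notin> K" for z
      unfolding lap_def dxx_def
      using dt_dx_d\<xi>_eq_0(2)[OF smooth_on_dx_inner[OF smooth] compact_imp_closed[OF K(1)] _ that] zero(2) by simp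
    have lap_cont: "continuous_on UNIV lap"
      unfolding lap_def[abs_def] dxx_def
      by (intro continuous_intros continuous_on_dt_dx_d\<xi> smooth_on_dx_inner[OF smooth])
    \<comment> \<open>The function of \<open>(t, x, l)\<close> against which the indicator of
      \<open>0 \<le> l \<le> u\<close> is tested.\<close>
    define h where "h z = dt \<Phi> (fst z, fst (snd z), F (snd (snd z)))" for z
    have h_cont: "continuous_on UNIV h"
      unfolding h_def[abs_def]
      by (rule continuous_on_compose2[OF dcont(1)[of UNIV]])
        (auto intro!: continuous_intros continuous_on_compose2[OF F_cont])
    \<comment> \<open>Since \<open>F\<close> tends to infinity at both ends in absolute value, the
      preimage of the compact support is bounded in \<open>l\<close> as well.\<close>
    define K2 where "K2 = {z. (fst z, fst (snd z), F (snd (snd z))) \<in> K}"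
    have K2: "compact K2"
    proof -
      have "bounded K" using K(1) by (rule compact_imp_bounded)
      then obtain b where b: "\<And>z. z \<in> K \<Longrightarrow> norm z \<le> b" by (auto simp: bounded_iff)
      have "\<forall>\<^sub>F y in at_top. b < F y" "\<forall>\<^sub>F y in at_bot. F y < - b"
        using F_top F_bot by (simp_all add: filterlim_at_top_dense filterlim_at_bot_dense)
      then obtain y1 y2 where y: "\<And>y. y1 \<le> y \<Longrightarrow> b < F y" "\<And>y. y \<le> y2 \<Longrightarrow> F y < - b"
        unfolding eventually_at_top_linorder eventually_at_bot_linorder by auto
      have "K2 \<subseteq> cball 0 b \<times> cball 0 b \<times> {y2..y1}"
      proof
        fix z assume z: "z \<in> K2"
        obtain t x l where tx: "z = (t, x, l)" by (cases z)
        have le: "norm (t, x, F l) \<le> b" using z b by (simp add: K2_def tx)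
        have 1: "norm t \<le> b" "norm (x, F l) \<le> b"
          using norm_fst_le[of t "(x, F l)"] norm_snd_le[of "(x, F l)" t] le by (auto simp del: real_norm_def)
        have 2: "norm x \<le> b" "norm (F l) \<le> b"
          using norm_fst_le[of x "F l"] norm_snd_le[of "F l" x] 1(2) by (auto simp del: real_norm_def)
        have "y2 \<le> l" "l \<le> y1"
          using y(1)[of l] y(2)[of l] 2(2) by (auto intro: ccontr)
        then show "z \<in> cball 0 b \<times> cball 0 b \<times> {y2..y1}" using 1 2 by (simp add: tx)
      qed
      then have "bounded K2" by (rule bounded_subset[rotated]) (intro bounded_Times bounded_cball bounded_closed_interval)
      moreover have "closed K2"
      proof -
        have "continuous_on UNIV (\<lambda>z :: real \<times> 'a \<times> real. (fst z, fst (snd z), F (snd (snd z))))"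
          by (intro continuous_intros continuous_on_compose2[OF F_cont]) auto
        from closed_vimage[OF compact_imp_closed[OF K(1)] this]
        show ?thesis by (simp add: K2_def vimage_def)
      qed
      ultimately show ?thesis by (simp add: compact_eq_bounded_closed)
    qed
    have K2Q: "K2 \<subseteq> ?Q" using K(2) by (auto simp: K2_def phase_space_def)
    have h_zero: "h z = 0" if "z \<notin> K2" for z using that zero(1) by (simp add: h_def K2_def)
    have d\<xi>_bd: "bounded (range (d\<xi> \<Phi>))"
    proof -
      have "bounded (d\<xi> \<Phi> ` K)" by (intro compact_imp_bounded compact_continuous_image dcont K)
      then have "bounded (insert 0 (d\<xi> \<Phi> ` K))" by simp
      then show ?thesis by (rule bounded_subset) (use zero(3) in auto)
    qed
    have si: "set_integrable lborel ?Q f" if "continuous_on UNIV f" "compact K'" "K' \<subseteq> ?Q" "\<And>z. z \<notin> K' \<Longrightarrow> f z = 0"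
      for f :: "real \<times> 'a \<times> real \<Rightarrow> real" and K'
      by (rule set_integrable_continuous_compact_support[OF oQ that(2,3) continuous_on_subset[OF that(1)]]) (use that(4) in auto)
    have ph: "set_integrable lborel ?Q h" by (rule si[OF h_cont K2 K2Q h_zero])
    have pt: "set_integrable lborel ?Q (dt \<Phi>)" by (rule si[OF dcont(1) K zero(1)])
    have pl: "set_integrable lborel ?Q lap" by (rule si[OF lap_cont K lap_zero])
    have wc: "continuous_on ?O (\<lambda>z. u (\<epsilon> k) (fst z) (snd z))" "continuous_on ?O (\<lambda>z. v (\<epsilon> k) (fst z) (snd z))" for k
    proof -
      interpret neumann_reaction_diffusion \<Omega> F "\<epsilon> k" "u (\<epsilon> k)" "v (\<epsilon> k)" "G k" "H k" by (rule nrd)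
      show "continuous_on ?O (\<lambda>z. u (\<epsilon> k) (fst z) (snd z))" "continuous_on ?O (\<lambda>z. v (\<epsilon> k) (fst z) (snd z))"
        by (rule continuous_on_subset[OF continuous_on_cylinder(1)], force, rule continuous_on_subset[OF continuous_on_cylinder(2)], force)
    qed
    define I where "I w f k = (LINT z:?Q|lborel. (case z of (t, x, \<xi>) \<Rightarrow> indicator {0..w (\<epsilon> k) t x} \<xi>) * f z)"
      for w :: "real \<Rightarrow> real \<Rightarrow> 'a \<Rightarrow> real" and f :: "real \<times> 'a \<times> real \<Rightarrow> real" and k
    have ident: "(LINT z|M k. d\<xi> \<Phi> z) = I u h k + I v (dt \<Phi>) k + I v lap k" for k
    proof -
      interpret neumann_reaction_diffusion \<Omega> F "\<epsilon> k" "u (\<epsilon> k)" "v (\<epsilon> k)" "G k" "H k" by (rule nrd)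
      have "(LINT z|M k. d\<xi> \<Phi> z) = (LINT z:?O|lborel. dissipation \<Phi> z)"
        using M_act[OF smooth d\<xi>_bd] by (simp add: Dis_def)
      also have "\<dots> = (LINT z:?O|lborel. integral {0..u (\<epsilon> k) (fst z) (snd z)} (\<lambda>l. dt \<Phi> (fst z, snd z, F l)))
        + (LINT z:?O|lborel. integral {0..v (\<epsilon> k) (fst z) (snd z)} (\<lambda>l. dt \<Phi> (fst z, snd z, l)))
        + (LINT z:?O|lborel. integral {0..v (\<epsilon> k) (fst z) (snd z)} (\<lambda>l. \<Sum>b\<in>Basis. dxx b \<Phi> (fst z, snd z, l)))"
        by (rule weak_identity[OF smooth K out region(1) region(3)])
      finally show ?thesis
        using set_integral_subgraph[OF op h_cont K2 K2Q h_zero wc(1)[of k]]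
          set_integral_subgraph[OF op dcont(1) K zero(1) wc(2)[of k]]
          set_integral_subgraph[OF op lap_cont K lap_zero wc(2)[of k]]
        by (simp add: I_def h_def lap_def)
    qed
    have wl: "(\<lambda>k. I w f k) \<longlonglongrightarrow> (LINT z:?Q|lborel. g z * f z)"
      if "Linf_weak_star_limit ?Q (\<lambda>k (t, x, \<xi>). indicator {0..w (\<epsilon> k) t x} \<xi>) g" "set_integrable lborel ?Q f" for w f g
      using that unfolding Linf_weak_star_limit_def I_def by blast
    have "(\<lambda>k. I u h k + I v (dt \<Phi>) k + I v lap k) \<longlonglongrightarrow>
      (LINT z:?Q|lborel. p z * h z) + (LINT z:?Q|lborel. q z * dt \<Phi> z) + (LINT z:?Q|lborel. q z * lap z)"
      by (intro tendsto_add wl assms(8,9) ph pt pl)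
    \<comment> \<open>The indicators converge along the whole given sequence, hence also along the
      subsequence \<open>r\<close>, which was selected for the measures alone and does not depend on
      the test function.\<close>
    from LIMSEQ_subseq_LIMSEQ[OF this r]
    have "(\<lambda>k. integral\<^sup>L (M (r k)) (d\<xi> \<Phi>)) \<longlonglongrightarrow>
      (LINT z:?Q|lborel. p z * h z) + (LINT z:?Q|lborel. q z * dt \<Phi> z) + (LINT z:?Q|lborel. q z * lap z)"
      by (simp add: ident o_def)
    from LIMSEQ_unique[OF conv[OF dcont(3) d\<xi>_bd] this]
    have main: "integral\<^sup>L Nu (d\<xi> \<Phi>) = (LINT z:?Q|lborel. p z * h z) + (LINT z:?Q|lborel. q z * dt \<Phi> z)
      + (LINT z:?Q|lborel. q z * lap z)" .
    \<comment> \<open>\<open>d\<xi> \<Phi>\<close> vanishes outside the phase space, so whatever the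
      restriction removed from \<open>Nu\<close> is not seen.\<close>
    have n_act: "(LINT z|n. d\<xi> \<Phi> z) = integral\<^sup>L Nu (d\<xi> \<Phi>)"
    proof -
      have "(LINT z|n. d\<xi> \<Phi> z) = (LINT z|Nu. indicator ?Q z *\<^sub>R d\<xi> \<Phi> z)"
        unfolding n_def by (rule integral_restrict_space) (use oQ Nu(1) sets_eq_imp_space_eq[OF Nu(1)] in auto)
      also have "\<dots> = integral\<^sup>L Nu (d\<xi> \<Phi>)"
        using zero(3) K(2) by (intro Bochner_Integration.integral_cong) (auto simp: indicator_def)
      finally show ?thesis .
    qed
    \<comment> \<open>Integrability for Fubini: the push-forward is defined by an iterated integral,
      the weak limit acts by an integral over phase space.\<close>
    have ph': "set_integrable lborel ?Q (\<lambda>z. p z * h z)"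
      unfolding set_integrable_def
    proof -
      obtain c where c: "AE z in lborel. z \<in> ?Q \<longrightarrow> \<bar>p z\<bar> \<le> c" and pm: "set_borel_measurable lborel ?Q p"
        using assms(8) by (auto simp: Linf_weak_star_limit_def Linf_on_def)
      show "integrable lborel (\<lambda>z. indicator ?Q z *\<^sub>R (p z * h z))"
      proof (rule Bochner_Integration.integrable_bound)
        show "integrable lborel (\<lambda>z. c * (indicator ?Q z *\<^sub>R h z))"
          using ph by (simp add: set_integrable_def)
        have "(\<lambda>z. (indicator ?Q z *\<^sub>R p z) * h z) \<in> borel_measurable lborel"
          using pm h_cont unfolding set_borel_measurable_def
          by (intro borel_measurable_times) (auto intro: borel_measurable_continuous_onI)
        then show "(\<lambda>z. indicator ?Q z *\<^sub>R (p z * h z)) \<in> borel_measurable lborel" by (simp add: mult.assoc)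
        show "AE z in lborel. norm (indicator ?Q z *\<^sub>R (p z * h z)) \<le> norm (c * (indicator ?Q z *\<^sub>R h z))"
          using c
        proof eventually_elim
          case (elim z)
          show ?case
          proof (cases "z \<in> ?Q")
            case True
            then have "\<bar>p z\<bar> * \<bar>h z\<bar> \<le> \<bar>c\<bar> * \<bar>h z\<bar>" using elim by (intro mult_right_mono) auto
            then show ?thesis using True by (simp add: abs_mult)
          qed simp
        qed
      qed
    qed
    have dt_eq: "(\<lambda>(t, x, \<xi>). deriv (\<lambda>s. \<Phi> (s, x, \<xi>)) t) = dt \<Phi>"
      using DERIV_imp_deriv[OF DERIV_t[OF smooth]] by (auto simp: fun_eq_iff)
    have dxi_eq: "(\<lambda>(t, x, \<xi>). deriv (\<lambda>\<eta>. \<Phi> (t, x, \<eta>)) \<xi>) = d\<xi> \<Phi>"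
      using DERIV_imp_deriv[OF DERIV_\<xi>[OF smooth]] by (auto simp: fun_eq_iff)
    have lap_eq: "(\<lambda>(t, x, \<xi>). laplacian (\<lambda>y. \<Phi> (t, y, \<xi>)) x) = lap"
      using laplacian_x[OF smooth] by (auto simp: fun_eq_iff lap_def)
    have "kinetic_pushforward T \<Omega> F p (dt \<Phi>) = (LINT z:?Q|lborel. p z * h z)"
      unfolding kinetic_pushforward_def pushforward_distr_def
      using set_integral_phase_space[OF ph'] by (simp add: h_def)
    \<comment> \<open>The derivatives in \<open>t\<close> and \<open>\<xi>\<close> carry a minus
      sign by duality and the Laplacian carries none, so the claim is \<open>main\<close> multiplied
      by -1.\<close>
    then show ?thesis
      unfolding distr_dt_def distr_dxi_def distr_laplacian_x_def dt_eq dxi_eq lap_eq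
      by (simp add: distr_of_fun_def distr_of_measure_def n_act main)
  qed
  ultimately show ?thesis by blast
qed

end
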